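(* Let $\sigma_0>0$ and let the reward be purely rank-dependent, i.e. $R(x,r)=R(r)$ does not depend on $x$, where $R:[0,1]\to\mathbb{R}$ is bounded, continuous and non-decreasing. Let $\bar\mu\in\mathcal{P}(\mathbb{R})$ be a (deterministic) equilibrium measure of the mean field game without common noise MFG$_0$. Then the random measure $$\mu:=\bar\mu(\cdot-\sigma_0W_T)$$ is a (random) equilibrium measure of the mean field game with common noise MFG$_{cn}$. Moreover, the optimal control associated with $\bar\mu$ for MFG$_0$, i.e. the process $a_t=(2c)^{-1}v_x(t,X^\circ_t;\bar\mu)$ where $dX^\circ_t=\frac{v_x(t,X^\circ_t;\bar\mu)}{2c}dt+\sigma\,dB_t$, $X^\circ_0=0$, is also an optimal open loop control associated with $\mu$ for MFG$_{cn}$.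
   Context: Fix constants $T>0$, $c>0$, $\sigma>0$. $\mathcal{P}(\mathbb{R})$ is the set of Borel probability measures on $\mathbb{R}$; for $\mu\in\mathcal{P}(\mathbb{R})$, $F_\mu(x)=\mu(-\infty,x]$ and $R_\mu(x):=R(F_\mu(x))$. For $q\in\mathbb{R}$, $\mu(\cdot+q)$ denotes the measure obtained by shifting $\mu$ to the left by $q$: $\mu(\cdot+q)(A)=\mu(A+q)$, so $F_{\mu(\cdot+q)}(x)=F_\mu(x+q)$. $B$ and $W$ are independent standard Brownian motions on a filtered probability space (Brownian with respect to the filtration). Admissible controls are progressively measurable processes $a$ with $\mathbb{E}\int_0^T|a_s|ds<\infty$. MFG$_0$ (no common noise). For deterministic $\mu\in\mathcal{P}(\mathbb{R})$ let $$v(t,x;\mu):=\sup_a \mathbb{E}_{t,x}\Big[R_\mu(X_T)-\int_t^T c\,a_s^2\,ds\Big],\qquad dX_s=a_s\,ds+\sigma\,dB_s,\ X_t=x,$$ over admissible $a$. Explicitly, $v=2c\sigma^2\log u$ with $u(t,x;\mu)=\mathbb{E}\big[\exp\big(\tfrac{1}{2c\sigma^2}R_\mu(x+\sigma\sqrt{T-t}\,Z)\big)\big]$, $Z$ standard normal; $v$ is smooth in $x$ for $t<T$, and $v_x$ is its $x$-derivative. Let $X^\mu$ be the strong solution of $dX_t=\frac{v_x(t,X_t;\mu)}{2c}dt+\sigma dB_t$, $X_0=0$, on $[0,T)$, extended to $t=T$ by its (existing) limit. An equilibrium measure of MFG$_0$ is a $\bar\mu\in\mathcal{P}(\mathbb{R})$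 with $\bar\mu=\mathcal{L}(X^{\bar\mu}_T)$, where $\mathcal{L}$ denotes law. MFG$_{cn}$ (common noise). For a random probability measure $\mu$ on $\mathbb{R}$ whose randomness comes from $W$ (i.e. $\sigma(W)$-measurable), consider $$V(\mu)=\sup_a\mathbb{E}\Big[R_\mu(X_T)-\int_0^T c\,a_s^2\,ds\Big],\qquad dX_s=a_s\,ds+\sigma\,dB_s+\sigma_0\,dW_s,\ X_0=0,$$ over admissible (open loop) controls $a$. An admissible $a$ attaining the supremum is called an optimal open loop control associated with $\mu$, and the corresponding state is denoted $X^\mu$. The random measure $\mu$ is an equilibrium measure of MFG$_{cn}$ if it is a fixed point of $\mu\mapsto\mathcal{L}(X^\mu_T\mid W)$, i.e. $\mu=\mathcal{L}(X^\mu_T\mid W)$ a.s. for an optimally controlled state $X^\mu$. *)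

theory Defs
  imports "HOL-Probability.Probability"
begin

text \<open>
  Processes are functions of type \<open>real \<Rightarrow> 'a \<Rightarrow> real\<close> (time, then sample point). Only their
  restriction to the time interval \<open>{0..T}\<close> matters. A filtration is a family
  \<open>F :: real \<Rightarrow> 'a measure\<close> of sub-sigma-algebras of \<open>M\<close>; only \<open>sets (F t)\<close> for \<open>t\<close> in
  \<open>{0..T}\<close> matters. No usual conditions are imposed on it.
\<close>

definition preimages :: "'a measure \<Rightarrow> ('a \<Rightarrow> real) \<Rightarrow> 'a set set" where
  "preimages M X = {X -` A \<inter> space M | A. A \<in> sets borel}"

definition history :: "'a measure \<Rightarrow> (real \<Rightarrow> 'a \<Rightarrow> real) \<Rightarrow> real \<Rightarrow> 'a measure" where
  "history M X t = sigma (space M) (\<Union>s\<in>{0..t}. preimages M (X s))"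

definition augmented_history :: "'a measure \<Rightarrow> (real \<Rightarrow> 'a \<Rightarrow> real) \<Rightarrow> real \<Rightarrow> 'a measure" where
  "augmented_history M X t = sigma (space M) (sets (history M X t) \<union> null_sets M)"

definition brownian_motion ::
  "'a measure \<Rightarrow> (real \<Rightarrow> 'a measure) \<Rightarrow> real \<Rightarrow> (real \<Rightarrow> 'a \<Rightarrow> real) \<Rightarrow> bool" where
  "brownian_motion M F T B \<longleftrightarrow>
     (\<forall>t\<in>{0..T}. B t \<in> borel_measurable (F t)) \<and>
     (AE \<omega> in M. B 0 \<omega> = 0) \<and>
     (AE \<omega> in M. continuous_on {0..T} (\<lambda>t. B t \<omega>)) \<and>
     (\<forall>s t. 0 \<le> s \<longrightarrow> s < t \<longrightarrow> t \<le> T \<longrightarrow>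
        distributed M lborel (\<lambda>\<omega>. B t \<omega> - B s \<omega>) (normal_density 0 (sqrt (t - s))) \<and>
        prob_space.indep_set M (sets (F s)) (preimages M (\<lambda>\<omega>. B t \<omega> - B s \<omega>)))"

definition progressively_measurable ::
  "(real \<Rightarrow> 'a measure) \<Rightarrow> real \<Rightarrow> (real \<Rightarrow> 'a \<Rightarrow> real) \<Rightarrow> bool" where
  "progressively_measurable F T a \<longleftrightarrow>
     (\<forall>t\<in>{0..T}. (\<lambda>(s, \<omega>). a s \<omega>)
        \<in> borel_measurable (restrict_space borel {0..t} \<Otimes>\<^sub>M F t))"

definition admissible ::
  "'a measure \<Rightarrow> (real \<Rightarrow> 'a measure) \<Rightarrow> real \<Rightarrow> (real \<Rightarrow> 'a \<Rightarrow> real) set" where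
  "admissible M F T = {a. progressively_measurable F T a \<and>
     (\<integral>\<^sup>+\<omega>. (\<integral>\<^sup>+s\<in>{0..T}. ennreal \<bar>a s \<omega>\<bar> \<partial>lborel) \<partial>M) < \<infinity>}"

definition rank_reward :: "(real \<Rightarrow> real) \<Rightarrow> real measure \<Rightarrow> real \<Rightarrow> real" where
  "rank_reward R \<mu> x = R (cdf \<mu> x)"

text \<open>
  The shift of \<open>\<mu>\<close> to the left by \<open>q\<close>: it assigns the mass \<open>\<mu> (A + q)\<close> to \<open>A\<close>.
\<close>

definition shift_measure :: "real measure \<Rightarrow> real \<Rightarrow> real measure" where
  "shift_measure \<mu> q = distr \<mu> borel (\<lambda>x. x - q)"

text \<open>
  \<open>expected_payoff M c T t Y a\<close> is the expectation of \<open>Y - \<integral>\<^bsub>t\<^esub>\<^bsup>T\<^esup> c (a s)\<^sup>2 ds\<close>. It is used for a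
  bounded terminal reward \<open>Y\<close>; an admissible control need not be square integrable, so the
  value may be \<open>-\<infinity>\<close>.
\<close>

definition expected_payoff ::
  "'a measure \<Rightarrow> real \<Rightarrow> real \<Rightarrow> real \<Rightarrow> ('a \<Rightarrow> real) \<Rightarrow> (real \<Rightarrow> 'a \<Rightarrow> real) \<Rightarrow> ereal" where
  "expected_payoff M c T t Y a =
     ereal (\<integral>\<omega>. Y \<omega> \<partial>M)
     - enn2ereal (\<integral>\<^sup>+\<omega>. (\<integral>\<^sup>+s\<in>{t..T}. ennreal (c * (a s \<omega>)\<^sup>2) \<partial>lborel) \<partial>M)"


subsection \<open>The game without common noise\<close>

definition mfg0_terminal_state ::
  "(real \<Rightarrow> 'a \<Rightarrow> real) \<Rightarrow> real \<Rightarrow> real \<Rightarrow> real \<Rightarrow> real \<Rightarrow> (real \<Rightarrow> 'a \<Rightarrow> real) \<Rightarrow> 'a \<Rightarrow> real" where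
  "mfg0_terminal_state B T \<sigma> t x a \<omega> =
     x + (LINT s:{t..T}|lborel. a s \<omega>) + \<sigma> * (B T \<omega> - B t \<omega>)"

text \<open>
  The supremum is finite, since \<open>R\<close> is bounded and the control \<open>0\<close> is admissible. Admissible
  controls on \<open>{t..T}\<close> are the restrictions of those on \<open>{0..T}\<close> (extend by \<open>0\<close>).
\<close>

definition mfg0_value ::
  "'a measure \<Rightarrow> (real \<Rightarrow> 'a measure) \<Rightarrow> (real \<Rightarrow> 'a \<Rightarrow> real) \<Rightarrow> real \<Rightarrow> real \<Rightarrow> real \<Rightarrow>
   (real \<Rightarrow> real) \<Rightarrow> real measure \<Rightarrow> real \<Rightarrow> real \<Rightarrow> real" where
  "mfg0_value M F B T c \<sigma> R \<mu> t x =
     real_of_ereal (SUP a\<in>admissible M F T.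
       expected_payoff M c T t (\<lambda>\<omega>. rank_reward R \<mu> (mfg0_terminal_state B T \<sigma> t x a \<omega>)) a)"

definition mfg0_drift ::
  "'a measure \<Rightarrow> (real \<Rightarrow> 'a measure) \<Rightarrow> (real \<Rightarrow> 'a \<Rightarrow> real) \<Rightarrow> real \<Rightarrow> real \<Rightarrow> real \<Rightarrow>
   (real \<Rightarrow> real) \<Rightarrow> real measure \<Rightarrow> real \<Rightarrow> real \<Rightarrow> real" where
  "mfg0_drift M F B T c \<sigma> R \<mu> t x = deriv (mfg0_value M F B T c \<sigma> R \<mu> t) x / (2 * c)"

text \<open>
  Strong solution on \<open>[0,T)\<close> of the optimally controlled equation started at \<open>0\<close>, extended to
  time \<open>T\<close> by its left limit. As the noise is additive, the equation only involves a Lebesgue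
  integral. Strong means adapted to the augmented filtration generated by \<open>B\<close>; progressive
  measurability is asked separately because \<open>F\<close> need not contain the null sets.
\<close>

definition mfg0_optimal_state ::
  "'a measure \<Rightarrow> (real \<Rightarrow> 'a measure) \<Rightarrow> (real \<Rightarrow> 'a \<Rightarrow> real) \<Rightarrow> real \<Rightarrow> real \<Rightarrow> real \<Rightarrow>
   (real \<Rightarrow> real) \<Rightarrow> real measure \<Rightarrow> (real \<Rightarrow> 'a \<Rightarrow> real) \<Rightarrow> bool" where
  "mfg0_optimal_state M F B T c \<sigma> R \<mu> X \<longleftrightarrow>
     progressively_measurable F T X \<and>
     (\<forall>t\<in>{0..T}. X t \<in> borel_measurable (augmented_history M B t)) \<and>
     (AE \<omega> in M.
        X 0 \<omega> = 0 \<and>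
        (\<forall>t\<in>{0..<T}.
           set_integrable lborel {0..t} (\<lambda>s. mfg0_drift M F B T c \<sigma> R \<mu> s (X s \<omega>)) \<and>
           X t \<omega> = (LINT s:{0..t}|lborel. mfg0_drift M F B T c \<sigma> R \<mu> s (X s \<omega>)) + \<sigma> * B t \<omega>) \<and>
        ((\<lambda>t. X t \<omega>) \<longlongrightarrow> X T \<omega>) (at_left T))"

definition mfg0_equilibrium ::
  "'a measure \<Rightarrow> (real \<Rightarrow> 'a measure) \<Rightarrow> (real \<Rightarrow> 'a \<Rightarrow> real) \<Rightarrow> real \<Rightarrow> real \<Rightarrow> real \<Rightarrow>
   (real \<Rightarrow> real) \<Rightarrow> real measure \<Rightarrow> bool" where
  "mfg0_equilibrium M F B T c \<sigma> R \<mu> \<longleftrightarrow>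
     sets \<mu> = sets borel \<and> prob_space \<mu> \<and>
     (\<exists>X. mfg0_optimal_state M F B T c \<sigma> R \<mu> X \<and> \<mu> = distr M borel (X T))"

text \<open>
  The value function need not be differentiable in \<open>x\<close> at the terminal time, so the control is
  set to \<open>0\<close> there.
\<close>

definition mfg0_optimal_control ::
  "'a measure \<Rightarrow> (real \<Rightarrow> 'a measure) \<Rightarrow> (real \<Rightarrow> 'a \<Rightarrow> real) \<Rightarrow> real \<Rightarrow> real \<Rightarrow> real \<Rightarrow>
   (real \<Rightarrow> real) \<Rightarrow> real measure \<Rightarrow> (real \<Rightarrow> 'a \<Rightarrow> real) \<Rightarrow> real \<Rightarrow> 'a \<Rightarrow> real" where
  "mfg0_optimal_control M F B T c \<sigma> R \<mu> X t \<omega> =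
     (if t < T then mfg0_drift M F B T c \<sigma> R \<mu> t (X t \<omega>) else 0)"


subsection \<open>The game with common noise\<close>

definition mfg_cn_terminal_state ::
  "(real \<Rightarrow> 'a \<Rightarrow> real) \<Rightarrow> (real \<Rightarrow> 'a \<Rightarrow> real) \<Rightarrow> real \<Rightarrow> real \<Rightarrow> real \<Rightarrow>
   (real \<Rightarrow> 'a \<Rightarrow> real) \<Rightarrow> 'a \<Rightarrow> real" where
  "mfg_cn_terminal_state B W T \<sigma> \<sigma>0 a \<omega> =
     (LINT s:{0..T}|lborel. a s \<omega>) + \<sigma> * B T \<omega> + \<sigma>0 * W T \<omega>"

definition mfg_cn_payoff ::
  "'a measure \<Rightarrow> (real \<Rightarrow> 'a \<Rightarrow> real) \<Rightarrow> (real \<Rightarrow> 'a \<Rightarrow> real) \<Rightarrow> real \<Rightarrow> real \<Rightarrow> real \<Rightarrow> real \<Rightarrow>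
   (real \<Rightarrow> real) \<Rightarrow> ('a \<Rightarrow> real measure) \<Rightarrow> (real \<Rightarrow> 'a \<Rightarrow> real) \<Rightarrow> ereal" where
  "mfg_cn_payoff M B W T c \<sigma> \<sigma>0 R \<mu> a =
     expected_payoff M c T 0
       (\<lambda>\<omega>. rank_reward R (\<mu> \<omega>) (mfg_cn_terminal_state B W T \<sigma> \<sigma>0 a \<omega>)) a"

definition mfg_cn_optimal_control ::
  "'a measure \<Rightarrow> (real \<Rightarrow> 'a measure) \<Rightarrow> (real \<Rightarrow> 'a \<Rightarrow> real) \<Rightarrow> (real \<Rightarrow> 'a \<Rightarrow> real) \<Rightarrow>
   real \<Rightarrow> real \<Rightarrow> real \<Rightarrow> real \<Rightarrow> (real \<Rightarrow> real) \<Rightarrow> ('a \<Rightarrow> real measure) \<Rightarrow>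
   (real \<Rightarrow> 'a \<Rightarrow> real) \<Rightarrow> bool" where
  "mfg_cn_optimal_control M F B W T c \<sigma> \<sigma>0 R \<mu> a \<longleftrightarrow>
     a \<in> admissible M F T \<and>
     mfg_cn_payoff M B W T c \<sigma> \<sigma>0 R \<mu> a
       = (SUP b\<in>admissible M F T. mfg_cn_payoff M B W T c \<sigma> \<sigma>0 R \<mu> b)"

text \<open>
  \<open>\<kappa>\<close> is a version of the regular conditional law of \<open>X\<close> given \<open>G\<close>. Such versions are
  determined up to almost sure equality.
\<close>

definition conditional_law ::
  "'a measure \<Rightarrow> 'a measure \<Rightarrow> ('a \<Rightarrow> real) \<Rightarrow> ('a \<Rightarrow> real measure) \<Rightarrow> bool" where
  "conditional_law M G X \<kappa> \<longleftrightarrow>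
     \<kappa> \<in> G \<rightarrow>\<^sub>M prob_algebra borel \<and>
     (\<forall>A\<in>sets borel. AE \<omega> in M.
        measure (\<kappa> \<omega>) A = real_cond_exp M G (indicator (X -` A \<inter> space M)) \<omega>)"

definition mfg_cn_equilibrium ::
  "'a measure \<Rightarrow> (real \<Rightarrow> 'a measure) \<Rightarrow> (real \<Rightarrow> 'a \<Rightarrow> real) \<Rightarrow> (real \<Rightarrow> 'a \<Rightarrow> real) \<Rightarrow>
   real \<Rightarrow> real \<Rightarrow> real \<Rightarrow> real \<Rightarrow> (real \<Rightarrow> real) \<Rightarrow> ('a \<Rightarrow> real measure) \<Rightarrow> bool" where
  "mfg_cn_equilibrium M F B W T c \<sigma> \<sigma>0 R \<mu> \<longleftrightarrow>
     \<mu> \<in> history M W T \<rightarrow>\<^sub>M prob_algebra borel \<and>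
     (\<exists>a. mfg_cn_optimal_control M F B W T c \<sigma> \<sigma>0 R \<mu> a \<and>
          conditional_law M (history M W T) (mfg_cn_terminal_state B W T \<sigma> \<sigma>0 a) \<mu>)"

end

theory Submission
  imports Defs
begin

text \<open>
  Under \<open>\<mu>bar (\<cdot> - \<sigma>0 W\<^sub>T)\<close> the rank of \<open>X\<^sub>T\<close> is that of \<open>X\<^sub>T - \<sigma>0 W\<^sub>T\<close> under \<open>\<mu>bar\<close>, so the common
  noise cancels and a control has the same payoff in both games. What remains is a verification
  theorem for \<open>v = 2 c \<sigma>\<^sup>2 log u\<close> among all adapted controls. It is proved by time
  discretisation instead of Ito's formula.

  Over one time step of length \<open>h\<close>, a Gaussian shift and Jensen's inequality (the Gibbs variational
  principle) show that \<open>E v\<close> minus the cost of a frozen control cannot increase, and that it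
  decreases by only \<open>O (h\<^sup>2)\<close> for the control \<open>v\<^sub>x / (2 c)\<close>, because \<open>v\<close> has a Lipschitz derivative
  in \<open>x\<close> away from \<open>T\<close>. For the upper bound an arbitrary control is replaced by its averages over
  the preceding time steps, which are adapted and no more expensive. For the lower bound one uses
  Euler controls, and for optimality the feedback process itself. The reward need not be continuous
  in \<open>x\<close>; upper semicontinuity suffices, with Lipschitz sup-convolutions as approximations.
\<close>

section \<open>Gaussian smoothing and the log-Laplace transform\<close>

text \<open>The feedback is defined through the derivative of a supremum, so \<open>v\<close> has to
  be identified for every starting time before \<open>T\<close> and every starting point; Euler
  controls show that the supremum is not smaller than the explicit formula. Dividing the reward by
  \<open>2 * c * \<sigma>\<^sup>2\<close> turns the running cost into
  \<open>a\<^sup>2 / (2 * \<sigma>\<^sup>2)\<close>, the relative entropy rate of a drift. The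
  obstacle is the terminal time: the reward may jump there, and the bounds on the slope of
  \<open>v\<close> and on its Lipschitz constant grow like \<open>1 / sqrt (T - t)\<close> and
  \<open>1 / (T - t)\<close>. Hence the reverse estimates stop at a positive distance from
  \<open>T\<close>, and square integrability of the feedback is a consequence of the inequalities
  before \<open>T\<close>. The distribution function helps twice: being monotone, it has countably
  many jumps, which a nondegenerate Gaussian does not see; being right-continuous as well, it yields
  an upper semicontinuous reward, and Lipschitz approximations from above point in the right
  direction for limits at \<open>T\<close>. Competing controls may react to \<open>W\<close>;
  independence of \<open>B\<close> and \<open>W\<close> enters only through the conditional
  law.\<close>

abbreviation \<gamma> :: "real measure" where "\<gamma> \<equiv> std_normal_distribution"

interpretation gauss: prob_space \<gamma>
  by (rule prob_space_normal_density) simp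

lemma sets_gauss [measurable_cong]: "sets \<gamma> = sets borel"
  by simp

lemma measure_gauss_UNIV [simp]: "measure \<gamma> UNIV = 1"
  using gauss.prob_space by simp

text \<open>One-dimensional Cameron-Martin formula: the weight is the quotient of the shifted
  density and the original one. Integrability is transferred too, because tilted integrands need not
  be bounded.\<close>

lemma gauss_shift:
  fixes f :: "real \<Rightarrow> real"
  assumes [measurable]: "f \<in> borel_measurable borel"
  shows gauss_shift_integral: "(\<integral>z. f z \<partial>\<gamma>) = (\<integral>z. f (z + \<theta>) * exp (- \<theta> * z - \<theta>\<^sup>2 / 2) \<partial>\<gamma>)"
    and gauss_shift_integrable: "integrable \<gamma> f \<longleftrightarrow> integrable \<gamma> (\<lambda>z. f (z + \<theta>) * exp (- \<theta> * z - \<theta>\<^sup>2 / 2))"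
proof -
  have eq: "std_normal_density (\<theta> + z) = std_normal_density z * exp (- \<theta> * z - \<theta>\<^sup>2 / 2)" for z
    by (simp add: std_normal_density_def exp_add [symmetric] power2_eq_square field_simps)
  have "(\<integral>z. f z \<partial>\<gamma>) = (\<integral>z. std_normal_density z * f z \<partial>lborel)"
    by (simp add: integral_density)
  also have "\<dots> = (\<integral>z. std_normal_density (\<theta> + z) * f (\<theta> + z) \<partial>lborel)"
    using lborel_integral_real_affine[of 1 "\<lambda>z. std_normal_density z * f z" \<theta>] by simp
  also have "\<dots> = (\<integral>z. f (z + \<theta>) * exp (- \<theta> * z - \<theta>\<^sup>2 / 2) \<partial>\<gamma>)"
    by (simp add: integral_density eq add.commute[of _ \<theta>] mult_ac)
  finally show "(\<integral>z. f z \<partial>\<gamma>) = (\<integral>z. f (z + \<theta>) * exp (- \<theta> * z - \<theta>\<^sup>2 / 2) \<partial>\<gamma>)" .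
  have "integrable \<gamma> f \<longleftrightarrow> integrable lborel (\<lambda>z. std_normal_density z * f z)"
    by (simp add: integrable_density)
  also have "\<dots> \<longleftrightarrow> integrable lborel (\<lambda>z. std_normal_density (\<theta> + z) * f (\<theta> + z))"
    using lborel_integrable_real_affine_iff[of 1 "\<lambda>z. std_normal_density z * f z" \<theta>] by simp
  also have "\<dots> \<longleftrightarrow> integrable \<gamma> (\<lambda>z. f (z + \<theta>) * exp (- \<theta> * z - \<theta>\<^sup>2 / 2))"
    by (simp add: integrable_density eq add.commute[of _ \<theta>] mult_ac)
  finally show "integrable \<gamma> f \<longleftrightarrow> integrable \<gamma> (\<lambda>z. f (z + \<theta>) * exp (- \<theta> * z - \<theta>\<^sup>2 / 2))" .
qed

text \<open>Shifting the constant \<open>1\<close> by \<open>- k\<close> leaves only the weight,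
  which is this exponential up to a constant factor.\<close>

lemma integrable_gauss_exp: "integrable \<gamma> (\<lambda>z. exp (k * z))"
proof -
  have "integrable \<gamma> (\<lambda>z. 1 * exp (- (- k) * z - (- k)\<^sup>2 / 2))"
    using gauss_shift_integrable[of "\<lambda>_. 1" "- k"] by simp
  then have "integrable \<gamma> (\<lambda>z. exp (k\<^sup>2 / 2) * exp (k * z - k\<^sup>2 / 2))"
    by simp
  then show ?thesis
    by (simp add: exp_add [symmetric])
qed

lemma integrable_gauss_exp_abs: "integrable \<gamma> (\<lambda>z. exp (k * \<bar>z\<bar>))"
proof (rule Bochner_Integration.integrable_bound)
  show "integrable \<gamma> (\<lambda>z. exp (k * z) + exp (- k * z))"
    using integrable_gauss_exp[of k] integrable_gauss_exp[of "- k"] by simp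
  show "AE z in \<gamma>. norm (exp (k * \<bar>z\<bar>)) \<le> norm (exp (k * z) + exp (- k * z))"
  proof (intro AE_I2)
    fix z :: real
    have "exp (k * \<bar>z\<bar>) \<le> exp (k * z) + exp (- k * z)"
      by (cases "z < 0") auto
    then show "norm (exp (k * \<bar>z\<bar>)) \<le> norm (exp (k * z) + exp (- k * z))" by simp
  qed
qed simp

text \<open>Polynomial factors are absorbed by an exponential of \<open>\<bar>z\<bar>\<close>, so
  this one criterion serves the weighted and tilted integrands.\<close>

lemma integrable_gauss_exp_bound:
  assumes [measurable]: "g \<in> borel_measurable borel"
    and "\<And>z. \<bar>g z\<bar> \<le> C * exp (k * \<bar>z\<bar>)"
  shows "integrable \<gamma> g"
proof (rule Bochner_Integration.integrable_bound)
  show "integrable \<gamma> (\<lambda>z. C * exp (k * \<bar>z\<bar>))"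
    by (simp add: integrable_gauss_exp_abs)
  show "AE z in \<gamma>. norm (g z) \<le> norm (C * exp (k * \<bar>z\<bar>))"
    using assms(2) by (intro AE_I2) (auto intro: order_trans[OF _ abs_ge_self])
qed simp

lemma abs_le_exp_abs: "\<bar>z\<bar> \<le> exp \<bar>z :: real\<bar>"
  using exp_ge_add_one_self[of "\<bar>z\<bar>"] by linarith

lemma integrable_gauss_id: "integrable \<gamma> (\<lambda>z. z)"
  by (rule integrable_gauss_exp_bound[of _ 1 1]) (auto simp: abs_le_exp_abs)

lemma integral_gauss_id: "(\<integral>z. z \<partial>\<gamma>) = 0"
  using integral_std_normal_moment_odd[of 0] by (simp add: integral_density)

lemma exp_taylor2: "\<bar>exp w - 1 - w\<bar> \<le> w\<^sup>2 * exp \<bar>w\<bar>" for w :: real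
proof -
  obtain t where t: "\<bar>t\<bar> \<le> \<bar>w\<bar>" "exp w = (\<Sum>m<2. w ^ m / fact m) + exp t / fact 2 * w ^ 2"
    using Maclaurin_exp_le[of w 2] by auto
  have "exp w - 1 - w = exp t / 2 * w\<^sup>2"
    using t(2) by (simp add: numeral_2_eq_2)
  then have "\<bar>exp w - 1 - w\<bar> = exp t / 2 * w\<^sup>2"
    by (simp only: abs_mult) simp
  also have "\<dots> \<le> exp \<bar>w\<bar> * w\<^sup>2"
  proof (intro mult_right_mono)
    have "exp t \<le> exp \<bar>w\<bar>" using t(1) by simp
    then show "exp t / 2 \<le> exp \<bar>w\<bar>" using exp_gt_zero[of "\<bar>w\<bar>"] by linarith
  qed simp
  finally show ?thesis by (simp add: mult.commute)
qed

text \<open>Gaussian convolution, parametrised by the standard deviation instead of time: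
  \<open>s = 0\<close> is the identity, and composition adds squares.\<close>

definition heat :: "real \<Rightarrow> (real \<Rightarrow> real) \<Rightarrow> real \<Rightarrow> real" where
  "heat s f x = (\<integral>z. f (x + s * z) \<partial>\<gamma>)"

text \<open>The Cole-Hopf transform. For the reward divided by
  \<open>2 * c * \<sigma>\<^sup>2\<close> it is the value function in the same units.\<close>

definition loglap :: "real \<Rightarrow> (real \<Rightarrow> real) \<Rightarrow> real \<Rightarrow> real" where
  "loglap s f x = ln (heat s (\<lambda>y. exp (f y)) x)"

text \<open>The \<open>x\<close>-derivative of \<open>heat\<close> after Gaussian integration by
  parts: the derivative falls on the density, so \<open>f\<close> may jump.\<close>

definition heat_slope :: "real \<Rightarrow> (real \<Rightarrow> real) \<Rightarrow> real \<Rightarrow> real" where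
  "heat_slope s f x = (\<integral>z. f (x + s * z) * z \<partial>\<gamma>) / s"

text \<open>The derivative of \<open>loglap\<close> for \<open>0 < s\<close>; up to the factor
  \<open>\<sigma>\<^sup>2\<close> it is the optimal feedback.\<close>

definition score :: "real \<Rightarrow> (real \<Rightarrow> real) \<Rightarrow> real \<Rightarrow> real" where
  "score s f x = heat_slope s (\<lambda>y. exp (f y)) x / heat s (\<lambda>y. exp (f y)) x"

section \<open>Measurability and elementary bounds\<close>

lemma measurable_heat [measurable]:
  assumes [measurable]: "f \<in> borel_measurable borel" "s \<in> borel_measurable N" "g \<in> borel_measurable N"
  shows "(\<lambda>x. heat (s x) f (g x)) \<in> borel_measurable N"
  unfolding heat_def by measurable

lemma measurable_heat_slope [measurable]:
  assumes [measurable]: "f \<in> borel_measurable borel" "s \<in> borel_measurable N" "g \<in> borel_measurable N"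
  shows "(\<lambda>x. heat_slope (s x) f (g x)) \<in> borel_measurable N"
  unfolding heat_slope_def by measurable

lemma measurable_loglap [measurable]:
  assumes [measurable]: "f \<in> borel_measurable borel" "s \<in> borel_measurable N" "g \<in> borel_measurable N"
  shows "(\<lambda>x. loglap (s x) f (g x)) \<in> borel_measurable N"
  unfolding loglap_def by measurable

lemma measurable_score [measurable]:
  assumes [measurable]: "f \<in> borel_measurable borel" "s \<in> borel_measurable N" "g \<in> borel_measurable N"
  shows "(\<lambda>x. score (s x) f (g x)) \<in> borel_measurable N"
  unfolding score_def by measurable

lemma measurable_loglap1 [measurable]:
  assumes f: "f \<in> borel_measurable borel" shows "loglap s f \<in> borel_measurable borel"
  using f by measurable

lemma measurable_score1 [measurable]:
  assumes f: "f \<in> borel_measurable borel" shows "score s f \<in> borel_measurable borel"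
  using f by measurable

lemma heat_0 [simp]: "heat 0 f x = f x"
  by (simp add: heat_def)

lemma loglap_0 [simp]: "loglap 0 f x = f x"
  by (simp add: loglap_def)

lemma integrable_heat:
  fixes f :: "real \<Rightarrow> real"
  assumes [measurable]: "f \<in> borel_measurable borel" and "\<And>x. \<bar>f x\<bar> \<le> K"
  shows "integrable \<gamma> (\<lambda>z. f (x + s * z))"
  using assms(2) by (intro gauss.integrable_const_bound[of _ K]) auto

lemma heat_mono:
  assumes "f \<in> borel_measurable borel" "\<And>x. \<bar>f x\<bar> \<le> K"
    and "g \<in> borel_measurable borel" "\<And>x. \<bar>g x\<bar> \<le> K'"
    and "\<And>x. f x \<le> g x"
  shows "heat s f x \<le> heat s g x"
  unfolding heat_def using assms
  by (intro integral_mono integrable_heat[of f K] integrable_heat[of g K']) auto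

lemma heat_const [simp]: "heat s (\<lambda>_. k) x = k"
  unfolding heat_def using gauss.prob_space by simp

lemma heat_bounds:
  assumes "f \<in> borel_measurable borel" "\<And>x. a \<le> f x" "\<And>x. f x \<le> b"
  shows "a \<le> heat s f x" "heat s f x \<le> b"
proof -
  have K: "\<bar>f x\<bar> \<le> \<bar>a\<bar> + \<bar>b\<bar>" for x
    using assms(2,3)[of x] by linarith
  show "a \<le> heat s f x"
    using heat_mono[of "\<lambda>_. a" "\<bar>a\<bar>" f "\<bar>a\<bar> + \<bar>b\<bar>" s x] K assms by simp
  show "heat s f x \<le> b"
    using heat_mono[of f "\<bar>a\<bar> + \<bar>b\<bar>" "\<lambda>_. b" "\<bar>b\<bar>" s x] K assms by simp
qed

lemma abs_heat_le:
  assumes "f \<in> borel_measurable borel" "\<And>x. \<bar>f x\<bar> \<le> K"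
  shows "\<bar>heat s f x\<bar> \<le> K"
proof -
  have "- K \<le> f x" "f x \<le> K" for x
    using assms(2)[of x] by linarith+
  then show ?thesis
    using heat_bounds[of f "- K" K s x] assms(1) by (simp add: abs_le_iff)
qed

lemma heat_exp_bounds:
  assumes [measurable]: "f \<in> borel_measurable borel" and K: "\<And>x. \<bar>f x\<bar> \<le> K"
  shows "exp (- K) \<le> heat s (\<lambda>y. exp (f y)) x" "heat s (\<lambda>y. exp (f y)) x \<le> exp K"
    "0 < heat s (\<lambda>y. exp (f y)) x"
proof -
  have "- K \<le> f x" "f x \<le> K" for x
    using K[of x] by linarith+
  then show *: "exp (- K) \<le> heat s (\<lambda>y. exp (f y)) x" "heat s (\<lambda>y. exp (f y)) x \<le> exp K"
    using heat_bounds[of "\<lambda>y. exp (f y)" "exp (- K)" "exp K" s x] by simp_all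
  show "0 < heat s (\<lambda>y. exp (f y)) x"
    using *(1) exp_gt_zero[of "- K"] by linarith
qed

lemma exp_loglap:
  assumes "f \<in> borel_measurable borel" "\<And>x. \<bar>f x\<bar> \<le> K"
  shows "exp (loglap s f x) = heat s (\<lambda>y. exp (f y)) x"
  unfolding loglap_def using heat_exp_bounds(3)[OF assms] by simp

lemma abs_loglap_le:
  assumes "f \<in> borel_measurable borel" "\<And>x. \<bar>f x\<bar> \<le> K"
  shows "\<bar>loglap s f x\<bar> \<le> K"
proof -
  have "exp (- K) \<le> exp (loglap s f x)" "exp (loglap s f x) \<le> exp K"
    using heat_exp_bounds[OF assms] exp_loglap[OF assms] by simp_all
  then show ?thesis by simp
qed

lemma abs_exp_le:
  assumes "\<bar>u\<bar> \<le> (K::real)"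
  shows "\<bar>exp u\<bar> \<le> exp K"
  using assms by simp

lemma loglap_mono:
  assumes "f \<in> borel_measurable borel" "\<And>x. \<bar>f x\<bar> \<le> K"
    and "g \<in> borel_measurable borel" "\<And>x. \<bar>g x\<bar> \<le> K'"
    and "\<And>x. f x \<le> g x"
  shows "loglap s f x \<le> loglap s g x"
proof -
  have "heat s (\<lambda>y. exp (f y)) x \<le> heat s (\<lambda>y. exp (g y)) x"
    using assms abs_exp_le[OF assms(2)] abs_exp_le[OF assms(4)]
    by (intro heat_mono[of _ "exp K" _ "exp K'"]) auto
  then show ?thesis
    using heat_exp_bounds(3)[OF assms(1,2), of s x] by (simp add: loglap_def)
qed

section \<open>The Gaussian semigroup and its logarithmic form\<close>

lemma (in prob_space) distributed_integral_scaled_gauss: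
  fixes f :: "real \<Rightarrow> real"
  assumes X: "distributed M lborel X (normal_density 0 s)" and s: "0 < s"
    and [measurable]: "f \<in> borel_measurable borel"
  shows "(\<integral>\<omega>. f (X \<omega>) \<partial>M) = (\<integral>z. f (s * z) \<partial>\<gamma>)"
proof -
  have "distributed M lborel (\<lambda>x. (X x - 0) / s) std_normal_density"
    using normal_standard_normal_convert[OF s, of X 0] X by simp
  then have Z: "distributed M lborel (\<lambda>x. X x / s) std_normal_density"
    by simp
  have "(\<integral>z. f (s * z) \<partial>\<gamma>) = (\<integral>z. std_normal_density z * f (s * z) \<partial>lborel)"
    by (simp add: integral_density)
  also have "\<dots> = (\<integral>\<omega>. f (s * (X \<omega> / s)) \<partial>M)"
    by (rule distributed_integral[OF Z]) auto
  finally show ?thesis using s by simp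
qed

text \<open>On the product of two copies of \<open>\<gamma>\<close> the coordinates are independent
  normals, and the variances of their multiples add; Fubini turns this into the semigroup
  law.\<close>

lemma heat_heat:
  assumes [measurable]: "f \<in> borel_measurable borel" and K: "\<And>x. \<bar>f x\<bar> \<le> K"
    and "0 \<le> s" "0 \<le> r"
  shows "heat s (heat r f) x = heat (sqrt (s\<^sup>2 + r\<^sup>2)) f x"
proof (cases "s = 0 \<or> r = 0")
  \<comment> \<open>A normal law with zero variance has no density, so the degenerate cases are
    separated.\<close>
  case True
  then show ?thesis
  proof
    assume "s = 0"
    then show ?thesis using assms(4) by simp
  next
    assume "r = 0"
    then show ?thesis using assms(3) by (simp add: heat_def[of s])
  qed
next
  case False
  then have pos: "0 < s" "0 < r" using assms by auto
  interpret P: pair_prob_space \<gamma> \<gamma> ..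
  have std: "distributed \<gamma> lborel (\<lambda>z. z) std_normal_density"
    by (auto simp: distributed_def distr_id2)
  have fstd: "distr (\<gamma> \<Otimes>\<^sub>M \<gamma>) lborel fst = \<gamma>"
    using gauss.distr_pair_fst[of \<gamma>] by (simp cong: distr_cong)
  have sndd: "distr (\<gamma> \<Otimes>\<^sub>M \<gamma>) lborel snd = \<gamma>"
  proof (rule measure_eqI)
    fix A assume "A \<in> sets (distr (\<gamma> \<Otimes>\<^sub>M \<gamma>) lborel snd)"
    then have A: "A \<in> sets borel" by simp
    have "emeasure (distr (\<gamma> \<Otimes>\<^sub>M \<gamma>) lborel snd) A = emeasure (\<gamma> \<Otimes>\<^sub>M \<gamma>) (UNIV \<times> A)"
      using A by (subst emeasure_distr) (auto simp: space_pair_measure intro!: arg_cong[where f="emeasure _"])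
    also have "\<dots> = emeasure \<gamma> A"
      using A gauss.emeasure_space_1 by (subst gauss.emeasure_pair_measure_Times) auto
    finally show "emeasure (distr (\<gamma> \<Otimes>\<^sub>M \<gamma>) lborel snd) A = emeasure \<gamma> A" .
  qed simp
  have df: "distributed (\<gamma> \<Otimes>\<^sub>M \<gamma>) lborel fst std_normal_density"
    using fstd by (simp add: distributed_def)
  have ds: "distributed (\<gamma> \<Otimes>\<^sub>M \<gamma>) lborel snd std_normal_density"
    using sndd by (simp add: distributed_def)
  have d1: "distributed (\<gamma> \<Otimes>\<^sub>M \<gamma>) lborel (\<lambda>p. 0 + s * fst p) (normal_density (0 + s * 0) (\<bar>s\<bar> * 1))"
    using pos by (intro P.normal_density_affine[OF df]) auto
  have d2: "distributed (\<gamma> \<Otimes>\<^sub>M \<gamma>) lborel (\<lambda>p. 0 + r * snd p) (normal_density (0 + r * 0) (\<bar>r\<bar> * 1))"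
    using pos by (intro P.normal_density_affine[OF ds]) auto
  have ind0: "P.indep_var borel fst borel snd"
  proof (subst P.indep_var_distribution_eq, intro conjI)
    have 1: "distr (\<gamma> \<Otimes>\<^sub>M \<gamma>) borel fst = \<gamma>"
      using fstd by (metis distr_cong sets_lborel)
    have 2: "distr (\<gamma> \<Otimes>\<^sub>M \<gamma>) borel snd = \<gamma>"
      using sndd by (metis distr_cong sets_lborel)
    have "distr (\<gamma> \<Otimes>\<^sub>M \<gamma>) (borel \<Otimes>\<^sub>M borel) (\<lambda>x. (fst x, snd x)) = distr (\<gamma> \<Otimes>\<^sub>M \<gamma>) (\<gamma> \<Otimes>\<^sub>M \<gamma>) (\<lambda>x. x)"
      by (intro distr_cong) (auto intro!: sets_pair_measure_cong)
    also have "\<dots> = \<gamma> \<Otimes>\<^sub>M \<gamma>" by (rule distr_id)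
    finally show "distr (\<gamma> \<Otimes>\<^sub>M \<gamma>) borel fst \<Otimes>\<^sub>M distr (\<gamma> \<Otimes>\<^sub>M \<gamma>) borel snd =
      distr (\<gamma> \<Otimes>\<^sub>M \<gamma>) (borel \<Otimes>\<^sub>M borel) (\<lambda>x. (fst x, snd x))"
      unfolding 1 2 by simp
  qed auto
  have "P.indep_var borel ((\<lambda>u. s * u) \<circ> fst) borel ((\<lambda>u. r * u) \<circ> snd)"
    by (intro P.indep_var_compose[OF ind0]) auto
  then have ind: "P.indep_var borel (\<lambda>p. s * fst p) borel (\<lambda>p. r * snd p)"
    by (simp add: comp_def)
  have "distributed (\<gamma> \<Otimes>\<^sub>M \<gamma>) lborel (\<lambda>p. s * fst p + r * snd p) (normal_density (0 + 0) (sqrt (s\<^sup>2 + r\<^sup>2)))"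
    using d1 d2 pos by (intro P.add_indep_normal ind) auto
  then have d: "distributed (\<gamma> \<Otimes>\<^sub>M \<gamma>) lborel (\<lambda>p. s * fst p + r * snd p) (normal_density 0 (sqrt (s\<^sup>2 + r\<^sup>2)))"
    by simp
  have "heat (sqrt (s\<^sup>2 + r\<^sup>2)) f x = (\<integral>z. f (x + sqrt (s\<^sup>2 + r\<^sup>2) * z) \<partial>\<gamma>)"
    by (simp add: heat_def)
  also have "\<dots> = (\<integral>p. f (x + (s * fst p + r * snd p)) \<partial>(\<gamma> \<Otimes>\<^sub>M \<gamma>))"
    using pos by (intro P.distributed_integral_scaled_gauss[OF d, symmetric, of "\<lambda>u. f (x + u)"])
      (auto intro!: add_pos_pos)
  also have "\<dots> = (\<integral>z. (\<integral>w. f (x + (s * z + r * w)) \<partial>\<gamma>) \<partial>\<gamma>)"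
    using K by (subst P.integral_fst'[symmetric]) (auto intro!: P.integrable_const_bound[of _ K])
  also have "\<dots> = heat s (heat r f) x"
    by (simp add: heat_def add.assoc)
  finally show ?thesis by simp
qed

text \<open>Dynamic programming: after exponentiation it is the semigroup law for
  \<open>heat\<close>.\<close>

lemma loglap_loglap:
  assumes [measurable]: "f \<in> borel_measurable borel" and K: "\<And>x. \<bar>f x\<bar> \<le> K"
    and "0 \<le> s" "0 \<le> r"
  shows "loglap s (loglap r f) x = loglap (sqrt (s\<^sup>2 + r\<^sup>2)) f x"
proof -
  have "heat s (\<lambda>y. exp (loglap r f y)) x = heat s (heat r (\<lambda>y. exp (f y))) x"
    using exp_loglap[OF assms(1) K] by simp
  also have "\<dots> = heat (sqrt (s\<^sup>2 + r\<^sup>2)) (\<lambda>y. exp (f y)) x"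
    using abs_exp_le[OF K] assms by (intro heat_heat[of _ "exp K"]) auto
  finally show ?thesis by (simp add: loglap_def)
qed

section \<open>The Gibbs variational principle for constant tilts, and its reversal\<close>

lemma heat_exp_shift:
  assumes [measurable]: "f \<in> borel_measurable borel"
  shows "heat s (\<lambda>y. exp (f y)) x
    = (\<integral>z. exp (f (x + s * \<theta> + s * z) - \<theta> * z - \<theta>\<^sup>2 / 2) \<partial>\<gamma>)"
  unfolding heat_def
  by (subst gauss_shift_integral[of _ \<theta>]) (auto simp: exp_add [symmetric] algebra_simps)

text \<open>Tilting the Gaussian by a constant \<open>\<theta>\<close> moves the mean by
  \<open>s * \<theta>\<close> and has relative entropy \<open>\<theta>\<^sup>2 / 2\<close>. In the
  tilted form of the exponential moment the claim is Jensen's inequality for the exponent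
  \<open>D\<close>.\<close>

lemma gibbs_bound:
  assumes [measurable]: "f \<in> borel_measurable borel" and K: "\<And>x. \<bar>f x\<bar> \<le> K"
  shows "heat s f (x + s * \<theta>) - \<theta>\<^sup>2 / 2 \<le> loglap s f x"
proof -
  define D where "D z = f (x + s * \<theta> + s * z) - \<theta> * z - \<theta>\<^sup>2 / 2" for z
  have [measurable]: "D \<in> borel_measurable borel" unfolding D_def by measurable
  have intf: "integrable \<gamma> (\<lambda>z. f (x + s * \<theta> + s * z))"
    by (rule integrable_heat[of f K]) (use K in auto)
  have intD: "integrable \<gamma> D"
    unfolding D_def using intf integrable_gauss_id by auto
  have ED: "(\<integral>z. D z \<partial>\<gamma>) = heat s f (x + s * \<theta>) - \<theta>\<^sup>2 / 2"
    unfolding D_def heat_def using intf integrable_gauss_id by (simp add: integral_gauss_id)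
  define m where "m = (\<integral>z. D z \<partial>\<gamma>)"
  have intexp: "integrable \<gamma> (\<lambda>z. exp (D z))"
  proof (rule integrable_gauss_exp_bound[of _ "exp K" "\<bar>\<theta>\<bar>"])
    fix z
    have "D z \<le> K + \<bar>\<theta>\<bar> * \<bar>z\<bar>"
      using K[of "x + s * \<theta> + s * z"] abs_ge_minus_self[of "\<theta> * z"] zero_le_power2[of \<theta>]
      unfolding D_def abs_mult by linarith
    then show "\<bar>exp (D z)\<bar> \<le> exp K * exp (\<bar>\<theta>\<bar> * \<bar>z\<bar>)"
      by (simp add: exp_add [symmetric])
  qed measurable
  \<comment> \<open>The tangent to \<open>exp\<close> at the mean \<open>m\<close> of
    \<open>D\<close>; its linear part integrates to zero.\<close>
  have "exp m * (1 + (D z - m)) \<le> exp (D z)" for z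
  proof -
    have "exp m * (1 + (D z - m)) \<le> exp m * exp (D z - m)"
      by (intro mult_left_mono exp_ge_add_one_self) simp
    then show ?thesis by (simp add: exp_diff)
  qed
  then have "(\<integral>z. exp m * (1 + (D z - m)) \<partial>\<gamma>) \<le> (\<integral>z. exp (D z) \<partial>\<gamma>)"
    using intD intexp by (intro integral_mono) auto
  also have "(\<integral>z. exp m * (1 + (D z - m)) \<partial>\<gamma>) = exp m"
    using intD by (simp add: m_def)
  also have "(\<integral>z. exp (D z) \<partial>\<gamma>) = exp (loglap s f x)"
    unfolding exp_loglap[OF assms] D_def heat_exp_shift[OF assms(1), of s x \<theta>] ..
  finally have "m \<le> loglap s f x" by simp
  then show ?thesis by (simp add: m_def ED)
qed

text \<open>The defect in Jensen's inequality for \<open>exp\<close> is of second order in the deviation \<open>w\<close> of the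
  exponent from a constant; this reverses the Gibbs bound up to an error.\<close>

lemma loglap_gap:
  assumes [measurable]: "f \<in> borel_measurable borel" and K: "\<And>x. \<bar>f x\<bar> \<le> K"
    and w: "\<And>z. w z = f (x + s * \<theta> + s * z) - \<theta> * z - k"
    and J: "\<And>z. (w z)\<^sup>2 * exp \<bar>w z\<bar> \<le> J z" "integrable \<gamma> J"
  shows "loglap s f x \<le> heat s f (x + s * \<theta>) - \<theta>\<^sup>2 / 2 + (\<integral>z. J z \<partial>\<gamma>)"
proof -
  have [measurable]: "w \<in> borel_measurable borel"
    unfolding w[abs_def] by measurable
  have intf: "integrable \<gamma> (\<lambda>z. f (x + s * \<theta> + s * z))"
    by (rule integrable_heat[of f K]) (use K in auto)
  have intw: "integrable \<gamma> w"
    unfolding w[abs_def] using intf integrable_gauss_id by auto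
  have Ew: "(\<integral>z. w z \<partial>\<gamma>) = heat s f (x + s * \<theta>) - k"
    unfolding w heat_def using intf integrable_gauss_id by (simp add: integral_gauss_id)
  have le: "exp (w z) \<le> 1 + w z + J z" for z
    using exp_taylor2[of "w z"] J(1)[of z] by linarith
  have J0: "0 \<le> J z" for z
    by (rule order_trans[OF _ J(1)]) simp
  have intexp: "integrable \<gamma> (\<lambda>z. exp (w z))"
    by (rule Bochner_Integration.integrable_bound[of _ "\<lambda>z. 1 + w z + J z"])
      (use intw J le in \<open>auto intro!: order_trans[OF le abs_ge_self]\<close>)
  have "heat s (\<lambda>y. exp (f y)) x = (\<integral>z. exp (k - \<theta>\<^sup>2 / 2) * exp (w z) \<partial>\<gamma>)"
    unfolding heat_exp_shift[OF assms(1), of s x \<theta>]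
    by (simp add: w exp_add [symmetric])
  also have "\<dots> = exp (k - \<theta>\<^sup>2 / 2) * (\<integral>z. exp (w z) \<partial>\<gamma>)" by simp
  finally have eq: "heat s (\<lambda>y. exp (f y)) x = exp (k - \<theta>\<^sup>2 / 2) * (\<integral>z. exp (w z) \<partial>\<gamma>)" .
  have pos: "0 < (\<integral>z. exp (w z) \<partial>\<gamma>)"
    using heat_exp_bounds(3)[OF assms(1) K, of s x] unfolding eq by (simp add: zero_less_mult_iff)
  have "loglap s f x = k - \<theta>\<^sup>2 / 2 + ln (\<integral>z. exp (w z) \<partial>\<gamma>)"
    unfolding loglap_def eq using pos by (simp add: ln_mult)
  \<comment> \<open>Linearising the logarithm at \<open>1\<close> leaves the mean of
    \<open>w\<close>, which cancels \<open>k\<close> and produces the heat term, and the remainder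
    \<open>J\<close>.\<close>
  also have "ln (\<integral>z. exp (w z) \<partial>\<gamma>) \<le> (\<integral>z. exp (w z) \<partial>\<gamma>) - 1"
    using ln_le_minus_one[OF pos] .
  also have "(\<integral>z. exp (w z) \<partial>\<gamma>) \<le> (\<integral>z. 1 + w z + J z \<partial>\<gamma>)"
    using intw J le intexp by (intro integral_mono) auto
  also have "(\<integral>z. 1 + w z + J z \<partial>\<gamma>) = 1 + (heat s f (x + s * \<theta>) - k) + (\<integral>z. J z \<partial>\<gamma>)"
    using intw J(2) by (simp add: Ew)
  finally show ?thesis by simp
qed

text \<open>Meant for a last short stretch before \<open>T\<close> without control. With zero tilt
  the exponent deviates from \<open>f x\<close> by at most \<open>L * \<bar>s * z\<bar>\<close>, so
  the loss is of the order of the elapsed time. The constant is chosen before \<open>f\<close>,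
  \<open>s\<close> and \<open>x\<close>.\<close>

lemma loglap_le_heat_lipschitz:
  assumes "0 \<le> L" "0 \<le> K"
  obtains C where "0 \<le> C" "\<And>f s x. \<lbrakk>f \<in> borel_measurable borel; \<And>x. \<bar>f x\<bar> \<le> K;
      \<And>x y. \<bar>f x - f y\<bar> \<le> L * \<bar>x - y\<bar>\<rbrakk> \<Longrightarrow> loglap s f x \<le> heat s f x + C * s\<^sup>2"
proof
  define C where "C = L\<^sup>2 * exp (2 * K) * (\<integral>z. z\<^sup>2 \<partial>\<gamma>)"
  show "0 \<le> C" unfolding C_def by (intro mult_nonneg_nonneg) auto
  have int2: "integrable \<gamma> (\<lambda>z. z\<^sup>2)"
    using integrable_std_normal_moment[of 2] by (simp add: integrable_density)
  fix f :: "real \<Rightarrow> real" and s x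
  assume [measurable]: "f \<in> borel_measurable borel" and K: "\<And>x. \<bar>f x\<bar> \<le> K"
    and L: "\<And>x y. \<bar>f x - f y\<bar> \<le> L * \<bar>x - y\<bar>"
  have "loglap s f x \<le> heat s f (x + s * 0) - 0\<^sup>2 / 2 + (\<integral>z. s\<^sup>2 * (L\<^sup>2 * exp (2 * K)) * z\<^sup>2 \<partial>\<gamma>)"
  proof (rule loglap_gap[of f K "\<lambda>z. f (x + s * z) - f x" x s 0 "f x"])
    fix z
    have a: "\<bar>f (x + s * z) - f x\<bar> \<le> L * \<bar>s * z\<bar>" using L[of "x + s * z" x] by simp
    have "\<bar>f (x + s * z) - f x\<bar>\<^sup>2 \<le> (L * \<bar>s * z\<bar>)\<^sup>2"
      using a by (intro power_mono) auto
    then have "(f (x + s * z) - f x)\<^sup>2 \<le> L\<^sup>2 * s\<^sup>2 * z\<^sup>2"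
      by (simp add: power_mult_distrib mult_ac)
    moreover have "exp \<bar>f (x + s * z) - f x\<bar> \<le> exp (2 * K)"
      using K[of x] K[of "x + s * z"] by simp
    ultimately have "(f (x + s * z) - f x)\<^sup>2 * exp \<bar>f (x + s * z) - f x\<bar> \<le> (L\<^sup>2 * s\<^sup>2 * z\<^sup>2) * exp (2 * K)"
      by (intro mult_mono) auto
    then show "(f (x + s * z) - f x)\<^sup>2 * exp \<bar>f (x + s * z) - f x\<bar> \<le> s\<^sup>2 * (L\<^sup>2 * exp (2 * K)) * z\<^sup>2"
      by (simp add: mult_ac)
  qed (use K int2 in auto)
  then show "loglap s f x \<le> heat s f x + C * s\<^sup>2"
    by (simp add: C_def mult_ac)
qed

lemma lipschitz_derivative_taylor:
  fixes \<psi> \<psi>' :: "real \<Rightarrow> real"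
  assumes d: "\<And>x. (\<psi> has_real_derivative \<psi>' x) (at x)"
    and L: "\<And>x y. \<bar>\<psi>' x - \<psi>' y\<bar> \<le> L * \<bar>x - y\<bar>" and "0 \<le> L"
  shows "\<bar>\<psi> (x + z) - \<psi> x - \<psi>' x * z\<bar> \<le> L * z\<^sup>2"
proof -
  have "\<exists>\<xi>. \<psi> (x + z) - \<psi> x = \<psi>' \<xi> * z \<and> \<bar>\<xi> - x\<bar> \<le> \<bar>z\<bar>"
  proof (cases z "0 :: real" rule: linorder_cases)
    case less
    then obtain \<xi> where "x + z < \<xi>" "\<xi> < x" "\<psi> x - \<psi> (x + z) = (x - (x + z)) * \<psi>' \<xi>"
      using MVT2[of "x + z" x \<psi> \<psi>'] d by auto
    then show ?thesis by (intro exI[of _ \<xi>]) (auto simp: algebra_simps)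
  next
    case greater
    then obtain \<xi> where "x < \<xi>" "\<xi> < x + z" "\<psi> (x + z) - \<psi> x = (x + z - x) * \<psi>' \<xi>"
      using MVT2[of x "x + z" \<psi> \<psi>'] d by auto
    then show ?thesis by (intro exI[of _ \<xi>]) (auto simp: algebra_simps)
  qed auto
  then obtain \<xi> where \<xi>: "\<psi> (x + z) - \<psi> x = \<psi>' \<xi> * z" "\<bar>\<xi> - x\<bar> \<le> \<bar>z\<bar>" by auto
  have "\<bar>\<psi> (x + z) - \<psi> x - \<psi>' x * z\<bar> = \<bar>\<psi>' \<xi> - \<psi>' x\<bar> * \<bar>z\<bar>"
    unfolding \<xi>(1) by (simp add: abs_mult [symmetric] algebra_simps)
  also have "\<dots> \<le> (L * \<bar>z\<bar>) * \<bar>z\<bar>"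
    using L[of \<xi> x] mult_left_mono[OF \<xi>(2) \<open>0 \<le> L\<close>] by (intro mult_right_mono) auto
  finally show ?thesis by (simp add: power2_eq_square abs_mult [symmetric])
qed

text \<open>With the tilt \<open>\<theta> = s * \<psi>' x\<close> the exponent minus its constant is
  the first-order Taylor remainder of \<open>\<psi>\<close>, hence of order
  \<open>s\<^sup>2\<close>, and the Jensen defect is of order \<open>s ^ 4\<close>. In terms of time
  this is quadratic in the step, so the errors of all steps add up to something vanishing with the
  mesh.\<close>

lemma loglap_le_heat_step:
  assumes "0 \<le> K" "0 \<le> P" "0 \<le> L" "0 \<le> S"
  obtains C where "0 \<le> C"
    "\<And>\<psi> \<psi>' s x. \<lbrakk>\<psi> \<in> borel_measurable borel; \<And>x. \<bar>\<psi> x\<bar> \<le> K;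
      \<And>x. (\<psi> has_real_derivative \<psi>' x) (at x); \<And>x. \<bar>\<psi>' x\<bar> \<le> P;
      \<And>x y. \<bar>\<psi>' x - \<psi>' y\<bar> \<le> L * \<bar>x - y\<bar>; 0 \<le> s; s \<le> S\<rbrakk>
      \<Longrightarrow> loglap s \<psi> x \<le> heat s \<psi> (x + s\<^sup>2 * \<psi>' x) - s\<^sup>2 * (\<psi>' x)\<^sup>2 / 2 + C * s ^ 4"
proof
  \<comment> \<open>The remainder is evaluated at a displacement of size at most
    \<open>s * (S * P + \<bar>z\<bar>)\<close>: the fourth power comes from squaring a quadratic
    remainder, and the exponentials bound \<open>exp \<bar>w z\<bar>\<close> through the bounds on
    \<open>\<psi>\<close> and \<open>\<psi>'\<close>.\<close>
  define J where "J z = L\<^sup>2 * exp (2 * K) * ((S * P + \<bar>z\<bar>) ^ 4 * exp (P * S * (S * P + \<bar>z\<bar>)))" for z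
  have [measurable]: "J \<in> borel_measurable borel" unfolding J_def by measurable
  have J0: "0 \<le> J z" for z unfolding J_def by (intro mult_nonneg_nonneg) auto
  have intJ: "integrable \<gamma> J"
  proof (rule integrable_gauss_exp_bound[of _ "L\<^sup>2 * exp (2 * K) * exp ((4 + P * S) * (S * P))" "4 + P * S"])
    fix z
    define a where "a = S * P + \<bar>z\<bar>"
    have a: "0 \<le> a" unfolding a_def using assms by simp
    have "a ^ 4 \<le> exp a ^ 4"
      using abs_le_exp_abs[of a] a by (intro power_mono) auto
    also have "\<dots> = exp (4 * a)"
      using exp_of_nat_mult[of 4 a] by simp
    finally have "a ^ 4 * exp (P * S * a) \<le> exp (4 * a) * exp (P * S * a)"
      by (intro mult_right_mono) auto
    also have "\<dots> = exp ((4 + P * S) * (S * P)) * exp ((4 + P * S) * \<bar>z\<bar>)"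
      by (simp add: a_def exp_add [symmetric] algebra_simps)
    finally have "L\<^sup>2 * exp (2 * K) * (a ^ 4 * exp (P * S * a)) \<le>
        L\<^sup>2 * exp (2 * K) * (exp ((4 + P * S) * (S * P)) * exp ((4 + P * S) * \<bar>z\<bar>))"
      by (intro mult_left_mono) auto
    then show "\<bar>J z\<bar> \<le> L\<^sup>2 * exp (2 * K) * exp ((4 + P * S) * (S * P)) * exp ((4 + P * S) * \<bar>z\<bar>)"
      using J0[of z] by (simp add: J_def a_def mult_ac)
  qed measurable
  define C where "C = (\<integral>z. J z \<partial>\<gamma>)"
  show "0 \<le> C" unfolding C_def using J0 by simp
  fix \<psi> \<psi>' :: "real \<Rightarrow> real" and s x
  assume [measurable]: "\<psi> \<in> borel_measurable borel" and K: "\<And>x. \<bar>\<psi> x\<bar> \<le> K"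
    and d: "\<And>x. (\<psi> has_real_derivative \<psi>' x) (at x)" and P: "\<And>x. \<bar>\<psi>' x\<bar> \<le> P"
    and L: "\<And>x y. \<bar>\<psi>' x - \<psi>' y\<bar> \<le> L * \<bar>x - y\<bar>" and s: "0 \<le> s" "s \<le> S"
  define p where "p = \<psi>' x"
  define \<theta> where "\<theta> = s * p"
  \<comment> \<open>The summand \<open>\<theta>\<^sup>2\<close> is the first-order effect of the
    moved mean; with it \<open>w\<close> becomes \<open>\<psi> (x + v) - \<psi> x - p * v\<close>
    for the total displacement \<open>v = s * \<theta> + s * z\<close>.\<close>
  define w where "w z = \<psi> (x + s * \<theta> + s * z) - \<theta> * z - (\<psi> x + \<theta>\<^sup>2)" for z
  have "loglap s \<psi> x \<le> heat s \<psi> (x + s * \<theta>) - \<theta>\<^sup>2 / 2 + (\<integral>z. s ^ 4 * J z \<partial>\<gamma>)"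
  proof (rule loglap_gap[of \<psi> K w x s \<theta> "\<psi> x + \<theta>\<^sup>2"])
    fix z
    define v where "v = s * \<theta> + s * z"
    have weq: "w z = \<psi> (x + v) - \<psi> x - p * v"
      unfolding w_def v_def \<theta>_def by (simp add: algebra_simps power2_eq_square)
    define q where "q = S * P + \<bar>z\<bar>"
    have q0: "0 \<le> q" unfolding q_def using assms by simp
    have sp: "\<bar>s * p\<bar> \<le> S * P"
      unfolding abs_mult p_def using s P[of x] by (intro mult_mono) auto
    have v1: "\<bar>v\<bar> \<le> s * q"
    proof -
      have "\<bar>v\<bar> = s * \<bar>s * p + z\<bar>"
        unfolding v_def \<theta>_def distrib_left [symmetric] abs_mult using s by simp
      also have "\<dots> \<le> s * q"
        unfolding q_def using sp s by (intro mult_left_mono) auto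
      finally show ?thesis .
    qed
    have "\<bar>w z\<bar> \<le> L * v\<^sup>2"
      unfolding weq p_def by (rule lipschitz_derivative_taylor[OF d L \<open>0 \<le> L\<close>])
    also have "v\<^sup>2 \<le> (s * q)\<^sup>2"
      using v1 by (rule power2_le_iff_abs_le[THEN iffD2, rotated]) (use s q0 in simp)
    finally have w1: "\<bar>w z\<bar> \<le> L * (s * q)\<^sup>2" using \<open>0 \<le> L\<close> by (simp add: mult_left_mono)
    have "(w z)\<^sup>2 \<le> (L * (s * q)\<^sup>2)\<^sup>2"
      using power_mono[OF w1, of 2] by simp
    also have "\<dots> = s ^ 4 * (L\<^sup>2 * q ^ 4)"
      by (simp add: power_mult_distrib flip: power_mult)
    finally have A: "(w z)\<^sup>2 \<le> s ^ 4 * (L\<^sup>2 * q ^ 4)" .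
    have "\<bar>w z\<bar> \<le> \<bar>\<psi> (x + v)\<bar> + \<bar>\<psi> x\<bar> + \<bar>p * v\<bar>"
      unfolding weq by linarith
    also have "\<bar>p * v\<bar> \<le> P * (S * q)"
    proof -
      have "\<bar>v\<bar> \<le> S * q" using v1 mult_right_mono[OF s(2) q0] by linarith
      then show ?thesis unfolding abs_mult p_def using P[of x] by (intro mult_mono) auto
    qed
    finally have "\<bar>w z\<bar> \<le> 2 * K + P * S * q"
      using K[of "x + v"] K[of x] by (simp add: mult_ac)
    then have B: "exp \<bar>w z\<bar> \<le> exp (2 * K) * exp (P * S * q)"
      by (simp add: exp_add [symmetric])
    have "(w z)\<^sup>2 * exp \<bar>w z\<bar> \<le> s ^ 4 * (L\<^sup>2 * q ^ 4) * (exp (2 * K) * exp (P * S * q))"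
      using A B by (intro mult_mono) auto
    then show "(w z)\<^sup>2 * exp \<bar>w z\<bar> \<le> s ^ 4 * J z"
      by (simp add: J_def q_def mult_ac)
  qed (use K intJ in \<open>auto simp: w_def\<close>)
  then show "loglap s \<psi> x \<le> heat s \<psi> (x + s\<^sup>2 * \<psi>' x) - s\<^sup>2 * (\<psi>' x)\<^sup>2 / 2 + C * s ^ 4"
    by (simp add: \<theta>_def p_def C_def power_mult_distrib mult_ac power2_eq_square)
qed

section \<open>Regularity of the smoothed reward\<close>

text \<open>The restriction to \<open>\<bar>\<theta>\<bar> \<le> 1\<close> makes the majorant
  independent of \<open>\<theta>\<close> up to the factor \<open>\<theta>\<^sup>2\<close>. In its
  exponent, \<open>2 * \<bar>z\<bar>\<close> comes from the squared deviation and
  \<open>\<bar>z\<bar> + 1\<close> from \<open>exp \<bar>w\<bar>\<close>; the leading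
  \<open>1\<close> pays for the term \<open>\<theta>\<^sup>2 / 2\<close> of the weight.\<close>

lemma gauss_weight_taylor:
  assumes "\<bar>\<theta>\<bar> \<le> (1::real)"
  shows "\<bar>exp (\<theta> * z - \<theta>\<^sup>2 / 2) - 1 - \<theta> * z\<bar> \<le> \<theta>\<^sup>2 * (1 + exp (3 * \<bar>z\<bar> + 1))"
proof -
  define w where "w = \<theta> * z - \<theta>\<^sup>2 / 2"
  have t2: "\<theta>\<^sup>2 \<le> \<bar>\<theta>\<bar>"
    using mult_left_mono[OF assms, of "\<bar>\<theta>\<bar>"] by (simp add: power2_eq_square abs_mult [symmetric])
  have w1: "\<bar>w\<bar> \<le> \<bar>\<theta>\<bar> * (\<bar>z\<bar> + 1)"
  proof -
    have "\<bar>w\<bar> \<le> \<bar>\<theta> * z\<bar> + \<theta>\<^sup>2 / 2" unfolding w_def using zero_le_power2[of \<theta>] by linarith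
    also have "\<dots> \<le> \<bar>\<theta>\<bar> * \<bar>z\<bar> + \<bar>\<theta>\<bar>" unfolding abs_mult using t2 zero_le_power2[of \<theta>] by linarith
    finally show ?thesis by (simp add: algebra_simps)
  qed
  have w2: "\<bar>w\<bar> \<le> \<bar>z\<bar> + 1"
    using w1 mult_right_mono[OF assms, of "\<bar>z\<bar> + 1"] by simp
  have z1: "(\<bar>z\<bar> + 1)\<^sup>2 \<le> exp (2 * \<bar>z\<bar>)"
  proof -
    have "(\<bar>z\<bar> + 1)\<^sup>2 \<le> (exp \<bar>z\<bar>)\<^sup>2"
      using exp_ge_add_one_self[of "\<bar>z\<bar>"] by (intro power_mono) (auto simp: add.commute)
    then show ?thesis by (simp add: power2_eq_square exp_add [symmetric])
  qed
  have "w\<^sup>2 \<le> \<theta>\<^sup>2 * (\<bar>z\<bar> + 1)\<^sup>2"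
    using power_mono[OF w1, of 2] by (simp add: power_mult_distrib)
  also have "\<dots> \<le> \<theta>\<^sup>2 * exp (2 * \<bar>z\<bar>)" using z1 by (intro mult_left_mono) auto
  finally have "w\<^sup>2 * exp \<bar>w\<bar> \<le> \<theta>\<^sup>2 * exp (2 * \<bar>z\<bar>) * exp (\<bar>z\<bar> + 1)"
    using w2 by (intro mult_mono) auto
  then have "w\<^sup>2 * exp \<bar>w\<bar> \<le> \<theta>\<^sup>2 * exp (3 * \<bar>z\<bar> + 1)"
    by (simp add: mult.assoc exp_add [symmetric])
  moreover have "\<bar>exp w - 1 - \<theta> * z\<bar> \<le> \<bar>exp w - 1 - w\<bar> + \<theta>\<^sup>2"
    unfolding w_def using zero_le_power2[of \<theta>] by linarith
  ultimately show ?thesis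
    using exp_taylor2[of w] unfolding w_def by (simp add: algebra_simps)
qed

text \<open>The mass of the majorant in \<open>gauss_weight_taylor\<close>. It also serves as a
  crude bound for the first absolute moment, so that one constant governs all slope
  estimates.\<close>

definition gauss_const :: real where
  "gauss_const = (\<integral>z. 1 + exp (3 * \<bar>z\<bar> + 1) \<partial>\<gamma>)"

lemma integrable_gauss_const: "integrable \<gamma> (\<lambda>z. 1 + exp (3 * \<bar>z\<bar> + 1))"
  using integrable_gauss_exp_abs[of 3] by (simp add: exp_add)

lemma gauss_const_ge_1: "1 \<le> gauss_const"
proof -
  have "(\<integral>z. 1 \<partial>\<gamma>) \<le> gauss_const"
    unfolding gauss_const_def by (intro integral_mono integrable_gauss_const) auto
  then show ?thesis by simp
qed

lemma integrable_heat_slope: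
  fixes f :: "real \<Rightarrow> real"
  assumes [measurable]: "f \<in> borel_measurable borel" and K: "\<And>x. \<bar>f x\<bar> \<le> K"
  shows "integrable \<gamma> (\<lambda>z. f (x + s * z) * z)"
proof (rule integrable_gauss_exp_bound[of _ K 1])
  fix z show "\<bar>f (x + s * z) * z\<bar> \<le> K * exp (1 * \<bar>z\<bar>)"
    unfolding abs_mult using K abs_le_exp_abs[of z] order_trans[OF abs_ge_zero K[of 0]]
    by (intro mult_mono) auto
qed measurable

text \<open>Moving \<open>x\<close> is the same as tilting the Gaussian, so \<open>f\<close> need not be smooth.\<close>

lemma heat_taylor:
  assumes [measurable]: "f \<in> borel_measurable borel" and K: "\<And>x. \<bar>f x\<bar> \<le> K"
    and s: "0 < s" and \<epsilon>: "\<bar>\<epsilon>\<bar> \<le> s"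
  shows "\<bar>heat s f (x + \<epsilon>) - heat s f x - heat_slope s f x * \<epsilon>\<bar> \<le> K * gauss_const / s\<^sup>2 * \<epsilon>\<^sup>2"
proof -
  define \<theta> where "\<theta> = \<epsilon> / s"
  have \<theta>: "\<epsilon> = s * \<theta>" "\<bar>\<theta>\<bar> \<le> 1" unfolding \<theta>_def using s \<epsilon> by auto
  have K0: "0 \<le> K" using order_trans[OF abs_ge_zero K[of 0]] .
  let ?e = "\<lambda>z. exp (\<theta> * z - \<theta>\<^sup>2 / 2)"
  have int1: "integrable \<gamma> (\<lambda>z. f (x + s * z))" by (rule integrable_heat[of f K]) (use K in auto)
  have int2: "integrable \<gamma> (\<lambda>z. f (x + s * z) * z)" by (rule integrable_heat_slope[of f K]) (use K in auto)
  have int0: "integrable \<gamma> (\<lambda>z. f (x + \<epsilon> + s * z))" by (rule integrable_heat[of f K]) (use K in auto)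
  have int3: "integrable \<gamma> (\<lambda>z. f (x + s * z) * ?e z)"
    using int0 by (subst (asm) gauss_shift_integrable[of _ "- \<theta>"]) (auto simp: \<theta>(1) algebra_simps)
  have "heat s f (x + \<epsilon>) = (\<integral>z. f (x + s * z) * ?e z \<partial>\<gamma>)"
    unfolding heat_def by (subst gauss_shift_integral[of _ "- \<theta>"]) (auto simp: \<theta>(1) algebra_simps)
  moreover have "heat_slope s f x * \<epsilon> = (\<integral>z. f (x + s * z) * z \<partial>\<gamma>) * \<theta>"
    using s by (simp add: heat_slope_def \<theta>_def)
  ultimately have eq: "heat s f (x + \<epsilon>) - heat s f x - heat_slope s f x * \<epsilon>
      = (\<integral>z. f (x + s * z) * ?e z - f (x + s * z) - f (x + s * z) * z * \<theta> \<partial>\<gamma>)"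
    using int1 int2 int3 by (simp add: heat_def)
  have "\<bar>heat s f (x + \<epsilon>) - heat s f x - heat_slope s f x * \<epsilon>\<bar> \<le> (\<integral>z. K * \<theta>\<^sup>2 * (1 + exp (3 * \<bar>z\<bar> + 1)) \<partial>\<gamma>)"
    unfolding eq
  proof (rule integral_abs_bound_integral)
    fix z
    have "\<bar>f (x + s * z) * ?e z - f (x + s * z) - f (x + s * z) * z * \<theta>\<bar>
        = \<bar>f (x + s * z)\<bar> * \<bar>?e z - 1 - \<theta> * z\<bar>"
      by (simp add: abs_mult [symmetric] algebra_simps)
    also have "\<dots> \<le> K * (\<theta>\<^sup>2 * (1 + exp (3 * \<bar>z\<bar> + 1)))"
      using K K0 gauss_weight_taylor[OF \<theta>(2)] by (intro mult_mono) auto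
    finally show "\<bar>f (x + s * z) * ?e z - f (x + s * z) - f (x + s * z) * z * \<theta>\<bar>
        \<le> K * \<theta>\<^sup>2 * (1 + exp (3 * \<bar>z\<bar> + 1))" by (simp add: mult_ac)
  qed (intro Bochner_Integration.integrable_diff integrable_mult_left integrable_mult_right int1 int2 int3 integrable_gauss_const)+
  also have "\<dots> = K * \<theta>\<^sup>2 * gauss_const"
    unfolding gauss_const_def by (rule integral_mult_right_zero)
  also have "\<dots> = K * gauss_const / s\<^sup>2 * \<epsilon>\<^sup>2"
    by (simp add: \<theta>_def power_divide)
  finally show ?thesis .
qed

lemma has_real_derivative_heat:
  assumes f: "f \<in> borel_measurable borel" and K: "\<And>x. \<bar>f x\<bar> \<le> K" and s: "0 < s"
  shows "(heat s f has_real_derivative heat_slope s f x) (at x)"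
  unfolding DERIV_def
proof (rule LIM_zero_cancel, rule Lim_null_comparison)
  show "\<forall>\<^sub>F h in at 0. norm ((heat s f (x + h) - heat s f x) / h - heat_slope s f x)
      \<le> K * gauss_const / s\<^sup>2 * \<bar>h\<bar>"
    unfolding eventually_at
  proof (intro exI[of _ s] conjI ballI impI s)
    fix h :: real assume h: "h \<noteq> 0 \<and> dist h 0 < s"
    have "\<bar>(heat s f (x + h) - heat s f x) / h - heat_slope s f x\<bar>
        = \<bar>heat s f (x + h) - heat s f x - heat_slope s f x * h\<bar> / \<bar>h\<bar>"
      using h by (subst abs_divide [symmetric]) (simp add: diff_divide_distrib)
    also have "\<dots> \<le> K * gauss_const / s\<^sup>2 * h\<^sup>2 / \<bar>h\<bar>"
      using h by (intro divide_right_mono heat_taylor[OF f K s]) auto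
    also have "\<dots> = K * gauss_const / s\<^sup>2 * \<bar>h\<bar>"
      using h by (simp add: power2_eq_square abs_if)
    finally show "norm ((heat s f (x + h) - heat s f x) / h - heat_slope s f x)
      \<le> K * gauss_const / s\<^sup>2 * \<bar>h\<bar>" by simp
  qed
  have "((\<lambda>h. K * gauss_const / s\<^sup>2 * \<bar>h\<bar>) \<longlongrightarrow> K * gauss_const / s\<^sup>2 * \<bar>0\<bar>) (at 0)"
    by (intro tendsto_intros)
  then show "((\<lambda>h. K * gauss_const / s\<^sup>2 * \<bar>h\<bar>) \<longlongrightarrow> 0) (at 0)" by simp
qed

lemma abs_heat_slope_le:
  assumes [measurable]: "f \<in> borel_measurable borel" and K: "\<And>x. \<bar>f x\<bar> \<le> K" and s: "0 < s"
  shows "\<bar>heat_slope s f x\<bar> \<le> K * gauss_const / s"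
proof -
  have K0: "0 \<le> K" using order_trans[OF abs_ge_zero K[of 0]] .
  have "\<bar>\<integral>z. f (x + s * z) * z \<partial>\<gamma>\<bar> \<le> (\<integral>z. K * (1 + exp (3 * \<bar>z\<bar> + 1)) \<partial>\<gamma>)"
  proof (rule integral_abs_bound_integral)
    fix z :: real
    have "\<bar>z\<bar> \<le> 1 + exp (3 * \<bar>z\<bar> + 1)"
      using exp_ge_add_one_self[of "3 * \<bar>z\<bar> + 1"] by linarith
    then show "\<bar>f (x + s * z) * z\<bar> \<le> K * (1 + exp (3 * \<bar>z\<bar> + 1))"
      unfolding abs_mult using K K0 by (intro mult_mono) auto
  qed (intro integrable_mult_right integrable_gauss_const integrable_heat_slope[of f K] K assms(1))+
  also have "\<dots> = K * gauss_const"
    unfolding gauss_const_def by (rule integral_mult_right_zero)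
  finally show ?thesis
    using s by (simp add: heat_slope_def abs_divide divide_right_mono)
qed

text \<open>No second derivative is taken: for \<open>\<bar>x - y\<bar> \<le> s\<close> the Taylor
  estimates from \<open>x\<close> to \<open>y\<close> and from \<open>y\<close> to \<open>x\<close>
  are added, and for larger distances the bound on the slope itself is enough.\<close>

lemma heat_slope_lipschitz:
  assumes f: "f \<in> borel_measurable borel" and K: "\<And>x. \<bar>f x\<bar> \<le> K" and s: "0 < s"
  shows "\<bar>heat_slope s f x - heat_slope s f y\<bar> \<le> 2 * K * gauss_const / s\<^sup>2 * \<bar>x - y\<bar>"
proof (cases "x = y")
  case False
  define d where "d = y - x"
  define C where "C = K * gauss_const / s\<^sup>2"
  have d0: "d \<noteq> 0" using False by (simp add: d_def)
  have K0: "0 \<le> K" using order_trans[OF abs_ge_zero K[of 0]] .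
  have "\<bar>heat_slope s f x - heat_slope s f y\<bar> \<le> 2 * C * \<bar>d\<bar>"
  proof (cases "\<bar>d\<bar> \<le> s")
    case True
    have 1: "\<bar>heat s f y - heat s f x - heat_slope s f x * d\<bar> \<le> C * d\<^sup>2"
      using heat_taylor[OF f K s True, of x] by (simp add: d_def C_def)
    have 2: "\<bar>heat s f x - heat s f y - heat_slope s f y * (- d)\<bar> \<le> C * d\<^sup>2"
      using heat_taylor[OF f K s, of "- d" y] True by (simp add: d_def C_def power2_commute)
    have "\<bar>(heat_slope s f x - heat_slope s f y) * d\<bar> \<le> 2 * C * d\<^sup>2"
      using 1 2 unfolding left_diff_distrib by linarith
    then have "\<bar>heat_slope s f x - heat_slope s f y\<bar> * \<bar>d\<bar> \<le> (2 * C * \<bar>d\<bar>) * \<bar>d\<bar>"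
      by (simp add: abs_mult power2_eq_square)
    then show ?thesis using d0 by simp
  next
    case False
    have "\<bar>heat_slope s f x - heat_slope s f y\<bar> \<le> 2 * (K * gauss_const / s)"
      using abs_heat_slope_le[OF f K s, of x] abs_heat_slope_le[OF f K s, of y] by linarith
    also have "K * gauss_const / s = C * s"
      using s by (simp add: C_def power2_eq_square)
    also have "2 * (C * s) \<le> 2 * (C * \<bar>d\<bar>)"
      using False K0 gauss_const_ge_1 unfolding C_def by (intro mult_left_mono) auto
    finally show ?thesis by simp
  qed
  then show ?thesis by (simp add: C_def d_def abs_minus_commute mult.assoc)
qed simp

lemma has_real_derivative_loglap:
  assumes [measurable]: "f \<in> borel_measurable borel" and K: "\<And>x. \<bar>f x\<bar> \<le> K" and s: "0 < s"
  shows "(loglap s f has_real_derivative score s f x) (at x)"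
proof -
  have "(heat s (\<lambda>y. exp (f y)) has_real_derivative heat_slope s (\<lambda>y. exp (f y)) x) (at x)"
    using abs_exp_le[OF K] s by (intro has_real_derivative_heat[of _ "exp K"]) auto
  then have "((\<lambda>x. ln (heat s (\<lambda>y. exp (f y)) x)) has_real_derivative
      1 / heat s (\<lambda>y. exp (f y)) x * heat_slope s (\<lambda>y. exp (f y)) x) (at x)"
    by (rule DERIV_chain2[where f=ln and g="heat s (\<lambda>y. exp (f y))", rotated])
      (rule DERIV_ln_divide[OF heat_exp_bounds(3)[OF assms(1) K]])
  then show ?thesis by (simp add: score_def loglap_def[abs_def])
qed

lemma lipschitz_of_bounded_derivative:
  fixes \<psi> :: "real \<Rightarrow> real"
  assumes d: "\<And>x. (\<psi> has_real_derivative \<psi>' x) (at x)" and P: "\<And>x. \<bar>\<psi>' x\<bar> \<le> P"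
  shows "\<bar>\<psi> x - \<psi> y\<bar> \<le> P * \<bar>x - y\<bar>"
  using field_differentiable_bound[of UNIV \<psi> \<psi>' P x y] d P by (simp add: has_field_derivative_at_within)

text \<open>The exponential moments lie between \<open>exp (- K)\<close> and \<open>exp K\<close>,
  so the bounds on slopes pass to the quotient. The constant depends on \<open>K\<close> only; the
  powers of \<open>s\<close> show how the feedback may degenerate at the terminal time.\<close>

lemma score_bounds:
  fixes K :: real
  obtains L where "0 \<le> L"
    "\<And>f s x. \<lbrakk>f \<in> borel_measurable borel; \<And>x. \<bar>f x\<bar> \<le> K; 0 < s\<rbrakk> \<Longrightarrow> \<bar>score s f x\<bar> \<le> L / s"
    "\<And>f s x y. \<lbrakk>f \<in> borel_measurable borel; \<And>x. \<bar>f x\<bar> \<le> K; 0 < s\<rbrakk>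
      \<Longrightarrow> \<bar>score s f x - score s f y\<bar> \<le> L / s\<^sup>2 * \<bar>x - y\<bar>"
proof
  define E where "E = exp K"
  define C where "C = E * gauss_const"
  define L where "L = E * C + (2 * E * C + E\<^sup>2 * C\<^sup>2)"
  have E: "0 < E" by (simp add: E_def)
  have C: "0 \<le> C" using gauss_const_ge_1 E by (simp add: C_def)
  show L0: "0 \<le> L" unfolding L_def using E C by (intro add_nonneg_nonneg mult_nonneg_nonneg) auto
  fix f :: "real \<Rightarrow> real" and s x y :: real
  assume [measurable]: "f \<in> borel_measurable borel" and K: "\<And>x. \<bar>f x\<bar> \<le> K" and s: "0 < s"
  define G where "G y = exp (f y)" for y
  have [measurable]: "G \<in> borel_measurable borel" unfolding G_def by measurable
  have G: "\<bar>G y\<bar> \<le> E" for y using K[of y] by (simp add: G_def E_def)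
  have lo: "1 / E \<le> heat s G y" for y
    using heat_exp_bounds(1)[of f K] K by (simp add: G_def[abs_def] E_def exp_minus inverse_eq_divide)
  have pos: "0 < heat s G y" for y
    using heat_exp_bounds(3)[of f K] K by (simp add: G_def[abs_def])
  have inv: "1 / heat s G y \<le> E" for y
    using lo[of y] pos[of y] E by (simp add: field_simps)
  have sl: "\<bar>heat_slope s G y\<bar> \<le> C / s" for y
    using abs_heat_slope_le[of G E s y] G s by (simp add: C_def)
  have ratio: "\<bar>score s f y\<bar> \<le> E * C / s" for y
  proof -
    have "\<bar>score s f y\<bar> = \<bar>heat_slope s G y\<bar> * (1 / heat s G y)"
      using pos[of y] by (simp add: score_def G_def[abs_def] abs_divide)
    also have "\<dots> \<le> C / s * E"
      using sl inv pos C s by (intro mult_mono) (auto simp: less_imp_le)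
    finally show ?thesis by (simp add: mult_ac)
  qed
  have "E * C / s \<le> L / s"
    using s E C by (intro divide_right_mono) (auto simp: L_def intro!: mult_nonneg_nonneg add_nonneg_nonneg)
  then show "\<bar>score s f x\<bar> \<le> L / s"
    using ratio[of x] by linarith
  have d1: "\<bar>heat_slope s G x - heat_slope s G y\<bar> \<le> 2 * C / s\<^sup>2 * \<bar>x - y\<bar>"
    using heat_slope_lipschitz[of G E s x y] G s by (simp add: C_def mult_ac)
  have d2: "\<bar>heat s G x - heat s G y\<bar> \<le> C / s * \<bar>x - y\<bar>"
    by (rule lipschitz_of_bounded_derivative[OF has_real_derivative_heat[of G E]]) (use G s sl in auto)
  have eq: "score s f x - score s f y
      = (heat_slope s G x - heat_slope s G y) * (1 / heat s G x)
        - score s f y * (1 / heat s G x) * (heat s G x - heat s G y)"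
    using pos[of x] pos[of y] by (simp add: score_def G_def[abs_def] field_simps)
  have "\<bar>score s f x - score s f y\<bar> \<le> \<bar>heat_slope s G x - heat_slope s G y\<bar> * (1 / heat s G x)
      + \<bar>score s f y\<bar> * (1 / heat s G x) * \<bar>heat s G x - heat s G y\<bar>"
    unfolding eq using pos[of x] by (intro order_trans[OF abs_triangle_ineq4]) (simp add: abs_mult)
  also have "\<dots> \<le> (2 * C / s\<^sup>2 * \<bar>x - y\<bar>) * E + E * C / s * E * (C / s * \<bar>x - y\<bar>)"
    using d1 d2 ratio inv pos E C s
    by (intro add_mono mult_mono) (auto simp: less_imp_le intro!: mult_nonneg_nonneg)
  also have "\<dots> = (2 * E * C + E\<^sup>2 * C\<^sup>2) / s\<^sup>2 * \<bar>x - y\<bar>"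
    using s by (simp add: field_simps power2_eq_square)
  also have "\<dots> \<le> L / s\<^sup>2 * \<bar>x - y\<bar>"
    using s E C by (intro mult_right_mono divide_right_mono) (auto simp: L_def)
  finally show "\<bar>score s f x - score s f y\<bar> \<le> L / s\<^sup>2 * \<bar>x - y\<bar>" .
qed

text \<open>A monotone reward has countably many jumps; this is why smoothing with positive variance
  ignores them.\<close>

lemma AE_gauss_not_in_countable:
  assumes "countable A" and "s \<noteq> 0"
  shows "AE z in \<gamma>. x + s * z \<notin> A"
proof -
  have "countable ((\<lambda>a. (a - x) / s) ` A)" using assms by auto
  then have "AE z in lborel. z \<notin> (\<lambda>a. (a - x) / s) ` A"
    by (intro AE_not_in countable_imp_null_set_lborel)
  then have "AE z in lborel. x + s * z \<notin> A"
    by eventually_elim (use assms in \<open>auto simp: image_iff field_simps\<close>)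
  then show ?thesis by (subst AE_density) (auto elim: eventually_mono)
qed

text \<open>Dominated convergence, jointly in mean and standard deviation. Continuity of
  \<open>f\<close> is needed only almost everywhere under the limiting Gaussian.\<close>

lemma tendsto_gauss_integral:
  fixes f :: "real \<Rightarrow> real"
  assumes [measurable]: "f \<in> borel_measurable borel" and K: "\<And>x. \<bar>f x\<bar> \<le> K"
    and cont: "AE z in \<gamma>. isCont f (x + s * z)"
    and lim: "X \<longlonglongrightarrow> x" "S \<longlonglongrightarrow> s"
  shows tendsto_heat: "(\<lambda>n. heat (S n) f (X n)) \<longlonglongrightarrow> heat s f x"
    and tendsto_heat_slope: "s \<noteq> 0 \<Longrightarrow> (\<lambda>n. heat_slope (S n) f (X n)) \<longlonglongrightarrow> heat_slope s f x"
proof -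
  have conv: "(\<lambda>n. f (X n + S n * z)) \<longlonglongrightarrow> f (x + s * z)" if "isCont f (x + s * z)" for z
    by (rule isCont_tendsto_compose[OF that]) (intro tendsto_intros lim)
  show "(\<lambda>n. heat (S n) f (X n)) \<longlonglongrightarrow> heat s f x"
    unfolding heat_def
    by (rule integral_dominated_convergence[where w="\<lambda>_. K"]) (use cont K conv in auto)
  have K0: "0 \<le> K" using order_trans[OF abs_ge_zero K[of 0]] .
  have "(\<lambda>n. \<integral>z. f (X n + S n * z) * z \<partial>\<gamma>) \<longlonglongrightarrow> (\<integral>z. f (x + s * z) * z \<partial>\<gamma>)"
  proof (rule integral_dominated_convergence[where w="\<lambda>z. K * \<bar>z\<bar>"])
    show "AE z in \<gamma>. (\<lambda>n. f (X n + S n * z) * z) \<longlonglongrightarrow> f (x + s * z) * z"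
      using cont by eventually_elim (intro tendsto_intros conv)
    show "AE z in \<gamma>. norm (f (X n + S n * z) * z) \<le> K * \<bar>z\<bar>" for n
      using K by (auto simp: abs_mult intro!: mult_right_mono)
    show "integrable \<gamma> (\<lambda>z. K * \<bar>z\<bar>)"
      using integrable_abs[OF integrable_gauss_id] by (rule integrable_mult_right)
  qed measurable
  then show "(\<lambda>n. heat_slope (S n) f (X n)) \<longlonglongrightarrow> heat_slope s f x" if "s \<noteq> 0"
    unfolding heat_slope_def using lim that by (intro tendsto_intros)
qed

lemma tendsto_score:
  assumes [measurable]: "f \<in> borel_measurable borel" and K: "\<And>x. \<bar>f x\<bar> \<le> K"
    and cont: "countable {x. \<not> isCont f x}"
    and lim: "X \<longlonglongrightarrow> x" "S \<longlonglongrightarrow> s" and s: "s \<noteq> 0"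
  shows "(\<lambda>n. score (S n) f (X n)) \<longlonglongrightarrow> score s f x"
proof -
  have "AE z in \<gamma>. isCont (\<lambda>y. exp (f y)) (x + s * z)"
    using AE_gauss_not_in_countable[OF cont s, of x] by eventually_elim (auto intro!: continuous_intros)
  moreover have "heat s (\<lambda>y. exp (f y)) x \<noteq> 0"
    using heat_exp_bounds(3)[OF assms(1) K, of s x] by simp
  ultimately show ?thesis
    unfolding score_def using abs_exp_le[OF K] lim s
    by (intro tendsto_divide tendsto_heat tendsto_heat_slope) auto
qed

text \<open>The parameter space is left general because the lemma is applied both along a path and
  on a square of pairs of times.\<close>

lemma continuous_on_score:
  assumes "f \<in> borel_measurable borel" and "\<And>x. \<bar>f x\<bar> \<le> K"
    and "countable {x. \<not> isCont f x}"
    and "continuous_on A u" "continuous_on A v" and "\<And>p. p \<in> A \<Longrightarrow> u p \<noteq> 0"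
  shows "continuous_on A (\<lambda>p :: 'p :: metric_space. score (u p) f (v p))"
  unfolding continuous_on_sequentially comp_def
proof (intro allI ballI impI, elim conjE)
  fix p P assume "p \<in> A" "\<forall>n. P n \<in> A" "P \<longlonglongrightarrow> p"
  then have "(\<lambda>n. u (P n)) \<longlonglongrightarrow> u p" "(\<lambda>n. v (P n)) \<longlonglongrightarrow> v p" "u p \<noteq> 0"
    using assms(4-6) by (auto intro: continuous_on_tendsto_compose)
  then show "(\<lambda>n. score (u (P n)) f (v (P n))) \<longlonglongrightarrow> score (u p) f (v p)"
    by (intro tendsto_score[OF assms(1-3)])
qed

text \<open>The limit \<open>s\<close> may be \<open>0\<close>, which is the terminal time. There
  the Gaussian no longer hides jumps, so \<open>f\<close> has to be continuous everywhere.\<close>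

lemma tendsto_loglap:
  assumes [measurable]: "f \<in> borel_measurable borel" and K: "\<And>x. \<bar>f x\<bar> \<le> K"
    and cont: "continuous_on UNIV f" and lim: "X \<longlonglongrightarrow> x" "S \<longlonglongrightarrow> s"
  shows "(\<lambda>n. loglap (S n) f (X n)) \<longlonglongrightarrow> loglap s f x"
proof -
  have "isCont (\<lambda>y. exp (f y)) y" for y
    using cont by (auto simp: continuous_on_eq_continuous_at intro!: continuous_intros)
  moreover have "heat s (\<lambda>y. exp (f y)) x \<noteq> 0"
    using heat_exp_bounds(3)[OF assms(1) K, of s x] by simp
  ultimately show ?thesis
    unfolding loglap_def using abs_exp_le[OF K] lim
    by (intro tendsto_ln tendsto_heat) auto
qed

lemma tendsto_loglap_fun:
  assumes [measurable]: "\<And>m. F m \<in> borel_measurable borel" "f \<in> borel_measurable borel"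
    and K: "\<And>m x. \<bar>F m x\<bar> \<le> K" "\<And>x. \<bar>f x\<bar> \<le> K"
    and lim: "AE z in \<gamma>. (\<lambda>m. F m (x + s * z)) \<longlonglongrightarrow> f (x + s * z)"
  shows "(\<lambda>m. loglap s (F m) x) \<longlonglongrightarrow> loglap s f x"
  unfolding loglap_def heat_def
proof (intro tendsto_ln integral_dominated_convergence[where w="\<lambda>_. exp K"])
  show "AE z in \<gamma>. (\<lambda>m. exp (F m (x + s * z))) \<longlonglongrightarrow> exp (f (x + s * z))"
    using lim by eventually_elim (intro tendsto_intros)
  show "(\<integral>z. exp (f (x + s * z)) \<partial>\<gamma>) \<noteq> 0"
    using heat_exp_bounds(3)[of f K s x] K by (simp add: heat_def)
  show "AE z in \<gamma>. norm (exp (F m (x + s * z))) \<le> exp K" for m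
    unfolding real_norm_def using abs_exp_le[OF K(1)] by (intro AE_I2)
qed auto

section \<open>Lipschitz envelopes by sup-convolution\<close>

definition sup_conv :: "(real \<Rightarrow> real) \<Rightarrow> nat \<Rightarrow> real \<Rightarrow> real" where
  "sup_conv f m x = (SUP y. f y - real m * \<bar>x - y\<bar>)"

context
  fixes f :: "real \<Rightarrow> real" and K :: real
  assumes K: "\<And>x. \<bar>f x\<bar> \<le> K"
begin

lemma sup_conv_bdd: "bdd_above (range (\<lambda>y. f y - real m * \<bar>x - y\<bar>))"
proof (rule bdd_aboveI2)
  fix y show "f y - real m * \<bar>x - y\<bar> \<le> K"
    using K[of y] mult_nonneg_nonneg[of "real m" "\<bar>x - y\<bar>"] abs_ge_zero[of "x - y"] of_nat_0_le_iff[of m] by linarith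
qed

lemma sup_conv_ge: "f y - real m * \<bar>x - y\<bar> \<le> sup_conv f m x"
  unfolding sup_conv_def by (rule cSUP_upper[OF UNIV_I sup_conv_bdd])

lemma sup_conv_ge_self: "f x \<le> sup_conv f m x"
  using sup_conv_ge[of x m x] by simp

lemma abs_sup_conv_le: "\<bar>sup_conv f m x\<bar> \<le> K"
proof -
  have "sup_conv f m x \<le> K"
    unfolding sup_conv_def
  proof (rule cSUP_least)
    fix y show "f y - real m * \<bar>x - y\<bar> \<le> K"
      using K[of y] mult_nonneg_nonneg[of "real m" "\<bar>x - y\<bar>"] abs_ge_zero[of "x - y"] of_nat_0_le_iff[of m] by linarith
  qed simp
  then show ?thesis using sup_conv_ge_self[of x m] K[of x] by linarith
qed

lemma sup_conv_lipschitz: "\<bar>sup_conv f m x - sup_conv f m y\<bar> \<le> real m * \<bar>x - y\<bar>"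
proof -
  have "sup_conv f m x \<le> sup_conv f m y + real m * \<bar>x - y\<bar>" for x y
    unfolding sup_conv_def[of f m x]
  proof (rule cSUP_least)
    fix z
    have "real m * \<bar>y - z\<bar> \<le> real m * (\<bar>x - y\<bar> + \<bar>x - z\<bar>)" by (intro mult_left_mono) auto
    then show "f z - real m * \<bar>x - z\<bar> \<le> sup_conv f m y + real m * \<bar>x - y\<bar>"
      using sup_conv_ge[of z m y] unfolding distrib_left by linarith
  qed simp
  from this[of x y] this[of y x] show ?thesis by (simp add: abs_le_iff abs_minus_commute)
qed

lemma continuous_on_sup_conv: "continuous_on UNIV (sup_conv f m)"
proof (rule lipschitz_on_continuous_on)
  show "(real m)-lipschitz_on UNIV (sup_conv f m)"
    using sup_conv_lipschitz by (intro lipschitz_onI) (auto simp: dist_real_def)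
qed

lemma measurable_sup_conv [measurable]: "sup_conv f m \<in> borel_measurable borel"
  using continuous_on_sup_conv by (rule borel_measurable_continuous_onI)

text \<open>A point at distance \<open>d\<close> or more competes only if its penalty is below the
  oscillation \<open>2 * K\<close>, which fails for large \<open>m\<close>; nearer points are
  controlled by semicontinuity. The hypothesis is local to \<open>x\<close>, because the envelopes
  from below converge only at continuity points.\<close>

lemma sup_conv_tendsto:
  assumes usc: "\<And>e. 0 < e \<Longrightarrow> \<exists>d>0. \<forall>y. \<bar>y - x\<bar> < d \<longrightarrow> f y < f x + e"
  shows "(\<lambda>m. sup_conv f m x) \<longlonglongrightarrow> f x"
proof (rule LIMSEQ_I)
  fix e :: real assume "0 < e"
  then obtain d where d: "d > 0" "\<And>y. \<bar>y - x\<bar> < d \<Longrightarrow> f y < f x + e / 2"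
    using usc[of "e / 2"] by auto
  obtain N where N: "2 * K / d < real N" using reals_Archimedean2 by blast
  have "sup_conv f m x \<le> f x + e / 2" if "N \<le> m" for m
    unfolding sup_conv_def
  proof (rule cSUP_least)
    fix y
    show "f y - real m * \<bar>x - y\<bar> \<le> f x + e / 2"
    proof (cases "\<bar>y - x\<bar> < d")
      case True
      have "f y \<le> f x + e / 2" using d(2)[OF True] by simp
      then show ?thesis using mult_nonneg_nonneg[of "real m" "\<bar>x - y\<bar>"] abs_ge_zero[of "x - y"] of_nat_0_le_iff[of m] by linarith
    next
      case False
      have "2 * K < real N * d" using N d(1) by (simp add: field_simps)
      also have "real N * d \<le> real m * \<bar>x - y\<bar>"
        using that False d(1) by (intro mult_mono) auto
      finally show ?thesis using K[of x] K[of y] \<open>0 < e\<close> by linarith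
    qed
  qed simp
  then have "norm (sup_conv f m x - f x) < e" if "N \<le> m" for m
    using sup_conv_ge_self[of x m] \<open>0 < e\<close> that unfolding real_norm_def by fastforce
  then show "\<exists>N. \<forall>m\<ge>N. norm (sup_conv f m x - f x) < e" by blast
qed

end

section \<open>Brownian increments\<close>

text \<open>The freezing lemma: independence makes the joint law a product, and Fubini does the
  rest. \<open>Y\<close> takes values in an arbitrary space \<open>N\<close>, so that an event can
  later be carried along with a real variable.\<close>

lemma (in prob_space) integral_independent:
  fixes X :: "'a \<Rightarrow> real" and \<phi> :: "'b \<Rightarrow> real \<Rightarrow> real"
  assumes G: "subalgebra M G" and indep: "indep_set (sets G) (preimages M X)"
    and X: "X \<in> borel_measurable M" and Y: "Y \<in> G \<rightarrow>\<^sub>M N"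
    and \<phi> [measurable]: "(\<lambda>(y, x). \<phi> y x) \<in> borel_measurable (N \<Otimes>\<^sub>M borel)"
    and K: "\<And>y x. \<bar>\<phi> y x\<bar> \<le> K"
  shows "(\<integral>\<omega>. \<phi> (Y \<omega>) (X \<omega>) \<partial>M) = (\<integral>\<omega>. (\<integral>\<omega>'. \<phi> (Y \<omega>) (X \<omega>') \<partial>M) \<partial>M)"
proof -
  note X [measurable]
  have [measurable]: "Y \<in> M \<rightarrow>\<^sub>M N" by (rule measurable_from_subalg[OF G Y])
  have sG: "space G = space M" "sets G \<subseteq> sets M"
    using G by (auto simp: subalgebra_def)
  interpret DY: prob_space "distr M N Y" by (rule prob_space_distr) measurable
  interpret DX: prob_space "distr M borel X" by (rule prob_space_distr) measurable
  interpret P: pair_prob_space "distr M N Y" "distr M borel X" ..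
  \<comment> \<open>Rectangles determine the joint law, and on them the claim is the product formula
    for independent events.\<close>
  have J: "distr M N Y \<Otimes>\<^sub>M distr M borel X = distr M (N \<Otimes>\<^sub>M borel) (\<lambda>\<omega>. (Y \<omega>, X \<omega>))"
  proof (rule pair_measure_eqI)
    fix A B assume "A \<in> sets (distr M N Y)" "B \<in> sets (distr M borel X)"
    then have [measurable]: "A \<in> sets N" "B \<in> sets borel" by simp_all
    have "Y -` A \<inter> space M \<in> sets G"
      using measurable_sets[OF Y \<open>A \<in> sets N\<close>] unfolding sG(1) .
    moreover have "X -` B \<inter> space M \<in> preimages M X"
      using \<open>B \<in> sets borel\<close> by (auto simp: preimages_def)
    ultimately have "prob ((Y -` A \<inter> space M) \<inter> (X -` B \<inter> space M))
        = prob (Y -` A \<inter> space M) * prob (X -` B \<inter> space M)"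
      by (rule indep_setD[OF indep])
    moreover have "(Y -` A \<inter> space M) \<inter> (X -` B \<inter> space M)
        = (\<lambda>\<omega>. (Y \<omega>, X \<omega>)) -` (A \<times> B) \<inter> space M" by auto
    ultimately show "emeasure (distr M N Y) A * emeasure (distr M borel X) B
        = emeasure (distr M (N \<Otimes>\<^sub>M borel) (\<lambda>\<omega>. (Y \<omega>, X \<omega>))) (A \<times> B)"
      by (simp add: emeasure_distr emeasure_eq_measure ennreal_mult)
  qed (auto intro: DY.sigma_finite_measure DX.sigma_finite_measure sets_pair_measure_cong)
  have "(\<integral>\<omega>. \<phi> (Y \<omega>) (X \<omega>) \<partial>M) = (\<integral>p. (\<lambda>(y, x). \<phi> y x) p \<partial>distr M (N \<Otimes>\<^sub>M borel) (\<lambda>\<omega>. (Y \<omega>, X \<omega>)))"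
    by (subst integral_distr) auto
  also have "\<dots> = (\<integral>y. (\<integral>x. \<phi> y x \<partial>distr M borel X) \<partial>distr M N Y)"
    unfolding J [symmetric] using K by (subst P.integral_fst'[symmetric]) (auto intro!: P.integrable_const_bound[of _ K])
  also have "\<dots> = (\<integral>\<omega>. (\<integral>x. \<phi> (Y \<omega>) x \<partial>distr M borel X) \<partial>M)"
    by (subst integral_distr) auto
  also have "\<dots> = (\<integral>\<omega>. (\<integral>\<omega>'. \<phi> (Y \<omega>) (X \<omega>') \<partial>M) \<partial>M)"
  proof (intro Bochner_Integration.integral_cong refl)
    fix \<omega> assume "\<omega> \<in> space M"
    then have "Y \<omega> \<in> space N" by (rule measurable_space[rotated]) measurable
    from measurable_Pair2[OF \<phi> this] have "\<phi> (Y \<omega>) \<in> borel_measurable borel" by simp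
    then show "(\<integral>x. \<phi> (Y \<omega>) x \<partial>distr M borel X) = (\<integral>\<omega>'. \<phi> (Y \<omega>) (X \<omega>') \<partial>M)"
      by (rule integral_distr[OF X])
  qed
  finally show ?thesis .
qed

text \<open>A single noise is enough: once the common noise has cancelled, the control problem
  involves \<open>B\<close> alone. The filtration is arbitrary, so controls may still depend on
  other information, such as \<open>W\<close>.\<close>

locale brownian_space = prob_space M for M :: "'a measure" +
  fixes F :: "real \<Rightarrow> 'a measure" and T :: real and B :: "real \<Rightarrow> 'a \<Rightarrow> real" and \<sigma> :: real
  assumes T_pos: "0 < T" and \<sigma>_pos: "0 < \<sigma>"
    and filtration: "filtration (space M) F" and subalgebra: "\<And>t. subalgebra M (F t)"
    and brownian: "brownian_motion M F T B"
begin

lemma space_F [simp]: "space (F t) = space M"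
  using subalgebra by (simp add: subalgebra_def)

lemma measurable_F_mono: "X \<in> F s \<rightarrow>\<^sub>M N \<Longrightarrow> s \<le> t \<Longrightarrow> X \<in> F t \<rightarrow>\<^sub>M N"
  using filtration.sets_F_mono[OF filtration, of s t] by (auto simp: measurable_def)

lemma measurable_F_M: "X \<in> F s \<rightarrow>\<^sub>M N \<Longrightarrow> X \<in> M \<rightarrow>\<^sub>M N"
  by (rule measurable_from_subalg[OF subalgebra])

lemma measurable_B: "0 \<le> s \<Longrightarrow> s \<le> t \<Longrightarrow> s \<le> T \<Longrightarrow> B s \<in> borel_measurable (F t)"
  using brownian measurable_F_mono[of "B s" s borel t] by (auto simp: brownian_motion_def)

lemma measurable_B_M [measurable]: "0 \<le> s \<Longrightarrow> s \<le> T \<Longrightarrow> B s \<in> borel_measurable M"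
  using measurable_B[of s s] measurable_F_M by auto

text \<open>The one place where the Gaussian law of the increments and their independence of the
  past are used.\<close>

lemma integral_increment:
  assumes st: "0 \<le> s" "s < t" "t \<le> T" and Y: "Y \<in> borel_measurable (F s)"
    and \<phi> [measurable]: "\<phi> \<in> borel_measurable borel" and K: "\<And>x. \<bar>\<phi> x\<bar> \<le> K"
  shows "(\<integral>\<omega>. \<phi> (Y \<omega> + \<sigma> * (B t \<omega> - B s \<omega>)) \<partial>M) = (\<integral>\<omega>. heat (\<sigma> * sqrt (t - s)) \<phi> (Y \<omega>) \<partial>M)"
proof -
  have D: "distributed M lborel (\<lambda>\<omega>. B t \<omega> - B s \<omega>) (normal_density 0 (sqrt (t - s)))"
    and I: "indep_set (sets (F s)) (preimages M (\<lambda>\<omega>. B t \<omega> - B s \<omega>))"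
    using brownian st by (auto simp: brownian_motion_def)
  have [measurable]: "B t \<in> borel_measurable M" "B s \<in> borel_measurable M" using st by auto
  have "(\<integral>\<omega>. \<phi> (Y \<omega> + \<sigma> * (B t \<omega> - B s \<omega>)) \<partial>M)
      = (\<integral>\<omega>. (\<integral>\<omega>'. \<phi> (Y \<omega> + \<sigma> * (B t \<omega>' - B s \<omega>')) \<partial>M) \<partial>M)"
    by (rule integral_independent[OF subalgebra I, where \<phi>="\<lambda>y x. \<phi> (y + \<sigma> * x)" and N=borel and K=K])
      (use Y K in auto)
  moreover have "(\<integral>\<omega>'. \<phi> (y + \<sigma> * (B t \<omega>' - B s \<omega>')) \<partial>M) = heat (\<sigma> * sqrt (t - s)) \<phi> y" for y
    unfolding heat_def using st
    by (subst distributed_integral_scaled_gauss[OF D, of "\<lambda>v. \<phi> (y + \<sigma> * v)"]) (simp_all add: mult.assoc)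
  ultimately show ?thesis by (simp only:)
qed

abbreviation "sd s \<equiv> \<sigma> * sqrt s"

lemma sd_square: "0 \<le> s \<Longrightarrow> (sd s)\<^sup>2 = \<sigma>\<^sup>2 * s"
  by (simp add: power_mult_distrib)

lemma loglap_sd:
  assumes "f \<in> borel_measurable borel" "\<And>x. \<bar>f x\<bar> \<le> K" "s \<le> t" "t \<le> T"
  shows "loglap (sd (t - s)) (loglap (sd (T - t)) f) x = loglap (sd (T - s)) f x"
proof -
  have "(sd (t - s))\<^sup>2 + (sd (T - t))\<^sup>2 = \<sigma>\<^sup>2 * (T - s)"
    using sd_square[of "t - s"] sd_square[of "T - t"] assms(3,4) by (simp add: algebra_simps)
  then have "sqrt ((sd (t - s))\<^sup>2 + (sd (T - t))\<^sup>2) = sd (T - s)"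
    using \<sigma>_pos by (simp only: real_sqrt_mult real_sqrt_abs)
  moreover have "loglap (sd (t - s)) (loglap (sd (T - t)) f) x
      = loglap (sqrt ((sd (t - s))\<^sup>2 + (sd (T - t))\<^sup>2)) f x"
    using assms(3,4) \<sigma>_pos by (intro loglap_loglap[OF assms(1,2)]) auto
  ultimately show ?thesis by (simp only:)
qed

lemma integrable_bounded:
  "X \<in> borel_measurable M \<Longrightarrow> (\<And>\<omega>. \<bar>X \<omega>\<bar> \<le> K) \<Longrightarrow> integrable M (X :: 'a \<Rightarrow> real)"
  by (rule integrable_const_bound[of _ K]) auto

text \<open>The displacement \<open>\<alpha>\<close> is known at time \<open>s\<close>, so
  conditionally it is a constant tilt and \<open>gibbs_bound\<close> applies. The penalty is the
  cost \<open>a\<^sup>2 / (2 * \<sigma>\<^sup>2)\<close> of the constant control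
  \<open>\<alpha> / (t - s)\<close>; \<open>\<alpha>\<close> may be unbounded.\<close>

lemma upper_step:
  assumes st: "0 \<le> s" "s < t" "t \<le> T"
    and Y: "Y \<in> borel_measurable (F s)" and \<alpha>: "\<alpha> \<in> borel_measurable (F s)"
    and int: "integrable M (\<lambda>\<omega>. (\<alpha> \<omega>)\<^sup>2)"
    and f [measurable]: "f \<in> borel_measurable borel" and K: "\<And>x. \<bar>f x\<bar> \<le> K"
  shows "(\<integral>\<omega>. loglap (sd (T - t)) f (Y \<omega> + \<alpha> \<omega> + \<sigma> * (B t \<omega> - B s \<omega>)) \<partial>M)
    \<le> (\<integral>\<omega>. loglap (sd (T - s)) f (Y \<omega>) \<partial>M) + (\<integral>\<omega>. (\<alpha> \<omega>)\<^sup>2 \<partial>M) / (2 * \<sigma>\<^sup>2 * (t - s))"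
proof -
  define \<psi> where "\<psi> = loglap (sd (T - t)) f"
  have [measurable]: "\<psi> \<in> borel_measurable borel" unfolding \<psi>_def by measurable
  have \<psi>: "\<bar>\<psi> x\<bar> \<le> K" for x unfolding \<psi>_def by (rule abs_loglap_le[OF f K])
  define r where "r = sd (t - s)"
  have r: "0 < r" "r\<^sup>2 = \<sigma>\<^sup>2 * (t - s)" using st \<sigma>_pos by (auto simp: r_def sd_square)
  have [measurable]: "Y \<in> borel_measurable M" "\<alpha> \<in> borel_measurable M"
    using measurable_F_M[OF Y] measurable_F_M[OF \<alpha>] .
  have "(\<integral>\<omega>. \<psi> (Y \<omega> + \<alpha> \<omega> + \<sigma> * (B t \<omega> - B s \<omega>)) \<partial>M) = (\<integral>\<omega>. heat r \<psi> (Y \<omega> + \<alpha> \<omega>) \<partial>M)"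
    unfolding r_def using \<psi> Y \<alpha> by (intro integral_increment[OF st]) auto
  also have "\<dots> \<le> (\<integral>\<omega>. loglap r \<psi> (Y \<omega>) + (\<alpha> \<omega>)\<^sup>2 / (2 * r\<^sup>2) \<partial>M)"
  proof (rule integral_mono)
    fix \<omega>
    \<comment> \<open>The tilt is measured in units of the standard deviation of the step.\<close>
    have "heat r \<psi> (Y \<omega> + r * (\<alpha> \<omega> / r)) - (\<alpha> \<omega> / r)\<^sup>2 / 2 \<le> loglap r \<psi> (Y \<omega>)"
      by (rule gibbs_bound[of \<psi> K]) (use \<psi> in auto)
    then show "heat r \<psi> (Y \<omega> + \<alpha> \<omega>) \<le> loglap r \<psi> (Y \<omega>) + (\<alpha> \<omega>)\<^sup>2 / (2 * r\<^sup>2)"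
      using r by (simp add: power_divide mult.commute)
    show "integrable M (\<lambda>\<omega>. heat r \<psi> (Y \<omega> + \<alpha> \<omega>))"
      using abs_heat_le[of \<psi> K] \<psi> by (intro integrable_bounded[of _ K]) auto
    show "integrable M (\<lambda>\<omega>. loglap r \<psi> (Y \<omega>) + (\<alpha> \<omega>)\<^sup>2 / (2 * r\<^sup>2))"
      using abs_loglap_le[of \<psi> K] \<psi> int
      by (intro Bochner_Integration.integrable_add integrable_divide integrable_bounded[of "\<lambda>\<omega>. loglap r \<psi> (Y \<omega>)" K]) auto
  qed
  also have "\<dots> = (\<integral>\<omega>. loglap r \<psi> (Y \<omega>) \<partial>M) + (\<integral>\<omega>. (\<alpha> \<omega>)\<^sup>2 \<partial>M) / (2 * r\<^sup>2)"
    using abs_loglap_le[of \<psi> K] \<psi> int by (subst Bochner_Integration.integral_add) (auto intro!: integrable_bounded[of _ K])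
  also have "(\<lambda>\<omega>. loglap r \<psi> (Y \<omega>)) = (\<lambda>\<omega>. loglap (sd (T - s)) f (Y \<omega>))"
    unfolding r_def \<psi>_def using st loglap_sd[OF f K, of s t] by auto
  finally show ?thesis by (simp add: \<psi>_def r(2) mult.assoc)
qed

text \<open>\<open>I\<close> is the integrated control and \<open>J\<close> its running cost. Each increment of \<open>I\<close> is applied one
  time step late, which makes it adapted; hence the state at time \<open>T\<close> only sees \<open>I\<close> up to one step
  before \<open>T\<close>.\<close>

lemma upper_discrete:
  assumes t0: "0 \<le> t0" "t0 < T" and n: "0 < n"
    and I: "\<And>u. t0 \<le> u \<Longrightarrow> u \<le> T \<Longrightarrow> I u \<in> borel_measurable (F u)" "\<And>\<omega>. I t0 \<omega> = 0"
    and J: "\<And>u. t0 \<le> u \<Longrightarrow> u \<le> T \<Longrightarrow> integrable M (J u)" "\<And>\<omega>. J t0 \<omega> = 0"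
    and IJ: "\<And>u v. t0 \<le> u \<Longrightarrow> u < v \<Longrightarrow> v \<le> T \<Longrightarrow>
      AE \<omega> in M. (I v \<omega> - I u \<omega>)\<^sup>2 \<le> (v - u) * (J v \<omega> - J u \<omega>)"
    and f [measurable]: "f \<in> borel_measurable borel" and K: "\<And>x. \<bar>f x\<bar> \<le> K"
  shows "(\<integral>\<omega>. f (x + I (T - (T - t0) / real n) \<omega> + \<sigma> * (B T \<omega> - B t0 \<omega>)) \<partial>M)
    \<le> loglap (sd (T - t0)) f x + (\<integral>\<omega>. J T \<omega> \<partial>M) / (2 * \<sigma>\<^sup>2)"
proof -
  define h where "h = (T - t0) / real n"
  have h: "0 < h" "real n * h = T - t0" using t0 n by (auto simp: h_def)
  define t where "t i = t0 + real i * h" for i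
  have tn: "t n = T" "t 0 = t0" by (auto simp: t_def h)
  have tS: "t (Suc i) = t i + h" for i by (simp add: t_def algebra_simps)
  have ti: "t0 \<le> t i" for i using h by (simp add: t_def)
  have tT: "t i \<le> T" if "i \<le> n" for i
  proof -
    have "real i * h \<le> real n * h" using that h by (intro mult_right_mono) auto
    then show ?thesis using h by (simp add: t_def)
  qed
  \<comment> \<open>Truncated subtraction matters: \<open>\<alpha> 0\<close> is zero, so the first
    step is uncontrolled and each later step uses the displacement of the step before it.\<close>
  define Y where "Y i \<omega> = x + I (t (i - 1)) \<omega> + \<sigma> * (B (t i) \<omega> - B t0 \<omega>)" for i \<omega>
  define \<alpha> where "\<alpha> i \<omega> = I (t i) \<omega> - I (t (i - 1)) \<omega>" for i \<omega>
  define EJ where "EJ u = (\<integral>\<omega>. J u \<omega> \<partial>M)" for u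
  have I': "I (t j) \<in> borel_measurable (F (t i))" if "j \<le> i" "i \<le> n" for i j
  proof -
    have "real j * h \<le> real i * h" using that h by (intro mult_right_mono) auto
    then have "t j \<le> t i" by (simp add: t_def)
    then show ?thesis using measurable_F_mono[OF I(1)] ti tT[of j] that by auto
  qed
  have "(\<integral>\<omega>. loglap (sd (T - t i)) f (Y i \<omega>) \<partial>M) \<le> loglap (sd (T - t0)) f x + EJ (t (i - 1)) / (2 * \<sigma>\<^sup>2)"
    if "i \<le> n" for i
    using that
  proof (induction i)
    case 0
    then show ?case using I(2) J(2) prob_space by (simp add: Y_def tn EJ_def)
  next
    case (Suc i)
    have le: "t0 \<le> t i" "t i < t (Suc i)" "t (Suc i) \<le> T" "t i \<le> T"
      using Suc.prems ti[of i] tT[of "Suc i"] tT[of i] tS[of i] h by simp_all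
    have Bm [measurable]: "B (t i) \<in> borel_measurable (F (t i))" "B t0 \<in> borel_measurable (F (t i))"
      using measurable_B le t0 by auto
    have Im [measurable]: "I (t i) \<in> borel_measurable (F (t i))" "I (t (i - 1)) \<in> borel_measurable (F (t i))"
      using I' Suc by auto
    have [measurable]: "Y i \<in> borel_measurable (F (t i))" "\<alpha> i \<in> borel_measurable (F (t i))"
      unfolding Y_def \<alpha>_def by measurable
    \<comment> \<open>\<open>IJ\<close> on the preceding interval is Cauchy-Schwarz: averaging a
      control over a step does not increase its energy.\<close>
    have ae: "AE \<omega> in M. (\<alpha> i \<omega>)\<^sup>2 \<le> h * (J (t i) \<omega> - J (t (i - 1)) \<omega>)"
    proof (cases i)
      case 0
      then show ?thesis by (simp add: \<alpha>_def)
    next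
      case (Suc j)
      then show ?thesis using IJ[of "t j" "t i"] ti le tS[of j] h by (simp add: \<alpha>_def)
    qed
    have Jint: "integrable M (J (t i))" "integrable M (J (t (i - 1)))"
      using J(1) ti tT Suc by auto
    have int: "integrable M (\<lambda>\<omega>. (\<alpha> i \<omega>)\<^sup>2)"
    proof (rule Bochner_Integration.integrable_bound)
      show "integrable M (\<lambda>\<omega>. h * (J (t i) \<omega> - J (t (i - 1)) \<omega>))" using Jint by auto
      show "(\<lambda>\<omega>. (\<alpha> i \<omega>)\<^sup>2) \<in> borel_measurable M" by (rule measurable_F_M[of _ "t i"]) measurable
      show "AE \<omega> in M. norm ((\<alpha> i \<omega>)\<^sup>2) \<le> norm (h * (J (t i) \<omega> - J (t (i - 1)) \<omega>))"
        using ae by eventually_elim auto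
    qed
    have "(\<integral>\<omega>. (\<alpha> i \<omega>)\<^sup>2 \<partial>M) \<le> (\<integral>\<omega>. h * (J (t i) \<omega> - J (t (i - 1)) \<omega>) \<partial>M)"
      using int Jint ae by (intro integral_mono_AE) auto
    also have "\<dots> = h * (EJ (t i) - EJ (t (i - 1)))" using Jint by (simp add: EJ_def)
    finally have \<alpha>2: "(\<integral>\<omega>. (\<alpha> i \<omega>)\<^sup>2 \<partial>M) \<le> h * (EJ (t i) - EJ (t (i - 1)))" .
    have "(\<lambda>\<omega>. Y (Suc i) \<omega>) = (\<lambda>\<omega>. Y i \<omega> + \<alpha> i \<omega> + \<sigma> * (B (t (Suc i)) \<omega> - B (t i) \<omega>))"
      by (auto simp: Y_def \<alpha>_def algebra_simps)
    then have "(\<integral>\<omega>. loglap (sd (T - t (Suc i))) f (Y (Suc i) \<omega>) \<partial>M)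
        = (\<integral>\<omega>. loglap (sd (T - t (Suc i))) f (Y i \<omega> + \<alpha> i \<omega> + \<sigma> * (B (t (Suc i)) \<omega> - B (t i) \<omega>)) \<partial>M)"
      by metis
    also have "\<dots> \<le> (\<integral>\<omega>. loglap (sd (T - t i)) f (Y i \<omega>) \<partial>M)
        + (\<integral>\<omega>. (\<alpha> i \<omega>)\<^sup>2 \<partial>M) / (2 * \<sigma>\<^sup>2 * (t (Suc i) - t i))"
      using le t0 int K by (intro upper_step[where K=K]) auto
    also have "(\<integral>\<omega>. (\<alpha> i \<omega>)\<^sup>2 \<partial>M) / (2 * \<sigma>\<^sup>2 * (t (Suc i) - t i)) \<le> h * (EJ (t i) - EJ (t (i - 1))) / (2 * \<sigma>\<^sup>2 * h)"
      using \<alpha>2 h \<sigma>_pos by (simp only: tS add_diff_cancel_left') (intro divide_right_mono, auto)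
    also have "\<dots> = (EJ (t i) - EJ (t (i - 1))) / (2 * \<sigma>\<^sup>2)" using h by simp
    finally show ?case using Suc by (simp add: diff_divide_distrib)
  qed
  from this[of n] have *: "(\<integral>\<omega>. f (Y n \<omega>) \<partial>M) \<le> loglap (sd (T - t0)) f x + EJ (t (n - 1)) / (2 * \<sigma>\<^sup>2)"
    by (simp add: tn)
  have tn1: "t (n - 1) = T - h"
    using n h by (simp add: t_def of_nat_diff algebra_simps)
  \<comment> \<open>\<open>IJ\<close> makes \<open>J\<close> almost surely nondecreasing, because
    its left side is a square.\<close>
  have "EJ (t (n - 1)) \<le> EJ T"
    unfolding EJ_def
  proof (rule integral_mono_AE)
    have "AE \<omega> in M. (I T \<omega> - I (t (n - 1)) \<omega>)\<^sup>2 \<le> (T - t (n - 1)) * (J T \<omega> - J (t (n - 1)) \<omega>)"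
      using ti[of "n - 1"] h tn1 by (intro IJ) auto
    then show "AE \<omega> in M. J (t (n - 1)) \<omega> \<le> J T \<omega>"
    proof eventually_elim
      case (elim \<omega>)
      have "0 \<le> (I T \<omega> - I (t (n - 1)) \<omega>)\<^sup>2" by simp
      also note elim
      finally have "0 \<le> h * (J T \<omega> - J (t (n - 1)) \<omega>)" unfolding tn1 by simp
      then show ?case using h by (simp add: zero_le_mult_iff)
    qed
  qed (use J ti tT t0 in auto)
  then have "EJ (t (n - 1)) / (2 * \<sigma>\<^sup>2) \<le> EJ T / (2 * \<sigma>\<^sup>2)" by (intro divide_right_mono) auto
  with * show ?thesis unfolding Y_def tn tn1 EJ_def h_def [symmetric] by linarith
qed

end

section \<open>The upper bound for arbitrary controls\<close>

lemma set_integrable_const_interval: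
  "set_integrable lborel {u<..v :: real} (\<lambda>_. k :: real)" "set_integrable lborel {u..v :: real} (\<lambda>_. k :: real)"
proof -
  have "set_integrable lborel {u..v} (\<lambda>_. k)"
    by (rule borel_integrable_atLeastAtMost') (rule continuous_on_const)
  then show "set_integrable lborel {u..v} (\<lambda>_. k)" "set_integrable lborel {u<..v} (\<lambda>_. k)"
    by (auto intro: set_integrable_subset)
qed

lemma set_integral_singleton: "(LINT s:{u :: real}|lborel. g s) = (0 :: real)"
proof -
  have "AE s in lborel. indicator {u} s *\<^sub>R g s = 0"
    using AE_lborel_singleton[of u] by eventually_elim simp
  then show ?thesis unfolding set_lebesgue_integral_def by (rule integral_eq_zero_AE)
qed

text \<open>The variance of \<open>a\<close> about its time average \<open>m\<close> is
  nonnegative.\<close>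

lemma set_integral_square_le:
  fixes a :: "real \<Rightarrow> real"
  assumes uv: "u < v" and a: "set_integrable lborel {u<..v} a" "set_integrable lborel {u<..v} (\<lambda>s. (a s)\<^sup>2)"
  shows "(LINT s:{u<..v}|lborel. a s)\<^sup>2 \<le> (v - u) * (LINT s:{u<..v}|lborel. (a s)\<^sup>2)"
proof -
  define I where "I = (LINT s:{u<..v}|lborel. a s)"
  define m where "m = I / (v - u)"
  have "0 \<le> (LINT s:{u<..v}|lborel. (a s - m)\<^sup>2)"
    unfolding set_lebesgue_integral_def by (intro integral_nonneg_AE AE_I2) auto
  also have "(\<lambda>s. (a s - m)\<^sup>2) = (\<lambda>s. (a s)\<^sup>2 - 2 * m * a s + m\<^sup>2)"
    by (auto simp: power2_diff)
  also have "(LINT s:{u<..v}|lborel. (a s)\<^sup>2 - 2 * m * a s + m\<^sup>2)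
      = (LINT s:{u<..v}|lborel. (a s)\<^sup>2) - 2 * m * I + m\<^sup>2 * (v - u)"
    using a set_integrable_const_interval(1)[of u v "m\<^sup>2"] uv
    by (simp add: set_integral_add set_integral_diff I_def set_integral_const)
  finally have "2 * m * I - m\<^sup>2 * (v - u) \<le> (LINT s:{u<..v}|lborel. (a s)\<^sup>2)" by simp
  moreover have "2 * m * I - m\<^sup>2 * (v - u) = I\<^sup>2 / (v - u)"
  proof -
    define l where "l = v - u"
    have "l \<noteq> 0" "I = m * l" using uv by (auto simp: l_def m_def)
    then have "2 * m * I - m\<^sup>2 * l = I\<^sup>2 / l" by (simp add: power2_eq_square)
    then show ?thesis by (simp add: l_def)
  qed
  ultimately have "I\<^sup>2 / (v - u) \<le> (LINT s:{u<..v}|lborel. (a s)\<^sup>2)" by simp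
  then show ?thesis using uv by (simp add: I_def pos_divide_le_eq mult.commute)
qed

lemma set_integrable_of_square:
  fixes a :: "real \<Rightarrow> real"
  assumes [measurable]: "a \<in> borel_measurable borel" and "set_integrable lborel {u..v} (\<lambda>s. (a s)\<^sup>2)"
  shows "set_integrable lborel {u..v} a"
  unfolding set_integrable_def
proof (rule Bochner_Integration.integrable_bound)
  show "integrable lborel (\<lambda>s. indicator {u..v} s *\<^sub>R (1 + (a s)\<^sup>2))"
    using set_integral_add(1)[OF set_integrable_const_interval(2) assms(2)] unfolding set_integrable_def .
  have "\<bar>x\<bar> \<le> 1 + x\<^sup>2" for x :: real
    using zero_le_power2[of "\<bar>x\<bar> - 1"] zero_le_power2[of x] by (simp add: power2_diff)
  then show "AE s in lborel. norm (indicator {u..v} s *\<^sub>R a s) \<le> norm (indicator {u..v} s *\<^sub>R (1 + (a s)\<^sup>2))"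
    by (intro AE_I2) (auto simp: indicator_def)
qed simp

lemma set_integral_Icc_diff:
  fixes a :: "real \<Rightarrow> real"
  assumes "t \<le> u" "u \<le> v" and a: "set_integrable lborel {t..v} a"
  shows "(LINT s:{t..v}|lborel. a s) - (LINT s:{t..u}|lborel. a s) = (LINT s:{u<..v}|lborel. a s)"
proof -
  have eq: "{t..v} = {t..u} \<union> {u<..v}" using assms by auto
  have "set_integrable lborel {t..u} a" "set_integrable lborel {u<..v} a"
    by (rule set_integrable_subset[OF a]; use assms in auto)+
  then show ?thesis unfolding eq by (subst set_integral_Un) auto
qed

section \<open>Progressive controls, their integrals and their energy\<close>

context brownian_space
begin

lemma progressive_measurable_pair:
  assumes a: "progressively_measurable F T a" and u: "0 \<le> u" "u \<le> T"
  shows "(\<lambda>(s, \<omega>). indicator {0..u} s * a s \<omega>) \<in> borel_measurable (lborel \<Otimes>\<^sub>M F u)"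
proof -
  \<comment> \<open>Clamping time into \<open>{0..u}\<close> extends the function from the
    restricted space to the whole line; the indicator discards the values invented outside.\<close>
  define cl where "cl s = max 0 (min u s)" for s
  have [measurable]: "cl \<in> lborel \<rightarrow>\<^sub>M restrict_space borel {0..u}"
    using u unfolding cl_def by (intro measurable_restrict_space2) auto
  have [measurable]: "(\<lambda>(s, \<omega>). a s \<omega>) \<in> borel_measurable (restrict_space borel {0..u} \<Otimes>\<^sub>M F u)"
    using a u by (simp add: progressively_measurable_def)
  have "(\<lambda>(s, \<omega>). indicator {0..u} s * (\<lambda>(s, \<omega>). a s \<omega>) (cl s, \<omega>)) \<in> borel_measurable (lborel \<Otimes>\<^sub>M F u)"
    by measurable
  also have "(\<lambda>(s, \<omega>). indicator {0..u} s * (\<lambda>(s, \<omega>). a s \<omega>) (cl s, \<omega>))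
      = (\<lambda>(s, \<omega>). indicator {0..u} s * a s \<omega>)"
    by (auto simp: cl_def indicator_def fun_eq_iff)
  finally show ?thesis .
qed

lemma progressive_section:
  assumes a: "progressively_measurable F T a" and \<omega>: "\<omega> \<in> space M"
  shows "(\<lambda>s. indicator {0..T} s * a s \<omega>) \<in> borel_measurable borel"
  using measurable_Pair1[OF progressive_measurable_pair[OF a, of T], of \<omega>] T_pos \<omega> by simp

lemma measurable_square_section:
  assumes a: "progressively_measurable F T a" and \<omega>: "\<omega> \<in> space M" and uv: "0 \<le> u" "v \<le> T"
  shows "(\<lambda>s. ennreal ((a s \<omega>)\<^sup>2) * indicator {u..v} s) \<in> borel_measurable lborel"
proof -
  note [measurable] = progressive_section[OF a \<omega>]
  have "(\<lambda>s. ennreal ((indicator {0..T} s * a s \<omega>)\<^sup>2) * indicator {u..v} s) \<in> borel_measurable lborel"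
    by measurable
  also have "(\<lambda>s. ennreal ((indicator {0..T} s * a s \<omega>)\<^sup>2) * indicator {u..v} s)
      = (\<lambda>s. ennreal ((a s \<omega>)\<^sup>2) * indicator {u..v} s)"
    using uv by (auto simp: indicator_def fun_eq_iff)
  finally show ?thesis .
qed

lemma progressive_time:
  assumes a: "progressively_measurable F T a" and u: "0 \<le> u" "u \<le> T"
  shows "a u \<in> borel_measurable (F u)"
  using measurable_Pair2[OF progressive_measurable_pair[OF assms], of u] u by simp

lemma progressive_square:
  "progressively_measurable F T a \<Longrightarrow> progressively_measurable F T (\<lambda>s \<omega>. (a s \<omega>)\<^sup>2)"
  unfolding progressively_measurable_def by (auto simp: case_prod_beta')

text \<open>Joint measurability up to time \<open>u\<close>, which is more than adaptedness, makes
  the integrated control adapted.\<close>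

lemma measurable_set_integral:
  assumes a: "progressively_measurable F T a" and u: "0 \<le> t0" "0 \<le> u" "u \<le> T"
  shows "(\<lambda>\<omega>. LINT s:{t0..u}|lborel. a s \<omega>) \<in> borel_measurable (F u)"
proof -
  note [measurable] = progressive_measurable_pair[OF a u(2,3)]
  have "(\<lambda>\<omega>. \<integral>s. indicator {t0..u} s * (\<lambda>(s, \<omega>). indicator {0..u} s * a s \<omega>) (s, \<omega>) \<partial>lborel) \<in> borel_measurable (F u)"
    by measurable
  also have "(\<lambda>\<omega>. \<integral>s. indicator {t0..u} s * (\<lambda>(s, \<omega>). indicator {0..u} s * a s \<omega>) (s, \<omega>) \<partial>lborel)
      = (\<lambda>\<omega>. LINT s:{t0..u}|lborel. a s \<omega>)"
    unfolding set_lebesgue_integral_def using u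
    by (intro ext Bochner_Integration.integral_cong) (auto simp: indicator_def)
  finally show ?thesis .
qed

lemma progressive_measurable_pair_M:
  assumes a: "progressively_measurable F T a"
  shows "(\<lambda>(s, \<omega>). indicator {0..T} s * a s \<omega>) \<in> borel_measurable (lborel \<Otimes>\<^sub>M M)"
proof -
  have [measurable]: "(\<lambda>\<omega>. \<omega>) \<in> M \<rightarrow>\<^sub>M F T" by (rule measurable_F_M[of _ T]) simp
  have [measurable]: "(\<lambda>(s, \<omega>). indicator {0..T} s * a s \<omega>) \<in> borel_measurable (lborel \<Otimes>\<^sub>M F T)"
    using T_pos by (intro progressive_measurable_pair[OF a]) auto
  have "(\<lambda>p. (\<lambda>(s, \<omega>). indicator {0..T} s * a s \<omega>) (fst p, snd p)) \<in> borel_measurable (lborel \<Otimes>\<^sub>M M)"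
    by measurable
  then show ?thesis by simp
qed

lemma measurable_set_nn_integral:
  assumes a: "progressively_measurable F T a" and u: "0 \<le> t0" "v \<le> T" and g [measurable]: "g \<in> borel_measurable borel"
  shows "(\<lambda>\<omega>. \<integral>\<^sup>+s\<in>{t0..v}. ennreal (g (a s \<omega>)) \<partial>lborel) \<in> borel_measurable M"
proof -
  note [measurable] = progressive_measurable_pair_M[OF a]
  have "(\<lambda>\<omega>. \<integral>\<^sup>+s. ennreal (g ((\<lambda>(s, \<omega>). indicator {0..T} s * a s \<omega>) (s, \<omega>))) * indicator {t0..v} s \<partial>lborel)
      \<in> borel_measurable M"
    by measurable
  also have "(\<lambda>\<omega>. \<integral>\<^sup>+s. ennreal (g ((\<lambda>(s, \<omega>). indicator {0..T} s * a s \<omega>) (s, \<omega>))) * indicator {t0..v} s \<partial>lborel)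
      = (\<lambda>\<omega>. \<integral>\<^sup>+s\<in>{t0..v}. ennreal (g (a s \<omega>)) \<partial>lborel)"
    using u by (intro ext nn_integral_cong) (auto simp: indicator_def)
  finally show ?thesis .
qed

lemma increment_bound:
  assumes a: "progressively_measurable F T a" and t0: "0 \<le> t0" and \<omega>: "\<omega> \<in> space M"
    and fin: "(\<integral>\<^sup>+s\<in>{t0..T}. ennreal ((a s \<omega>)\<^sup>2) \<partial>lborel) < \<infinity>"
  shows progressive_square_set_integrable: "set_integrable lborel {t0..T} (\<lambda>s. (a s \<omega>)\<^sup>2)"
    and progressive_set_integrable: "set_integrable lborel {t0..T} (\<lambda>s. a s \<omega>)"
    and progressive_increment: "\<And>u v. t0 \<le> u \<Longrightarrow> u < v \<Longrightarrow> v \<le> T \<Longrightarrow>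
      ((LINT s:{t0..v}|lborel. a s \<omega>) - (LINT s:{t0..u}|lborel. a s \<omega>))\<^sup>2
        \<le> (v - u) * ((LINT s:{t0..v}|lborel. (a s \<omega>)\<^sup>2) - (LINT s:{t0..u}|lborel. (a s \<omega>)\<^sup>2))"
proof -
  \<comment> \<open>Progressive measurability says nothing about \<open>a\<close> beyond
    \<open>{0..T}\<close>, so the path is cut off before it is treated as a measurable function on
    the line.\<close>
  define b where "b s = indicator {0..T} s * a s \<omega>" for s
  have [measurable]: "b \<in> borel_measurable borel"
    unfolding b_def by (rule progressive_section[OF a \<omega>])
  have ab: "b s = a s \<omega>" if "s \<in> {t0..T}" for s using that t0 by (simp add: b_def)
  have "(\<integral>\<^sup>+s. ennreal (norm (indicator {t0..T} s *\<^sub>R (b s)\<^sup>2)) \<partial>lborel)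
      = (\<integral>\<^sup>+s\<in>{t0..T}. ennreal ((a s \<omega>)\<^sup>2) \<partial>lborel)"
    using ab by (intro nn_integral_cong) (auto simp: indicator_def)
  then have bsq: "set_integrable lborel {t0..T} (\<lambda>s. (b s)\<^sup>2)"
    using fin unfolding set_integrable_def by (intro integrableI_bounded) auto
  then show sq: "set_integrable lborel {t0..T} (\<lambda>s. (a s \<omega>)\<^sup>2)"
    by (rule set_integrable_cong[THEN iffD1, rotated -1]) (use ab in auto)
  have "set_integrable lborel {t0..T} b"
    by (rule set_integrable_of_square[OF _ bsq]) measurable
  then show si: "set_integrable lborel {t0..T} (\<lambda>s. a s \<omega>)"
    by (rule set_integrable_cong[THEN iffD1, rotated -1]) (use ab in auto)
  fix u v assume uv: "t0 \<le> u" "u < v" "v \<le> T"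
  have i: "set_integrable lborel {t0..v} (\<lambda>s. a s \<omega>)" "set_integrable lborel {t0..v} (\<lambda>s. (a s \<omega>)\<^sup>2)"
    by (rule set_integrable_subset[OF si] set_integrable_subset[OF sq]; use uv in auto)+
  have j: "set_integrable lborel {u<..v} (\<lambda>s. a s \<omega>)" "set_integrable lborel {u<..v} (\<lambda>s. (a s \<omega>)\<^sup>2)"
    by (rule set_integrable_subset[OF si] set_integrable_subset[OF sq]; use uv in auto)+
  show "((LINT s:{t0..v}|lborel. a s \<omega>) - (LINT s:{t0..u}|lborel. a s \<omega>))\<^sup>2
        \<le> (v - u) * ((LINT s:{t0..v}|lborel. (a s \<omega>)\<^sup>2) - (LINT s:{t0..u}|lborel. (a s \<omega>)\<^sup>2))"
    using set_integral_square_le[OF uv(2) j] uv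
    by (simp only: set_integral_Icc_diff[OF _ _ i(1)] set_integral_Icc_diff[OF _ _ i(2)] less_imp_le)
qed

text \<open>By Cauchy-Schwarz the missing piece is at most the square root of the remaining time
  times the energy.\<close>

lemma progressive_integral_tendsto:
  assumes a: "progressively_measurable F T a" and t0: "0 \<le> t0" and \<omega>: "\<omega> \<in> space M"
    and fin: "(\<integral>\<^sup>+s\<in>{t0..T}. ennreal ((a s \<omega>)\<^sup>2) \<partial>lborel) < \<infinity>"
    and u: "\<And>n. t0 \<le> u n" "\<And>n. u n < T" "u \<longlonglongrightarrow> T"
  shows "(\<lambda>n. LINT s:{t0..u n}|lborel. a s \<omega>) \<longlonglongrightarrow> (LINT s:{t0..T}|lborel. a s \<omega>)"
proof -
  define I where "I v = (LINT s:{t0..v}|lborel. a s \<omega>)" for v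
  define J where "J v = (LINT s:{t0..v}|lborel. (a s \<omega>)\<^sup>2)" for v
  have J0: "0 \<le> J v" for v
    unfolding J_def set_lebesgue_integral_def by (intro integral_nonneg_AE AE_I2) auto
  have "(\<lambda>n. (I T - I (u n))\<^sup>2) \<longlonglongrightarrow> 0"
  proof (rule tendsto_sandwich[OF _ _ tendsto_const])
    show "\<forall>\<^sub>F n in sequentially. (I T - I (u n))\<^sup>2 \<le> (T - u n) * J T"
    proof (intro always_eventually allI)
      fix n
      have "(I T - I (u n))\<^sup>2 \<le> (T - u n) * (J T - J (u n))"
        unfolding I_def J_def using u by (intro progressive_increment[OF a t0 \<omega> fin]) auto
      also have "\<dots> \<le> (T - u n) * J T"
        using u(2)[of n] J0[of "u n"] by (intro mult_left_mono) auto
      finally show "(I T - I (u n))\<^sup>2 \<le> (T - u n) * J T" .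
    qed
    have "(\<lambda>n. (T - u n) * J T) \<longlonglongrightarrow> (T - T) * J T"
      by (intro tendsto_intros u)
    then show "(\<lambda>n. (T - u n) * J T) \<longlonglongrightarrow> 0" by simp
  qed auto
  then have "(\<lambda>n. sqrt ((I T - I (u n))\<^sup>2)) \<longlonglongrightarrow> sqrt 0"
    by (rule tendsto_real_sqrt)
  then have "(\<lambda>n. I T - I (u n)) \<longlonglongrightarrow> 0"
    by (simp add: tendsto_rabs_zero_iff)
  from tendsto_diff[OF tendsto_const[of "I T"] this] show ?thesis by (simp add: I_def)
qed

text \<open>The discrete bound is the same for every mesh, and the mesh enters only through the
  delay of one step. The delayed integral converges to the full one on paths of finite energy, and
  continuity of \<open>f\<close> carries this to the payoff.\<close>

lemma upper_bound_continuous: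
  assumes a: "progressively_measurable F T a" and t0: "0 \<le> t0" "t0 < T"
    and fin: "(\<integral>\<^sup>+\<omega>. (\<integral>\<^sup>+s\<in>{t0..T}. ennreal ((a s \<omega>)\<^sup>2) \<partial>lborel) \<partial>M) = ennreal Q" and Q: "0 \<le> Q"
    and f: "continuous_on UNIV f" and K: "\<And>x. \<bar>f x\<bar> \<le> K"
  shows "(\<integral>\<omega>. f (x + (LINT s:{t0..T}|lborel. a s \<omega>) + \<sigma> * (B T \<omega> - B t0 \<omega>)) \<partial>M)
    \<le> loglap (sd (T - t0)) f x + Q / (2 * \<sigma>\<^sup>2)"
proof -
  have fm [measurable]: "f \<in> borel_measurable borel"
    using f by (rule borel_measurable_continuous_onI)
  define I where "I u \<omega> = (LINT s:{t0..u}|lborel. a s \<omega>)" for u \<omega>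
  define J where "J u \<omega> = (LINT s:{t0..u}|lborel. (a s \<omega>)\<^sup>2)" for u \<omega>
  have Im: "I u \<in> borel_measurable (F u)" if "t0 \<le> u" "u \<le> T" for u
    unfolding I_def using measurable_set_integral[OF a] that t0 by auto
  have Jm: "J u \<in> borel_measurable M" if "t0 \<le> u" "u \<le> T" for u
    unfolding J_def using measurable_F_M[OF measurable_set_integral[OF progressive_square[OF a]]] that t0 by auto
  have "AE \<omega> in M. (\<integral>\<^sup>+s\<in>{t0..T}. ennreal ((a s \<omega>)\<^sup>2) \<partial>lborel) \<noteq> \<infinity>"
    using measurable_set_nn_integral[OF a t0(1) order_refl, of "\<lambda>x. x\<^sup>2"] fin by (intro nn_integral_PInf_AE) auto
  then have good: "AE \<omega> in M. \<omega> \<in> space M \<and> (\<integral>\<^sup>+s\<in>{t0..T}. ennreal ((a s \<omega>)\<^sup>2) \<partial>lborel) < \<infinity>"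
    by (rule AE_mp) (auto simp: less_top)
  have IJ: "AE \<omega> in M. \<forall>u v. t0 \<le> u \<longrightarrow> u < v \<longrightarrow> v \<le> T \<longrightarrow> (I v \<omega> - I u \<omega>)\<^sup>2 \<le> (v - u) * (J v \<omega> - J u \<omega>)"
    using good unfolding I_def J_def
    by eventually_elim (use progressive_increment[OF a t0(1)] in blast)
  have JT_nn: "AE \<omega> in M. ennreal (J T \<omega>) = (\<integral>\<^sup>+s\<in>{t0..T}. ennreal ((a s \<omega>)\<^sup>2) \<partial>lborel)"
    using good
  proof eventually_elim
    case (elim \<omega>)
    then have "set_integrable lborel {t0..T} (\<lambda>s. (a s \<omega>)\<^sup>2)"
      using progressive_square_set_integrable[OF a t0(1)] by auto
    then have "(\<integral>\<^sup>+s. ennreal (indicator {t0..T} s *\<^sub>R (a s \<omega>)\<^sup>2) \<partial>lborel) = ennreal (J T \<omega>)"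
      unfolding J_def set_lebesgue_integral_def set_integrable_def
      by (intro nn_integral_eq_integral) auto
    moreover have "(\<integral>\<^sup>+s. ennreal (indicator {t0..T} s *\<^sub>R (a s \<omega>)\<^sup>2) \<partial>lborel)
        = (\<integral>\<^sup>+s\<in>{t0..T}. ennreal ((a s \<omega>)\<^sup>2) \<partial>lborel)"
      by (intro nn_integral_cong) (auto simp: indicator_def)
    ultimately show ?case by simp
  qed
  have J0: "0 \<le> J u \<omega>" for u \<omega>
    unfolding J_def set_lebesgue_integral_def by (intro integral_nonneg_AE AE_I2) auto
  have JT: "(\<integral>\<^sup>+\<omega>. ennreal (J T \<omega>) \<partial>M) = ennreal Q"
    using JT_nn fin by (subst nn_integral_cong_AE[OF JT_nn]) auto
  have intJT: "integrable M (J T)"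
    using JT Jm[of T] t0 J0 by (intro integrableI_nonneg) auto
  have EJT: "(\<integral>\<omega>. J T \<omega> \<partial>M) = Q"
    using JT Jm[of T] t0 J0 Q by (simp add: integral_eq_nn_integral)
  have Jle: "AE \<omega> in M. \<forall>u. t0 \<le> u \<longrightarrow> u \<le> T \<longrightarrow> J u \<omega> \<le> J T \<omega>"
    using IJ
  proof eventually_elim
    case (elim \<omega>)
    show ?case
    proof (intro allI impI)
      fix u assume u: "t0 \<le> u" "u \<le> T"
      show "J u \<omega> \<le> J T \<omega>"
      proof (cases "u = T")
        case False
        then have "0 \<le> (T - u) * (J T \<omega> - J u \<omega>)"
          using u elim by (meson order_trans zero_le_power2 order_refl less_le)
        then show ?thesis using False u by (simp add: zero_le_mult_iff)
      qed simp
    qed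
  qed
  have intJ: "integrable M (J u)" if u: "t0 \<le> u" "u \<le> T" for u
  proof (rule Bochner_Integration.integrable_bound[OF intJT])
    show "J u \<in> borel_measurable M" using u by (rule Jm)
    show "AE \<omega> in M. norm (J u \<omega>) \<le> norm (J T \<omega>)"
      using Jle by eventually_elim (use J0 u in auto)
  qed
  have le: "(\<integral>\<omega>. f (x + I (T - (T - t0) / real (Suc n)) \<omega> + \<sigma> * (B T \<omega> - B t0 \<omega>)) \<partial>M)
      \<le> loglap (sd (T - t0)) f x + Q / (2 * \<sigma>\<^sup>2)" for n
    unfolding EJT [symmetric]
  proof (rule upper_discrete[where K=K])
    show "I t0 \<omega> = 0" "J t0 \<omega> = 0" for \<omega> by (simp_all add: I_def J_def set_integral_singleton)
    fix u v assume "t0 \<le> u" "u < v" "v \<le> T"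
    then show "AE \<omega> in M. (I v \<omega> - I u \<omega>)\<^sup>2 \<le> (v - u) * (J v \<omega> - J u \<omega>)"
      using IJ by (auto elim!: eventually_mono)
  qed (use t0 K Im intJ in auto)
  \<comment> \<open>The last grid point before \<open>T\<close>, up to which the delayed control
    acts in \<open>upper_discrete\<close>.\<close>
  define u where "u n = T - (T - t0) / real (Suc n)" for n
  have u: "t0 \<le> u n" "u n < T" for n
  proof -
    have "(T - t0) / real (Suc n) \<le> T - t0"
      using t0 by (simp add: divide_le_eq mult_le_cancel_left1)
    then show "t0 \<le> u n" by (simp add: u_def)
    show "u n < T" using t0 by (simp add: u_def)
  qed
  have uT: "u \<longlonglongrightarrow> T"
  proof -
    have "(\<lambda>n. T - (T - t0) * inverse (real (Suc n))) \<longlonglongrightarrow> T - (T - t0) * 0"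
      by (intro tendsto_intros LIMSEQ_inverse_real_of_nat)
    then show ?thesis by (simp add: u_def[abs_def] divide_inverse)
  qed
  have conv: "AE \<omega> in M. (\<lambda>n. I (u n) \<omega>) \<longlonglongrightarrow> I T \<omega>"
    using good unfolding I_def
    by eventually_elim (rule progressive_integral_tendsto[OF a t0(1) _ _ u uT]; simp)
  have [measurable]: "I T \<in> borel_measurable M" "I (u n) \<in> borel_measurable M" for n
    using measurable_F_M[OF Im] u[of n] t0 by auto
  have [measurable]: "B T \<in> borel_measurable M" "B t0 \<in> borel_measurable M" using t0 by auto
  have "(\<lambda>n. \<integral>\<omega>. f (x + I (u n) \<omega> + \<sigma> * (B T \<omega> - B t0 \<omega>)) \<partial>M)
      \<longlonglongrightarrow> (\<integral>\<omega>. f (x + I T \<omega> + \<sigma> * (B T \<omega> - B t0 \<omega>)) \<partial>M)"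
  proof (rule integral_dominated_convergence[where w="\<lambda>_. K"])
    show "AE \<omega> in M. (\<lambda>n. f (x + I (u n) \<omega> + \<sigma> * (B T \<omega> - B t0 \<omega>)))
        \<longlonglongrightarrow> f (x + I T \<omega> + \<sigma> * (B T \<omega> - B t0 \<omega>))"
      using conv
    proof eventually_elim
      case (elim \<omega>)
      show ?case
        by (rule continuous_on_tendsto_compose[OF f]) (auto intro!: tendsto_intros elim)
    qed
    show "AE \<omega> in M. norm (f (x + I (u n) \<omega> + \<sigma> * (B T \<omega> - B t0 \<omega>))) \<le> K" for n
      using K by simp
  qed auto
  then show ?thesis
    unfolding I_def [of T, symmetric] using le unfolding u_def [symmetric] by (intro LIMSEQ_le_const2) auto
qed

text \<open>The envelopes lie above \<open>f\<close>, so replacing \<open>f\<close> by one only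
  raises the payoff, while upper semicontinuity brings the right side back to \<open>f\<close> in
  the limit.\<close>

lemma upper_bound:
  assumes a: "progressively_measurable F T a" and t0: "0 \<le> t0" "t0 < T"
    and fin: "(\<integral>\<^sup>+\<omega>. (\<integral>\<^sup>+s\<in>{t0..T}. ennreal ((a s \<omega>)\<^sup>2) \<partial>lborel) \<partial>M) = ennreal Q" and Q: "0 \<le> Q"
    and f [measurable]: "f \<in> borel_measurable borel" and K: "\<And>x. \<bar>f x\<bar> \<le> K"
    and usc: "\<And>x e. 0 < e \<Longrightarrow> \<exists>d>0. \<forall>y. \<bar>y - x\<bar> < d \<longrightarrow> f y < f x + e"
  shows "(\<integral>\<omega>. f (x + (LINT s:{t0..T}|lborel. a s \<omega>) + \<sigma> * (B T \<omega> - B t0 \<omega>)) \<partial>M)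
    \<le> loglap (sd (T - t0)) f x + Q / (2 * \<sigma>\<^sup>2)"
proof -
  have [measurable]: "(\<lambda>\<omega>. LINT s:{t0..T}|lborel. a s \<omega>) \<in> borel_measurable M"
    using measurable_F_M[OF measurable_set_integral[OF a]] t0 by auto
  have [measurable]: "B T \<in> borel_measurable M" "B t0 \<in> borel_measurable M" using t0 by auto
  note fm = measurable_sup_conv[OF K] and Km = abs_sup_conv_le[OF K] and lim = sup_conv_tendsto[OF K usc]
  note fm [measurable]
  have "(\<integral>\<omega>. f (x + (LINT s:{t0..T}|lborel. a s \<omega>) + \<sigma> * (B T \<omega> - B t0 \<omega>)) \<partial>M)
      \<le> loglap (sd (T - t0)) (sup_conv f m) x + Q / (2 * \<sigma>\<^sup>2)" for m
  proof -
    have "(\<integral>\<omega>. f (x + (LINT s:{t0..T}|lborel. a s \<omega>) + \<sigma> * (B T \<omega> - B t0 \<omega>)) \<partial>M)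
      \<le> (\<integral>\<omega>. sup_conv f m (x + (LINT s:{t0..T}|lborel. a s \<omega>) + \<sigma> * (B T \<omega> - B t0 \<omega>)) \<partial>M)"
      using K Km sup_conv_ge_self[OF K] by (intro integral_mono integrable_bounded[of _ K]) auto
    also have "\<dots> \<le> loglap (sd (T - t0)) (sup_conv f m) x + Q / (2 * \<sigma>\<^sup>2)"
      by (rule upper_bound_continuous[OF a t0 fin Q continuous_on_sup_conv[OF K] Km])
    finally show ?thesis .
  qed
  moreover have "(\<lambda>m. loglap (sd (T - t0)) (sup_conv f m) x + Q / (2 * \<sigma>\<^sup>2))
      \<longlonglongrightarrow> loglap (sd (T - t0)) f x + Q / (2 * \<sigma>\<^sup>2)"
    by (intro tendsto_intros tendsto_loglap_fun[OF fm f Km K] AE_I2 lim)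
  ultimately show ?thesis by (intro LIMSEQ_le_const) auto
qed

end

section \<open>The lower bound by Euler controls\<close>

text \<open>At a given time at most one interval of the grid is active. The same index serves all
  coefficient families \<open>g\<close>, which permits squaring a step control term by term.\<close>

lemma step_function_cases:
  fixes t :: "nat \<Rightarrow> real" and s :: real
  assumes mono: "\<And>i j. i \<le> j \<Longrightarrow> t i \<le> t j"
  shows "(\<exists>j<n. \<forall>g :: nat \<Rightarrow> real. (\<Sum>i<n. indicator {t i..<t (Suc i)} s * g i) = g j)
    \<or> (\<forall>g :: nat \<Rightarrow> real. (\<Sum>i<n. indicator {t i..<t (Suc i)} s * g i) = 0)"
proof (cases "\<exists>j<n. s \<in> {t j..<t (Suc j)}")
  case True
  then obtain j where j: "j < n" "s \<in> {t j..<t (Suc j)}" by auto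
  have uniq: "i = j" if "s \<in> {t i..<t (Suc i)}" for i
  proof (rule antisym)
    show "i \<le> j"
    proof (rule ccontr)
      assume "\<not> i \<le> j"
      then have "t (Suc j) \<le> t i" by (intro mono) simp
      with that j(2) show False by simp
    qed
    show "j \<le> i"
    proof (rule ccontr)
      assume "\<not> j \<le> i"
      then have "t (Suc i) \<le> t j" by (intro mono) simp
      with that j(2) show False by simp
    qed
  qed
  have "(\<Sum>i<n. indicator {t i..<t (Suc i)} s * g i) = g j" for g :: "nat \<Rightarrow> real"
  proof -
    have "(\<Sum>i<n. indicator {t i..<t (Suc i)} s * g i) = (\<Sum>i<n. if i = j then g j else 0)"
    proof (rule sum.cong[OF refl])
      fix i show "indicator {t i..<t (Suc i)} s * g i = (if i = j then g j else 0)"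
        using uniq[of i] j(2) by (cases "i = j") (auto simp: indicator_def simp del: atLeastLessThan_iff)
    qed
    then show ?thesis using j(1) by (simp only: sum.delta[OF finite_lessThan] lessThan_iff if_True)
  qed
  then show ?thesis using j(1) by blast
next
  case False
  then have "(\<Sum>i<n. indicator {t i..<t (Suc i)} s * g i) = 0" for g :: "nat \<Rightarrow> real"
    by (intro sum.neutral) (auto simp: indicator_def)
  then show ?thesis by blast
qed

context brownian_space
begin

text \<open>The feedback \<open>v\<^sub>x / (2 c)\<close> for
  \<open>v = 2 c \<sigma>\<^sup>2 loglap\<close>: the constant \<open>c\<close> drops out.\<close>

definition drift :: "(real \<Rightarrow> real) \<Rightarrow> real \<Rightarrow> real \<Rightarrow> real" where
  "drift f t x = \<sigma>\<^sup>2 * score (sd (T - t)) f x"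

lemma measurable_drift [measurable]:
  assumes [measurable]: "f \<in> borel_measurable borel" "s \<in> borel_measurable N" "g \<in> borel_measurable N"
  shows "(\<lambda>x. drift f (s x) (g x)) \<in> borel_measurable N"
  unfolding drift_def by measurable

text \<open>If the displacement is \<open>(t - s)\<close> times the drift, the estimate of order
  \<open>s ^ 4\<close> in \<open>loglap_le_heat_step\<close> gives a loss quadratic in
  \<open>t - s\<close>. The drift is taken at the right end \<open>t\<close>, since the estimate
  differentiates the value at that time; evaluated at the state of time \<open>s\<close> it is still
  known at \<open>s\<close>. Any other displacement \<open>A\<close> is paid for with the Lipschitz
  constant of the value. Distance \<open>\<delta>\<close> from \<open>T\<close> keeps all constants
  uniform.\<close>

lemma lower_step:
  assumes f [measurable]: "f \<in> borel_measurable borel" and K: "\<And>x. \<bar>f x\<bar> \<le> K" and \<delta>: "0 < \<delta>"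
  obtains C P where "0 \<le> C" "0 \<le> P"
    "\<And>t x. t \<le> T - \<delta> \<Longrightarrow> \<bar>drift f t x\<bar> \<le> P"
    "\<And>s t Y A. \<lbrakk>0 \<le> s; s < t; t \<le> T - \<delta>; Y \<in> borel_measurable (F s); integrable M A\<rbrakk> \<Longrightarrow>
      (\<integral>\<omega>. loglap (sd (T - s)) f (Y \<omega>) \<partial>M) + (\<integral>\<omega>. (t - s) * (drift f t (Y \<omega>))\<^sup>2 \<partial>M) / (2 * \<sigma>\<^sup>2)
      \<le> (\<integral>\<omega>. loglap (sd (T - t)) f (Y \<omega> + A \<omega> + \<sigma> * (B t \<omega> - B s \<omega>)) \<partial>M)
        + C * (t - s)\<^sup>2 + P * (\<integral>\<omega>. \<bar>A \<omega> - (t - s) * drift f t (Y \<omega>)\<bar> \<partial>M)"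
proof -
  have K0: "0 \<le> K" using order_trans[OF abs_ge_zero K[of 0]] .
  obtain L where L: "0 \<le> L" "\<And>s x. 0 < s \<Longrightarrow> \<bar>score s f x\<bar> \<le> L / s"
    "\<And>s x y. 0 < s \<Longrightarrow> \<bar>score s f x - score s f y\<bar> \<le> L / s\<^sup>2 * \<bar>x - y\<bar>"
    using score_bounds[of K] f K by metis
  define P where "P = L / sd \<delta>"
  define L2 where "L2 = L / (sd \<delta>)\<^sup>2"
  have sd\<delta>: "0 < sd \<delta>" using \<delta> \<sigma>_pos by simp
  have P0: "0 \<le> P" "0 \<le> L2" using L(1) sd\<delta> by (auto simp: P_def L2_def)
  have sdle: "sd \<delta> \<le> sd (T - t)" if "t \<le> T - \<delta>" for t
    using that \<sigma>_pos by (intro mult_left_mono real_sqrt_le_mono) auto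
  have sP: "\<bar>score (sd (T - t)) f x\<bar> \<le> P" if "t \<le> T - \<delta>" for t x
  proof -
    have "\<bar>score (sd (T - t)) f x\<bar> \<le> L / sd (T - t)" using sdle[OF that] sd\<delta> by (intro L(2)) simp
    also have "\<dots> \<le> P" unfolding P_def by (rule frac_le[OF L(1) order_refl sd\<delta> sdle[OF that]])
    finally show ?thesis .
  qed
  have sL: "\<bar>score (sd (T - t)) f x - score (sd (T - t)) f y\<bar> \<le> L2 * \<bar>x - y\<bar>" if "t \<le> T - \<delta>" for t x y
  proof -
    have "\<bar>score (sd (T - t)) f x - score (sd (T - t)) f y\<bar> \<le> L / (sd (T - t))\<^sup>2 * \<bar>x - y\<bar>"
      using sdle[OF that] sd\<delta> by (intro L(3)) simp
    also have "\<dots> \<le> L2 * \<bar>x - y\<bar>"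
      unfolding L2_def using sdle[OF that] sd\<delta> L(1)
      by (intro mult_right_mono divide_left_mono power_mono mult_pos_pos[OF zero_less_power zero_less_power]) (linarith | simp)+
    finally show ?thesis .
  qed
  have S0: "0 \<le> sd T" using T_pos \<sigma>_pos by simp
  obtain C where C: "0 \<le> C"
    "\<And>\<psi> \<psi>' s x. \<lbrakk>\<psi> \<in> borel_measurable borel; \<And>x. \<bar>\<psi> x\<bar> \<le> K;
      \<And>x. (\<psi> has_real_derivative \<psi>' x) (at x); \<And>x. \<bar>\<psi>' x\<bar> \<le> P;
      \<And>x y. \<bar>\<psi>' x - \<psi>' y\<bar> \<le> L2 * \<bar>x - y\<bar>; 0 \<le> s; s \<le> sd T\<rbrakk>
      \<Longrightarrow> loglap s \<psi> x \<le> heat s \<psi> (x + s\<^sup>2 * \<psi>' x) - s\<^sup>2 * (\<psi>' x)\<^sup>2 / 2 + C * s ^ 4"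
    using loglap_le_heat_step[OF K0 P0 S0] by metis
  \<comment> \<open>One constant for two purposes: \<open>P\<close> is the Lipschitz constant of the
    value, \<open>\<sigma>\<^sup>2 * P\<close> bounds the drift.\<close>
  define P' where "P' = max P (\<sigma>\<^sup>2 * P)"
  show thesis
  proof (rule that[of "C * \<sigma> ^ 4" P'])
    show "0 \<le> C * \<sigma> ^ 4" "0 \<le> P'" using C(1) P0 by (auto simp: P'_def)
    have d\<sigma>: "\<bar>drift f t x\<bar> \<le> \<sigma>\<^sup>2 * P" if "t \<le> T - \<delta>" for t x
      using sP[OF that, of x] by (simp add: drift_def abs_mult mult_left_mono)
    then show "\<bar>drift f t x\<bar> \<le> P'" if "t \<le> T - \<delta>" for t x
      using d\<sigma>[OF that, of x] by (simp add: P'_def)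
    fix s t :: real and Y A :: "'a \<Rightarrow> real"
    assume st: "0 \<le> s" "s < t" "t \<le> T - \<delta>" and Y: "Y \<in> borel_measurable (F s)" and A: "integrable M A"
    define \<psi> where "\<psi> = loglap (sd (T - t)) f"
    define p where "p = score (sd (T - t)) f"
    have [measurable]: "\<psi> \<in> borel_measurable borel" "p \<in> borel_measurable borel"
      unfolding \<psi>_def p_def by measurable
    have [measurable]: "Y \<in> borel_measurable M" using measurable_F_M[OF Y] .
    have [measurable]: "A \<in> borel_measurable M" using A by auto
    have [measurable]: "B t \<in> borel_measurable M" "B s \<in> borel_measurable M" using st \<delta> by auto
    have tT: "t \<le> T" "0 < sd (T - t)" using st \<delta> \<sigma>_pos by auto
    have \<psi>: "\<bar>\<psi> x\<bar> \<le> K" for x unfolding \<psi>_def by (rule abs_loglap_le[OF f K])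
    have d: "(\<psi> has_real_derivative p x) (at x)" for x
      unfolding \<psi>_def p_def by (rule has_real_derivative_loglap[OF f K tT(2)])
    have pP: "\<bar>p x\<bar> \<le> P" for x using sP st unfolding p_def by auto
    have pL: "\<bar>p x - p y\<bar> \<le> L2 * \<bar>x - y\<bar>" for x y using sL st unfolding p_def by auto
    define r where "r = sd (t - s)"
    have r: "0 \<le> r" "r \<le> sd T" "r\<^sup>2 = \<sigma>\<^sup>2 * (t - s)"
      using st \<sigma>_pos \<delta> by (auto simp: r_def sd_square)
    define b where "b x = (t - s) * drift f t x" for x
    have b: "b x = r\<^sup>2 * p x" for x by (simp add: b_def drift_def p_def r(3))
    have [measurable]: "b \<in> borel_measurable borel" unfolding b_def by measurable
    have bbd: "\<bar>b x\<bar> \<le> r\<^sup>2 * P" for x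
      unfolding b abs_mult using pP by (intro mult_mono) auto
    have intb: "integrable M (\<lambda>\<omega>. b (Y \<omega>))" using bbd by (intro integrable_bounded) auto
    have pb: "r\<^sup>2 * (p x)\<^sup>2 / 2 = (t - s) * (drift f t x)\<^sup>2 / (2 * \<sigma>\<^sup>2)" for x
      unfolding r(3) drift_def p_def using \<sigma>_pos by (simp add: power2_eq_square)
    have step: "loglap (sd (T - s)) f x + (t - s) * (drift f t x)\<^sup>2 / (2 * \<sigma>\<^sup>2)
        \<le> heat r \<psi> (x + b x) + C * \<sigma> ^ 4 * (t - s)\<^sup>2" for x
    proof -
      have "loglap r \<psi> x \<le> heat r \<psi> (x + r\<^sup>2 * p x) - r\<^sup>2 * (p x)\<^sup>2 / 2 + C * r ^ 4"
        by (rule C(2)[OF _ \<psi> d pP pL r(1,2)]) measurable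
      moreover have "loglap r \<psi> x = loglap (sd (T - s)) f x"
        unfolding r_def \<psi>_def by (rule loglap_sd[OF f K]) (use st tT in auto)
      moreover have "r ^ 4 = \<sigma> ^ 4 * (t - s)\<^sup>2"
      proof -
        have "r ^ 4 = (r\<^sup>2)\<^sup>2" by simp
        also have "\<dots> = (\<sigma>\<^sup>2)\<^sup>2 * (t - s)\<^sup>2" unfolding r(3) by (rule power_mult_distrib)
        finally show ?thesis by simp
      qed
      ultimately show ?thesis by (simp add: pb b mult.assoc)
    qed
    have sq: "(drift f t x)\<^sup>2 \<le> (\<sigma>\<^sup>2 * P)\<^sup>2" for x
      using d\<sigma>[OF st(3), of x] by (rule power2_le_iff_abs_le[THEN iffD2, rotated]) (use P0 in simp)
    have int1: "integrable M (\<lambda>\<omega>. loglap (sd (T - s)) f (Y \<omega>))"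
      using abs_loglap_le[OF f K] by (intro integrable_bounded[of _ K]) auto
    have int2: "integrable M (\<lambda>\<omega>. (t - s) * (drift f t (Y \<omega>))\<^sup>2)"
      using sq by (intro integrable_mult_right integrable_bounded[of _ "(\<sigma>\<^sup>2 * P)\<^sup>2"]) auto
    have int3: "integrable M (\<lambda>\<omega>. heat r \<psi> (Y \<omega> + b (Y \<omega>)))"
      using abs_heat_le[of \<psi> K] \<psi> by (intro integrable_bounded[of _ K]) auto
    have int4: "integrable M (\<lambda>\<omega>. \<psi> (Y \<omega> + A \<omega> + \<sigma> * (B t \<omega> - B s \<omega>)))"
      using \<psi> by (intro integrable_bounded[of _ K]) auto
    have int5: "integrable M (\<lambda>\<omega>. \<bar>A \<omega> - b (Y \<omega>)\<bar>)"
      using A intb by auto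
    have "(\<integral>\<omega>. loglap (sd (T - s)) f (Y \<omega>) \<partial>M) + (\<integral>\<omega>. (t - s) * (drift f t (Y \<omega>))\<^sup>2 \<partial>M) / (2 * \<sigma>\<^sup>2)
        = (\<integral>\<omega>. loglap (sd (T - s)) f (Y \<omega>) + (t - s) * (drift f t (Y \<omega>))\<^sup>2 / (2 * \<sigma>\<^sup>2) \<partial>M)"
      using int1 int2 by (subst Bochner_Integration.integral_add) auto
    also have "\<dots> \<le> (\<integral>\<omega>. heat r \<psi> (Y \<omega> + b (Y \<omega>)) + C * \<sigma> ^ 4 * (t - s)\<^sup>2 \<partial>M)"
      using int1 int2 int3 step by (intro integral_mono) auto
    also have "\<dots> = (\<integral>\<omega>. heat r \<psi> (Y \<omega> + b (Y \<omega>)) \<partial>M) + C * \<sigma> ^ 4 * (t - s)\<^sup>2"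
      using int3 prob_space by (subst Bochner_Integration.integral_add) auto
    also have "(\<integral>\<omega>. heat r \<psi> (Y \<omega> + b (Y \<omega>)) \<partial>M) = (\<integral>\<omega>. \<psi> (Y \<omega> + b (Y \<omega>) + \<sigma> * (B t \<omega> - B s \<omega>)) \<partial>M)"
      unfolding r_def using Y \<psi> by (intro integral_increment[symmetric] st tT) auto
    \<comment> \<open>The ideal displacement is exchanged for the actual one under the Lipschitz
      function \<open>\<psi>\<close>. This avoids any measurability of \<open>A\<close> at time
      \<open>s\<close>.\<close>
    also have "\<dots> \<le> (\<integral>\<omega>. \<psi> (Y \<omega> + A \<omega> + \<sigma> * (B t \<omega> - B s \<omega>)) + P * \<bar>A \<omega> - b (Y \<omega>)\<bar> \<partial>M)"
    proof (rule integral_mono)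
      show "integrable M (\<lambda>\<omega>. \<psi> (Y \<omega> + b (Y \<omega>) + \<sigma> * (B t \<omega> - B s \<omega>)))"
        using \<psi> by (intro integrable_bounded[of _ K]) auto
      show "integrable M (\<lambda>\<omega>. \<psi> (Y \<omega> + A \<omega> + \<sigma> * (B t \<omega> - B s \<omega>)) + P * \<bar>A \<omega> - b (Y \<omega>)\<bar>)"
        using int4 int5 by auto
      fix \<omega>
      have "\<bar>\<psi> (Y \<omega> + b (Y \<omega>) + \<sigma> * (B t \<omega> - B s \<omega>)) - \<psi> (Y \<omega> + A \<omega> + \<sigma> * (B t \<omega> - B s \<omega>))\<bar>
        \<le> P * \<bar>Y \<omega> + b (Y \<omega>) + \<sigma> * (B t \<omega> - B s \<omega>) - (Y \<omega> + A \<omega> + \<sigma> * (B t \<omega> - B s \<omega>))\<bar>"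
        by (rule lipschitz_of_bounded_derivative[OF d pP])
      also have "Y \<omega> + b (Y \<omega>) + \<sigma> * (B t \<omega> - B s \<omega>) - (Y \<omega> + A \<omega> + \<sigma> * (B t \<omega> - B s \<omega>)) = b (Y \<omega>) - A \<omega>"
        by simp
      finally show "\<psi> (Y \<omega> + b (Y \<omega>) + \<sigma> * (B t \<omega> - B s \<omega>))
        \<le> \<psi> (Y \<omega> + A \<omega> + \<sigma> * (B t \<omega> - B s \<omega>)) + P * \<bar>A \<omega> - b (Y \<omega>)\<bar>"
        by (simp add: abs_minus_commute)
    qed
    also have "\<dots> = (\<integral>\<omega>. \<psi> (Y \<omega> + A \<omega> + \<sigma> * (B t \<omega> - B s \<omega>)) \<partial>M) + P * (\<integral>\<omega>. \<bar>A \<omega> - b (Y \<omega>)\<bar> \<partial>M)"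
      using int4 int5 by (subst Bochner_Integration.integral_add) auto
    also have "P * (\<integral>\<omega>. \<bar>A \<omega> - b (Y \<omega>)\<bar> \<partial>M) \<le> P' * (\<integral>\<omega>. \<bar>A \<omega> - b (Y \<omega>)\<bar> \<partial>M)"
      by (intro mult_right_mono integral_nonneg_AE AE_I2) (auto simp: P'_def)
    finally show "(\<integral>\<omega>. loglap (sd (T - s)) f (Y \<omega>) \<partial>M) + (\<integral>\<omega>. (t - s) * (drift f t (Y \<omega>))\<^sup>2 \<partial>M) / (2 * \<sigma>\<^sup>2)
      \<le> (\<integral>\<omega>. loglap (sd (T - t)) f (Y \<omega> + A \<omega> + \<sigma> * (B t \<omega> - B s \<omega>)) \<partial>M)
        + C * \<sigma> ^ 4 * (t - s)\<^sup>2 + P' * (\<integral>\<omega>. \<bar>A \<omega> - (t - s) * drift f t (Y \<omega>)\<bar> \<partial>M)"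
      unfolding \<psi>_def b_def by linarith
  qed
qed

text \<open>Two processes are fed into this telescoping sum: the Euler scheme, for which the last
  error vanishes, and the feedback process sampled on a grid. The recursion is required only almost
  surely because the equation of the latter holds only almost surely.\<close>

lemma lower_discrete:
  assumes f: "f \<in> borel_measurable borel" and K: "\<And>x. \<bar>f x\<bar> \<le> K" and \<delta>: "0 < \<delta>"
  obtains C P where "0 \<le> C" "0 \<le> P"
    "\<And>t x. t \<le> T - \<delta> \<Longrightarrow> \<bar>drift f t x\<bar> \<le> P"
    "\<And>t0 h n t Y A. \<lbrakk>0 \<le> t0; 0 < h; t0 + real n * h \<le> T - \<delta>; \<And>i. t i = t0 + real i * h;
      \<And>i. i \<le> n \<Longrightarrow> Y i \<in> borel_measurable (F (t i)); \<And>i. i < n \<Longrightarrow> integrable M (A i);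
      \<And>i. i < n \<Longrightarrow> AE \<omega> in M. Y (Suc i) \<omega> = Y i \<omega> + A i \<omega> + \<sigma> * (B (t (Suc i)) \<omega> - B (t i) \<omega>)\<rbrakk> \<Longrightarrow>
      (\<integral>\<omega>. loglap (sd (T - t0)) f (Y 0 \<omega>) \<partial>M)
        + (\<Sum>i<n. \<integral>\<omega>. h * (drift f (t (Suc i)) (Y i \<omega>))\<^sup>2 \<partial>M) / (2 * \<sigma>\<^sup>2)
      \<le> (\<integral>\<omega>. loglap (sd (T - t n)) f (Y n \<omega>) \<partial>M)
        + real n * C * h\<^sup>2 + P * (\<Sum>i<n. \<integral>\<omega>. \<bar>A i \<omega> - h * drift f (t (Suc i)) (Y i \<omega>)\<bar> \<partial>M)"
proof -
  obtain C P where CP: "0 \<le> C" "0 \<le> P" "\<And>t x. t \<le> T - \<delta> \<Longrightarrow> \<bar>drift f t x\<bar> \<le> P"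
    and step: "\<And>s t Y A. \<lbrakk>0 \<le> s; s < t; t \<le> T - \<delta>; Y \<in> borel_measurable (F s); integrable M A\<rbrakk> \<Longrightarrow>
      (\<integral>\<omega>. loglap (sd (T - s)) f (Y \<omega>) \<partial>M) + (\<integral>\<omega>. (t - s) * (drift f t (Y \<omega>))\<^sup>2 \<partial>M) / (2 * \<sigma>\<^sup>2)
      \<le> (\<integral>\<omega>. loglap (sd (T - t)) f (Y \<omega> + A \<omega> + \<sigma> * (B t \<omega> - B s \<omega>)) \<partial>M)
        + C * (t - s)\<^sup>2 + P * (\<integral>\<omega>. \<bar>A \<omega> - (t - s) * drift f t (Y \<omega>)\<bar> \<partial>M)"
    by (rule lower_step[OF f K \<delta>]) (rule that)
  show thesis
  proof (rule that[OF CP])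
    fix t0 h :: real and n and t :: "nat \<Rightarrow> real" and Y A :: "nat \<Rightarrow> 'a \<Rightarrow> real"
    assume t0: "0 \<le> t0" and h: "0 < h" and T: "t0 + real n * h \<le> T - \<delta>" and t: "\<And>i. t i = t0 + real i * h"
      and Y: "\<And>i. i \<le> n \<Longrightarrow> Y i \<in> borel_measurable (F (t i))" and A: "\<And>i. i < n \<Longrightarrow> integrable M (A i)"
      and ae: "\<And>i. i < n \<Longrightarrow> AE \<omega> in M. Y (Suc i) \<omega> = Y i \<omega> + A i \<omega> + \<sigma> * (B (t (Suc i)) \<omega> - B (t i) \<omega>)"
    have tS: "t (Suc i) - t i = h" for i by (simp add: t algebra_simps)
    have tT: "t i \<le> T - \<delta>" if "i \<le> n" for i
    proof -
      have "real i * h \<le> real n * h" using that h by (intro mult_right_mono) auto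
      then show ?thesis using T by (simp add: t)
    qed
    have t0i: "0 \<le> t i" for i using t0 h by (simp add: t)
    have "(\<integral>\<omega>. loglap (sd (T - t0)) f (Y 0 \<omega>) \<partial>M)
        + (\<Sum>i<m. \<integral>\<omega>. h * (drift f (t (Suc i)) (Y i \<omega>))\<^sup>2 \<partial>M) / (2 * \<sigma>\<^sup>2)
      \<le> (\<integral>\<omega>. loglap (sd (T - t m)) f (Y m \<omega>) \<partial>M)
        + real m * C * h\<^sup>2 + P * (\<Sum>i<m. \<integral>\<omega>. \<bar>A i \<omega> - h * drift f (t (Suc i)) (Y i \<omega>)\<bar> \<partial>M)"
      if "m \<le> n" for m
      using that
    proof (induction m)
      case 0
      then show ?case by (simp add: t)
    next
      case (Suc m)
      then have m: "m < n" "m \<le> n" "Suc m \<le> n" by auto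
      have [measurable]: "Y m \<in> borel_measurable M" "Y (Suc m) \<in> borel_measurable M" "A m \<in> borel_measurable M"
        using measurable_F_M[OF Y] A m by auto
      have tm: "t m \<le> T" "t (Suc m) \<le> T" using tT[of m] tT[of "Suc m"] m \<delta> by auto
      have [measurable]: "B (t m) \<in> borel_measurable M" "B (t (Suc m)) \<in> borel_measurable M"
        using tm t0i by auto
      have "(\<integral>\<omega>. loglap (sd (T - t m)) f (Y m \<omega>) \<partial>M)
          + (\<integral>\<omega>. h * (drift f (t (Suc m)) (Y m \<omega>))\<^sup>2 \<partial>M) / (2 * \<sigma>\<^sup>2)
        \<le> (\<integral>\<omega>. loglap (sd (T - t (Suc m))) f (Y m \<omega> + A m \<omega> + \<sigma> * (B (t (Suc m)) \<omega> - B (t m) \<omega>)) \<partial>M)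
          + C * h\<^sup>2 + P * (\<integral>\<omega>. \<bar>A m \<omega> - h * drift f (t (Suc m)) (Y m \<omega>)\<bar> \<partial>M)"
        using step[of "t m" "t (Suc m)" "Y m" "A m"] tS[of m] h tT[of "Suc m"] t0i Y A m by simp
      also have "(\<integral>\<omega>. loglap (sd (T - t (Suc m))) f (Y m \<omega> + A m \<omega> + \<sigma> * (B (t (Suc m)) \<omega> - B (t m) \<omega>)) \<partial>M)
          = (\<integral>\<omega>. loglap (sd (T - t (Suc m))) f (Y (Suc m) \<omega>) \<partial>M)"
        using ae[OF m(1)] f by (intro integral_cong_AE) (auto elim!: eventually_mono)
      finally show ?case using Suc.IH m by (simp add: add_divide_distrib distrib_left distrib_right)
    qed
    from this[of n] show "(\<integral>\<omega>. loglap (sd (T - t0)) f (Y 0 \<omega>) \<partial>M)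
        + (\<Sum>i<n. \<integral>\<omega>. h * (drift f (t (Suc i)) (Y i \<omega>))\<^sup>2 \<partial>M) / (2 * \<sigma>\<^sup>2)
      \<le> (\<integral>\<omega>. loglap (sd (T - t n)) f (Y n \<omega>) \<partial>M)
        + real n * C * h\<^sup>2 + P * (\<Sum>i<n. \<integral>\<omega>. \<bar>A i \<omega> - h * drift f (t (Suc i)) (Y i \<omega>)\<bar> \<partial>M)" by simp
  qed
qed

section \<open>Step controls\<close>

lemma admissible_bounded:
  assumes "progressively_measurable F T a" and b: "\<And>s \<omega>. \<bar>a s \<omega>\<bar> \<le> P"
  shows "a \<in> admissible M F T"
proof -
  have "(\<integral>\<^sup>+\<omega>. (\<integral>\<^sup>+s\<in>{0..T}. ennreal \<bar>a s \<omega>\<bar> \<partial>lborel) \<partial>M)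
      \<le> (\<integral>\<^sup>+\<omega>. (\<integral>\<^sup>+s\<in>{0..T}. ennreal P \<partial>lborel) \<partial>M)"
    using b by (intro nn_integral_mono mult_right_mono ennreal_leI) auto
  also have "\<dots> = ennreal P * ennreal T"
    using T_pos emeasure_space_1 by (simp add: nn_integral_cmult)
  also have "\<dots> < \<infinity>" by (simp add: ennreal_mult_less_top)
  finally show ?thesis using assms(1) by (simp add: admissible_def)
qed

lemma progressive_step_function:
  assumes \<beta>: "\<And>i. i < n \<Longrightarrow> \<beta> i \<in> borel_measurable (F (t i))"
  shows "progressively_measurable F T (\<lambda>s \<omega>. \<Sum>i<n. indicator {t i..<t (Suc i)} s * \<beta> i \<omega>)"
  unfolding progressively_measurable_def
proof (intro ballI)
  fix u assume "u \<in> {0..T}"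
  have fst: "fst \<in> restrict_space borel {0..u} \<Otimes>\<^sub>M F u \<rightarrow>\<^sub>M (borel :: real measure)"
    by (rule measurable_compose[OF measurable_fst]) (rule measurable_restrict_space1, simp)
  have "(\<lambda>p. \<Sum>i<n. indicator {t i..<t (Suc i)} (fst p) * \<beta> i (snd p))
      \<in> borel_measurable (restrict_space borel {0..u} \<Otimes>\<^sub>M F u)"
  proof (rule borel_measurable_sum)
    fix i assume "i \<in> {..<n}"
    then have i: "i < n" by simp
    show "(\<lambda>p. indicator {t i..<t (Suc i)} (fst p) * \<beta> i (snd p))
      \<in> borel_measurable (restrict_space borel {0..u} \<Otimes>\<^sub>M F u)"
    proof (cases "t i \<le> u")
      case True
      have "(\<lambda>p. \<beta> i (snd p)) \<in> borel_measurable (restrict_space borel {0..u} \<Otimes>\<^sub>M F u)"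
        by (rule measurable_compose[OF measurable_snd measurable_F_mono[OF \<beta>[OF i] True]])
      moreover have "(\<lambda>p. indicator {t i..<t (Suc i)} (fst p) :: real) \<in> borel_measurable (restrict_space borel {0..u} \<Otimes>\<^sub>M F u)"
        by (rule measurable_compose[OF fst]) simp
      ultimately show ?thesis by (rule borel_measurable_times[rotated])
    next
      \<comment> \<open>An interval starting after \<open>u\<close> contributes zero on
        \<open>{0..u}\<close>, so its coefficient, known only later, does no harm.\<close>
      case False
      have "(\<lambda>p. indicator {t i..<t (Suc i)} (fst p) * \<beta> i (snd p))
          \<in> borel_measurable (restrict_space borel {0..u} \<Otimes>\<^sub>M F u) \<longleftrightarrow>
        (\<lambda>p. 0 :: real) \<in> borel_measurable (restrict_space borel {0..u} \<Otimes>\<^sub>M F u)"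
        using False by (intro measurable_cong) (auto simp: space_pair_measure space_restrict_space)
      then show ?thesis by simp
    qed
  qed
  then show "(\<lambda>(s, \<omega>). \<Sum>i<n. indicator {t i..<t (Suc i)} s * \<beta> i \<omega>)
      \<in> borel_measurable (restrict_space borel {0..u} \<Otimes>\<^sub>M F u)"
    by (simp add: case_prod_beta')
qed

lemma set_integral_step_function:
  fixes g :: "nat \<Rightarrow> real"
  assumes t: "\<And>i. t i = t0 + real i * h" and h: "0 < h" and n: "t n \<le> u"
  shows "set_integrable lborel {t0..u} (\<lambda>s. \<Sum>i<n. indicator {t i..<t (Suc i)} s * g i)"
    "(LINT s:{t0..u}|lborel. \<Sum>i<n. indicator {t i..<t (Suc i)} s * g i) = (\<Sum>i<n. h * g i)"
proof -
  have sub: "{t i..<t (Suc i)} \<subseteq> {t0..u}" if "i < n" for i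
  proof -
    have "real (Suc i) * h \<le> real n * h" using that h by (intro mult_right_mono) auto
    then have "t (Suc i) \<le> t n" by (simp add: t)
    moreover have "t0 \<le> t i" using h by (simp add: t)
    ultimately show ?thesis using n by auto
  qed
  have "indicator {t0..u} s *\<^sub>R (\<Sum>i<n. indicator {t i..<t (Suc i)} s * g i)
      = (\<Sum>i<n. indicator {t i..<t (Suc i)} s * g i)" for s
  proof (cases "s \<in> {t0..u}")
    case False
    then have "indicator {t i..<t (Suc i)} s = (0 :: real)" if "i < n" for i
      using sub[OF that] by (auto simp: indicator_def)
    then have "(\<Sum>i<n. indicator {t i..<t (Suc i)} s * g i) = 0" by (intro sum.neutral) auto
    then show ?thesis by (simp only: scaleR_zero_right)
  qed (simp only: indicator_simps scaleR_one)
  note eq = this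
  have int: "integrable lborel (\<lambda>s. indicator {t i..<t (Suc i)} s * g i)" for i
    by (intro integrable_mult_left integrable_real_indicator) (auto simp: t h)
  show "set_integrable lborel {t0..u} (\<lambda>s. \<Sum>i<n. indicator {t i..<t (Suc i)} s * g i)"
    unfolding set_integrable_def eq by (intro Bochner_Integration.integrable_sum int)
  have "(LINT s:{t0..u}|lborel. \<Sum>i<n. indicator {t i..<t (Suc i)} s * g i)
      = (\<Sum>i<n. \<integral>s. indicator {t i..<t (Suc i)} s * g i \<partial>lborel)"
    unfolding set_lebesgue_integral_def eq by (intro Bochner_Integration.integral_sum int)
  also have "\<dots> = (\<Sum>i<n. h * g i)"
    using h by (intro sum.cong) (auto simp: t algebra_simps)
  finally show "(LINT s:{t0..u}|lborel. \<Sum>i<n. indicator {t i..<t (Suc i)} s * g i) = (\<Sum>i<n. h * g i)" .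
qed

text \<open>The Euler control acts up to \<open>T - \<delta>\<close> and is zero afterwards, where
  the feedback could become large. Half of \<open>\<epsilon>\<close> pays for the idle stretch and
  half for the discretisation.\<close>

lemma lower_bound_lipschitz:
  assumes t0: "0 \<le> t0" "t0 < T" and K: "\<And>x. \<bar>f x\<bar> \<le> K" and L: "0 \<le> L" "\<And>x y. \<bar>f x - f y\<bar> \<le> L * \<bar>x - y\<bar>"
    and f [measurable]: "f \<in> borel_measurable borel" and \<epsilon>: "0 < \<epsilon>"
  shows "\<exists>a\<in>admissible M F T. \<exists>Q\<ge>0.
    (\<integral>\<^sup>+\<omega>. (\<integral>\<^sup>+s\<in>{t0..T}. ennreal ((a s \<omega>)\<^sup>2) \<partial>lborel) \<partial>M) = ennreal Q \<and>
    loglap (sd (T - t0)) f x - \<epsilon> \<le>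
      (\<integral>\<omega>. f (x + (LINT s:{t0..T}|lborel. a s \<omega>) + \<sigma> * (B T \<omega> - B t0 \<omega>)) \<partial>M) - Q / (2 * \<sigma>\<^sup>2)"
proof -
  have K0: "0 \<le> K" using order_trans[OF abs_ge_zero K[of 0]] .
  obtain C1 where C1: "0 \<le> C1" "\<And>s x. loglap s f x \<le> heat s f x + C1 * s\<^sup>2"
    by (rule loglap_le_heat_lipschitz[OF L(1) K0]) (rule that; use f K L(2) in blast)
  \<comment> \<open>The idle stretch costs \<open>C1 * \<sigma>\<^sup>2 * \<delta>\<close>. The
    summand \<open>1\<close> protects the denominator, and the first argument of \<open>min\<close>
    leaves a controlled stretch after \<open>t0\<close>.\<close>
  define \<delta> where "\<delta> = min ((T - t0) / 2) (\<epsilon> / (2 * (C1 * \<sigma>\<^sup>2 + 1)))"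
  have C1': "0 < C1 * \<sigma>\<^sup>2 + 1" using C1(1) by (simp add: add_nonneg_pos)
  have \<delta>: "0 < \<delta>" "t0 < T - \<delta>" "C1 * \<sigma>\<^sup>2 * \<delta> \<le> \<epsilon> / 2"
  proof -
    show "0 < \<delta>" using t0 \<epsilon> C1' by (simp add: \<delta>_def)
    have "\<delta> \<le> (T - t0) / 2" unfolding \<delta>_def by (rule min.cobounded1)
    also have "\<dots> < T - t0" using t0 by simp
    finally show "t0 < T - \<delta>" by simp
    have "C1 * \<sigma>\<^sup>2 * \<delta> \<le> (C1 * \<sigma>\<^sup>2 + 1) * \<delta>"
      using \<open>0 < \<delta>\<close> by (intro mult_right_mono) auto
    also have "\<dots> \<le> (C1 * \<sigma>\<^sup>2 + 1) * (\<epsilon> / (2 * (C1 * \<sigma>\<^sup>2 + 1)))"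
      using C1' by (intro mult_left_mono) (auto simp: \<delta>_def)
    also have "\<dots> = \<epsilon> / 2" using C1' by (simp add: field_simps)
    finally show "C1 * \<sigma>\<^sup>2 * \<delta> \<le> \<epsilon> / 2" .
  qed
  show ?thesis
  proof (rule lower_discrete[OF f K \<delta>(1)])
    fix C P assume C: "0 \<le> C" and P: "0 \<le> P" "\<And>t x. t \<le> T - \<delta> \<Longrightarrow> \<bar>drift f t x\<bar> \<le> P"
      and low: "\<And>t0 h n t Y A. \<lbrakk>0 \<le> t0; 0 < h; t0 + real n * h \<le> T - \<delta>; \<And>i. t i = t0 + real i * h;
        \<And>i. i \<le> n \<Longrightarrow> Y i \<in> borel_measurable (F (t i)); \<And>i. i < n \<Longrightarrow> integrable M (A i);
        \<And>i. i < n \<Longrightarrow> AE \<omega> in M. Y (Suc i) \<omega> = Y i \<omega> + A i \<omega> + \<sigma> * (B (t (Suc i)) \<omega> - B (t i) \<omega>)\<rbrakk> \<Longrightarrow>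
        (\<integral>\<omega>. loglap (sd (T - t0)) f (Y 0 \<omega>) \<partial>M)
          + (\<Sum>i<n. \<integral>\<omega>. h * (drift f (t (Suc i)) (Y i \<omega>))\<^sup>2 \<partial>M) / (2 * \<sigma>\<^sup>2)
        \<le> (\<integral>\<omega>. loglap (sd (T - t n)) f (Y n \<omega>) \<partial>M)
          + real n * C * h\<^sup>2 + P * (\<Sum>i<n. \<integral>\<omega>. \<bar>A i \<omega> - h * drift f (t (Suc i)) (Y i \<omega>)\<bar> \<partial>M)"
    define l where "l = T - \<delta> - t0"
    have l: "0 < l" using \<delta> by (simp add: l_def)
    \<comment> \<open>\<open>n\<close> steps of length \<open>l / n\<close> accumulate an error
      \<open>C * l\<^sup>2 / n\<close>, and this \<open>n\<close> makes it at most half of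
      \<open>\<epsilon>\<close>.\<close>
    obtain n where n: "2 * C * l\<^sup>2 / \<epsilon> < real n" using reals_Archimedean2 by blast
    have "0 \<le> 2 * C * l\<^sup>2 / \<epsilon>" using C \<epsilon> by simp
    then have n0: "0 < real n" "n > 0" using n by simp_all
    define h where "h = l / real n"
    have h: "0 < h" "real n * h = l" using l n0 by (auto simp: h_def)
    have nCh: "real n * C * h\<^sup>2 \<le> \<epsilon> / 2"
    proof -
      have "real n * C * h\<^sup>2 = C * l\<^sup>2 / real n"
        using n0 by (simp add: h_def power2_eq_square)
      also have "\<dots> \<le> \<epsilon> / 2"
      proof -
        have "2 * C * l\<^sup>2 \<le> real n * \<epsilon>" using n \<epsilon> by (simp add: divide_less_eq less_imp_le)
        then show ?thesis using n0 by (simp add: divide_le_eq mult.commute)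
      qed
      finally show ?thesis .
    qed
    define t where "t i = t0 + real i * h" for i
    have tn: "t n = T - \<delta>" by (simp add: t_def h(2) l_def)
    have tmono: "t i \<le> t j" if "i \<le> j" for i j
      using that h unfolding t_def by (intro add_left_mono mult_right_mono) auto
    have tn': "t i \<le> T - \<delta>" if "i \<le> n" for i using tmono[OF that] tn by simp
    have t0i: "0 \<le> t i" "t0 \<le> t i" for i using t0 h by (auto simp: t_def)
    define Y where "Y = rec_nat (\<lambda>\<omega>. x) (\<lambda>i y \<omega>. y \<omega> + h * drift f (t (Suc i)) (y \<omega>)
        + \<sigma> * (B (t (Suc i)) \<omega> - B (t i) \<omega>))"
    have Y0: "Y 0 = (\<lambda>\<omega>. x)" by (simp add: Y_def)
    have YS: "Y (Suc i) = (\<lambda>\<omega>. Y i \<omega> + h * drift f (t (Suc i)) (Y i \<omega>) + \<sigma> * (B (t (Suc i)) \<omega> - B (t i) \<omega>))" for i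
      by (simp add: Y_def)
    have Ym: "Y i \<in> borel_measurable (F (t i))" if "i \<le> n" for i
      using that
    proof (induction i)
      case (Suc i)
      have [measurable]: "Y i \<in> borel_measurable (F (t (Suc i)))"
        by (rule measurable_F_mono[OF Suc.IH tmono]) (use Suc.prems in simp_all)
      have "t (Suc i) \<le> T" "t i \<le> T" using tn'[of "Suc i"] tn'[of i] Suc.prems \<delta>(1) by linarith+
      then have [measurable]: "B (t (Suc i)) \<in> borel_measurable (F (t (Suc i)))" "B (t i) \<in> borel_measurable (F (t (Suc i)))"
        by (intro measurable_B t0i tmono; simp)+
      show ?case unfolding YS by measurable
    qed (simp add: Y0)
    \<comment> \<open>The drift of the later time is a deterministic function, so
      \<open>\<beta> i\<close> depends on the state at \<open>t i\<close> only and is known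
      there.\<close>
    define \<beta> where "\<beta> i \<omega> = drift f (t (Suc i)) (Y i \<omega>)" for i \<omega>
    have \<beta>F: "\<beta> i \<in> borel_measurable (F (t i))" if "i < n" for i
    proof -
      have [measurable]: "Y i \<in> borel_measurable (F (t i))" using Ym that by simp
      show ?thesis unfolding \<beta>_def by measurable
    qed
    have \<beta>P: "\<bar>\<beta> i \<omega>\<bar> \<le> P" if "i < n" for i \<omega>
      unfolding \<beta>_def using P(2) tn'[of "Suc i"] that by simp
    have \<beta>m: "\<beta> i \<in> borel_measurable M" if "i < n" for i using measurable_F_M[OF \<beta>F[OF that]] .
    have \<beta>i: "integrable M (\<lambda>\<omega>. h * \<beta> i \<omega>)" if "i < n" for i
      using \<beta>m[OF that] \<beta>P[OF that] by (intro integrable_mult_right integrable_bounded) auto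
    have \<beta>2: "integrable M (\<lambda>\<omega>. h * (\<beta> i \<omega>)\<^sup>2)" if "i < n" for i
    proof (intro integrable_mult_right integrable_bounded)
      show "(\<lambda>\<omega>. (\<beta> i \<omega>)\<^sup>2) \<in> borel_measurable M" using \<beta>m[OF that] by measurable
      show "\<bar>(\<beta> i \<omega>)\<^sup>2\<bar> \<le> P\<^sup>2" for \<omega>
        using \<beta>P[OF that, of \<omega>] P(1) by (simp add: abs_le_square_iff [symmetric])
    qed
    define a where "a s \<omega> = (\<Sum>i<n. indicator {t i..<t (Suc i)} s * \<beta> i \<omega>)" for s \<omega>
    have ap: "progressively_measurable F T a"
      unfolding a_def by (rule progressive_step_function[OF \<beta>F])
    have aP: "\<bar>a s \<omega>\<bar> \<le> P" for s \<omega>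
      using step_function_cases[of t n s, OF tmono]
    proof
      assume "\<exists>j<n. \<forall>g :: nat \<Rightarrow> real. (\<Sum>i<n. indicator {t i..<t (Suc i)} s * g i) = g j"
      then obtain j where j: "j < n" "\<And>g :: nat \<Rightarrow> real. (\<Sum>i<n. indicator {t i..<t (Suc i)} s * g i) = g j" by blast
      show ?thesis unfolding a_def j(2) using \<beta>P[OF j(1)] .
    next
      assume z: "\<forall>g :: nat \<Rightarrow> real. (\<Sum>i<n. indicator {t i..<t (Suc i)} s * g i) = 0"
      show ?thesis unfolding a_def z[rule_format] using P(1) by simp
    qed
    have a2: "(a s \<omega>)\<^sup>2 = (\<Sum>i<n. indicator {t i..<t (Suc i)} s * (\<beta> i \<omega>)\<^sup>2)" for s \<omega>
      using step_function_cases[of t n s, OF tmono]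
    proof
      assume "\<exists>j<n. \<forall>g :: nat \<Rightarrow> real. (\<Sum>i<n. indicator {t i..<t (Suc i)} s * g i) = g j"
      then obtain j where j: "\<And>g :: nat \<Rightarrow> real. (\<Sum>i<n. indicator {t i..<t (Suc i)} s * g i) = g j" by blast
      show ?thesis unfolding a_def j ..
    next
      assume z: "\<forall>g :: nat \<Rightarrow> real. (\<Sum>i<n. indicator {t i..<t (Suc i)} s * g i) = 0"
      show ?thesis unfolding a_def z[rule_format] by simp
    qed
    have tnT: "t n \<le> T" using tn \<delta>(1) by simp
    have inta: "(LINT s:{t0..T}|lborel. a s \<omega>) = (\<Sum>i<n. h * \<beta> i \<omega>)" for \<omega>
      unfolding a_def by (rule set_integral_step_function(2)[OF t_def h(1) tnT])
    define S where "S \<omega> = (\<Sum>i<n. h * (\<beta> i \<omega>)\<^sup>2)" for \<omega>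
    have S0: "0 \<le> S \<omega>" for \<omega> unfolding S_def using h(1) by (intro sum_nonneg) auto
    have nn: "(\<integral>\<^sup>+s\<in>{t0..T}. ennreal ((a s \<omega>)\<^sup>2) \<partial>lborel) = ennreal (S \<omega>)" for \<omega>
    proof -
      have "(\<integral>\<^sup>+s\<in>{t0..T}. ennreal ((a s \<omega>)\<^sup>2) \<partial>lborel) = (\<integral>\<^sup>+s. ennreal (indicator {t0..T} s *\<^sub>R (a s \<omega>)\<^sup>2) \<partial>lborel)"
        by (intro nn_integral_cong) (auto simp: indicator_def)
      also have "\<dots> = ennreal (LINT s:{t0..T}|lborel. (a s \<omega>)\<^sup>2)"
        unfolding set_lebesgue_integral_def
        using set_integral_step_function(1)[OF t_def h(1) tnT, of "\<lambda>i. (\<beta> i \<omega>)\<^sup>2"]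
        unfolding a2 [symmetric] set_integrable_def by (intro nn_integral_eq_integral) auto
      also have "(LINT s:{t0..T}|lborel. (a s \<omega>)\<^sup>2) = S \<omega>"
        unfolding a2 S_def by (rule set_integral_step_function(2)[OF t_def h(1) tnT])
      finally show ?thesis .
    qed
    have Sint: "integrable M S" unfolding S_def using \<beta>2 by (intro Bochner_Integration.integrable_sum) auto
    define Q where "Q = (\<integral>\<omega>. S \<omega> \<partial>M)"
    have Q0: "0 \<le> Q" unfolding Q_def using S0 by simp
    have Q: "(\<integral>\<^sup>+\<omega>. (\<integral>\<^sup>+s\<in>{t0..T}. ennreal ((a s \<omega>)\<^sup>2) \<partial>lborel) \<partial>M) = ennreal Q"
      unfolding nn Q_def using Sint S0 by (intro nn_integral_eq_integral) auto
    have QS: "Q = (\<Sum>i<n. \<integral>\<omega>. h * (\<beta> i \<omega>)\<^sup>2 \<partial>M)"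
      unfolding Q_def S_def using \<beta>2 by (intro Bochner_Integration.integral_sum) auto
    have sumY: "Y m \<omega> = x + (\<Sum>i<m. h * \<beta> i \<omega>) + \<sigma> * (B (t m) \<omega> - B t0 \<omega>)" for m \<omega>
      by (induction m) (auto simp: Y0 YS \<beta>_def t_def algebra_simps)
    \<comment> \<open>The displacement of the Euler scheme is the drift times \<open>h\<close> by
      construction, so the last sum vanishes.\<close>
    have main: "(\<integral>\<omega>. loglap (sd (T - t0)) f (Y 0 \<omega>) \<partial>M)
          + (\<Sum>i<n. \<integral>\<omega>. h * (drift f (t (Suc i)) (Y i \<omega>))\<^sup>2 \<partial>M) / (2 * \<sigma>\<^sup>2)
        \<le> (\<integral>\<omega>. loglap (sd (T - t n)) f (Y n \<omega>) \<partial>M)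
          + real n * C * h\<^sup>2 + P * (\<Sum>i<n. \<integral>\<omega>. \<bar>h * \<beta> i \<omega> - h * drift f (t (Suc i)) (Y i \<omega>)\<bar> \<partial>M)"
      by (rule low[OF t0(1) h(1) _ t_def Ym \<beta>i]) (auto simp: h(2) l_def YS \<beta>_def)
    then have main': "loglap (sd (T - t0)) f x + Q / (2 * \<sigma>\<^sup>2)
        \<le> (\<integral>\<omega>. loglap (sd \<delta>) f (Y n \<omega>) \<partial>M) + real n * C * h\<^sup>2"
      using prob_space by (simp add: Y0 \<beta>_def [symmetric] QS tn)
    have [measurable]: "Y n \<in> borel_measurable M" using measurable_F_M[OF Ym[of n]] by simp
    have "(\<integral>\<omega>. loglap (sd \<delta>) f (Y n \<omega>) \<partial>M) \<le> (\<integral>\<omega>. heat (sd \<delta>) f (Y n \<omega>) + C1 * (sd \<delta>)\<^sup>2 \<partial>M)"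
      using C1(2) abs_loglap_le[OF f K] abs_heat_le[OF f K]
      by (intro integral_mono Bochner_Integration.integrable_add integrable_bounded[of _ K] integrable_const) auto
    also have "\<dots> = (\<integral>\<omega>. heat (sd \<delta>) f (Y n \<omega>) \<partial>M) + C1 * (sd \<delta>)\<^sup>2"
      using abs_heat_le[OF f K] prob_space
      by (subst Bochner_Integration.integral_add) (auto intro!: integrable_bounded[of _ K])
    also have "C1 * (sd \<delta>)\<^sup>2 \<le> \<epsilon> / 2" using \<delta> by (simp add: sd_square mult.assoc)
    \<comment> \<open>With zero control after \<open>T - \<delta>\<close>, the heat term is the
      expectation over the remaining Brownian increment.\<close>
    also have "(\<integral>\<omega>. heat (sd \<delta>) f (Y n \<omega>) \<partial>M) = (\<integral>\<omega>. f (Y n \<omega> + \<sigma> * (B T \<omega> - B (T - \<delta>) \<omega>)) \<partial>M)"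
      using integral_increment[of "T - \<delta>" T "Y n" f K] Ym[of n] tn K \<delta> t0 by simp
    also have "(\<lambda>\<omega>. f (Y n \<omega> + \<sigma> * (B T \<omega> - B (T - \<delta>) \<omega>)))
        = (\<lambda>\<omega>. f (x + (LINT s:{t0..T}|lborel. a s \<omega>) + \<sigma> * (B T \<omega> - B t0 \<omega>)))"
      unfolding sumY inta tn by (simp add: algebra_simps)
    finally have fin: "(\<integral>\<omega>. loglap (sd \<delta>) f (Y n \<omega>) \<partial>M)
        \<le> (\<integral>\<omega>. f (x + (LINT s:{t0..T}|lborel. a s \<omega>) + \<sigma> * (B T \<omega> - B t0 \<omega>)) \<partial>M) + \<epsilon> / 2"
      by simp
    show ?thesis
    proof (intro bexI[of _ a] exI[of _ Q] conjI Q0 Q)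
      show "loglap (sd (T - t0)) f x - \<epsilon>
          \<le> (\<integral>\<omega>. f (x + (LINT s:{t0..T}|lborel. a s \<omega>) + \<sigma> * (B T \<omega> - B t0 \<omega>)) \<partial>M) - Q / (2 * \<sigma>\<^sup>2)"
        using main' fin nCh by linarith
      show "a \<in> admissible M F T" by (rule admissible_bounded[OF ap aP])
    qed
  qed
qed

text \<open>Now the envelopes must lie below \<open>f\<close>, so the sup-convolution is applied to
  \<open>- f\<close>. They converge only where \<open>f\<close> is continuous, which is enough
  because the Gaussian gives no mass to the jumps. One fixed envelope already yields the
  control.\<close>

lemma lower_bound:
  assumes t0: "0 \<le> t0" "t0 < T" and K: "\<And>x. \<bar>f x\<bar> \<le> K" and cont: "countable {x. \<not> isCont f x}"
    and f [measurable]: "f \<in> borel_measurable borel" and \<epsilon>: "0 < \<epsilon>"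
  shows "\<exists>a\<in>admissible M F T. \<exists>Q\<ge>0.
    (\<integral>\<^sup>+\<omega>. (\<integral>\<^sup>+s\<in>{t0..T}. ennreal ((a s \<omega>)\<^sup>2) \<partial>lborel) \<partial>M) = ennreal Q \<and>
    loglap (sd (T - t0)) f x - \<epsilon> \<le>
      (\<integral>\<omega>. f (x + (LINT s:{t0..T}|lborel. a s \<omega>) + \<sigma> * (B T \<omega> - B t0 \<omega>)) \<partial>M) - Q / (2 * \<sigma>\<^sup>2)"
proof -
  define g where "g m y = - sup_conv (\<lambda>z. - f z) m y" for m y
  have Kn: "\<bar>- f y\<bar> \<le> K" for y using K by simp
  have gK: "\<bar>g m y\<bar> \<le> K" for m y using abs_sup_conv_le[where f="\<lambda>z. - f z", OF Kn] by (simp add: g_def)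
  have gL: "\<bar>g m y - g m z\<bar> \<le> real m * \<bar>y - z\<bar>" for m y z
    using sup_conv_lipschitz[where f="\<lambda>z. - f z" and m=m and x=y and y=z, OF Kn] by (simp add: g_def abs_minus_commute)
  have gm: "g m \<in> borel_measurable borel" for m
    unfolding g_def using measurable_sup_conv[where f="\<lambda>z. - f z" and m=m, OF Kn] by (rule borel_measurable_uminus)
  have gf: "g m y \<le> f y" for m y
    using sup_conv_ge_self[where f="\<lambda>z. - f z" and m=m and x=y, OF Kn] by (simp add: g_def)
  have glim: "(\<lambda>m. g m y) \<longlonglongrightarrow> f y" if cy: "isCont f y" for y
  proof -
    have "(\<lambda>m. sup_conv (\<lambda>z. - f z) m y) \<longlonglongrightarrow> - f y"
    proof (rule sup_conv_tendsto[OF Kn])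
      fix e :: real assume "0 < e"
      then obtain d where d: "d > 0" "\<forall>z. z \<noteq> y \<and> norm (z - y) < d \<longrightarrow> norm (f z - f y) < e"
        using LIM_D[OF cy[unfolded isCont_def]] by blast
      show "\<exists>d>0. \<forall>z. \<bar>z - y\<bar> < d \<longrightarrow> - f z < - f y + e"
      proof (intro exI[of _ d] conjI allI impI d(1))
        fix z assume "\<bar>z - y\<bar> < d"
        then have "\<bar>f z - f y\<bar> < e" using d(2) \<open>0 < e\<close> by (cases "z = y") simp_all
        then show "- f z < - f y + e" by linarith
      qed
    qed
    from tendsto_minus[OF this] show ?thesis by (simp add: g_def)
  qed
  have s: "sd (T - t0) \<noteq> 0" using t0 \<sigma>_pos by simp
  have "(\<lambda>m. loglap (sd (T - t0)) (g m) x) \<longlonglongrightarrow> loglap (sd (T - t0)) f x"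
  proof (rule tendsto_loglap_fun[OF gm f gK K])
    show "AE z in \<gamma>. (\<lambda>m. g m (x + sd (T - t0) * z)) \<longlonglongrightarrow> f (x + sd (T - t0) * z)"
      using AE_gauss_not_in_countable[OF cont s, of x] by eventually_elim (auto intro: glim)
  qed
  then have "\<forall>\<^sub>F m in sequentially. loglap (sd (T - t0)) f x - \<epsilon> / 2 < loglap (sd (T - t0)) (g m) x"
    by (rule order_tendstoD(1)) (use \<epsilon> in simp)
  then obtain m where m: "loglap (sd (T - t0)) f x - \<epsilon> / 2 < loglap (sd (T - t0)) (g m) x"
    by (auto simp: eventually_sequentially)
  obtain a Q where a: "a \<in> admissible M F T" and Q: "0 \<le> Q"
    "(\<integral>\<^sup>+\<omega>. (\<integral>\<^sup>+s\<in>{t0..T}. ennreal ((a s \<omega>)\<^sup>2) \<partial>lborel) \<partial>M) = ennreal Q"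
    and low: "loglap (sd (T - t0)) (g m) x - \<epsilon> / 2 \<le>
      (\<integral>\<omega>. g m (x + (LINT s:{t0..T}|lborel. a s \<omega>) + \<sigma> * (B T \<omega> - B t0 \<omega>)) \<partial>M) - Q / (2 * \<sigma>\<^sup>2)"
    using lower_bound_lipschitz[OF t0 gK of_nat_0_le_iff gL gm, where x=x and \<epsilon>="\<epsilon> / 2"] half_gt_zero[OF \<epsilon>] by meson
  have [measurable]: "(\<lambda>\<omega>. LINT s:{t0..T}|lborel. a s \<omega>) \<in> borel_measurable M"
    using measurable_F_M[OF measurable_set_integral[of a t0 T]] a t0 by (auto simp: admissible_def)
  have [measurable]: "B T \<in> borel_measurable M" "B t0 \<in> borel_measurable M" using t0 by auto
  note gm [measurable]
  have "(\<integral>\<omega>. g m (x + (LINT s:{t0..T}|lborel. a s \<omega>) + \<sigma> * (B T \<omega> - B t0 \<omega>)) \<partial>M)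
      \<le> (\<integral>\<omega>. f (x + (LINT s:{t0..T}|lborel. a s \<omega>) + \<sigma> * (B T \<omega> - B t0 \<omega>)) \<partial>M)"
    using gf gK K by (intro integral_mono integrable_bounded[of _ K]) auto
  then have "loglap (sd (T - t0)) f x - \<epsilon> \<le>
      (\<integral>\<omega>. f (x + (LINT s:{t0..T}|lborel. a s \<omega>) + \<sigma> * (B T \<omega> - B t0 \<omega>)) \<partial>M) - Q / (2 * \<sigma>\<^sup>2)"
    using low m by linarith
  then show ?thesis using a Q by blast
qed

end

section \<open>Optimality of the feedback control\<close>

text \<open>Uniform continuity on the square. The mixed evaluation, right end in the first variable
  and left end in the second, matches the drift at the end of a step taken at the state of its
  beginning. The absolute values stand inside the sum because the one-step errors are added without
  cancellation.\<close>

lemma riemann_diagonal: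
  fixes k :: "real \<times> real \<Rightarrow> real"
  assumes k: "continuous_on ({0..\<tau>} \<times> {0..\<tau>}) k" and \<tau>: "0 < \<tau>"
    and h: "\<And>n. h n = \<tau> / real (Suc n)" and t: "\<And>n i. t n i = real i * h n"
  shows "(\<lambda>n. \<Sum>i<Suc n. \<bar>(LINT s:{t n i<..t n (Suc i)}|lborel. k (s, s)) - h n * k (t n (Suc i), t n i)\<bar>) \<longlonglongrightarrow> 0"
proof (rule LIMSEQ_I)
  fix r :: real assume r: "0 < r"
  define e where "e = r / (2 * \<tau>)"
  have e: "0 < e" using r \<tau> by (simp add: e_def)
  have "uniformly_continuous_on ({0..\<tau>} \<times> {0..\<tau>}) k"
    by (intro compact_uniformly_continuous k compact_Times) auto
  then obtain d where d: "0 < d" "\<And>p q. \<lbrakk>p \<in> {0..\<tau>} \<times> {0..\<tau>}; q \<in> {0..\<tau>} \<times> {0..\<tau>}; dist q p < d\<rbrakk> \<Longrightarrow> dist (k q) (k p) < e"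
    using e unfolding uniformly_continuous_on_def by metis
  obtain N where N: "2 * \<tau> / d < real N" using reals_Archimedean2 by blast
  have kd: "continuous_on {0..\<tau>} (\<lambda>s. k (s, s))"
    by (rule continuous_on_compose2[OF k]) (auto intro!: continuous_intros)
  have bound: "(\<Sum>i<Suc n. \<bar>(LINT s:{t n i<..t n (Suc i)}|lborel. k (s, s)) - h n * k (t n (Suc i), t n i)\<bar>) \<le> r / 2"
    if n: "N \<le> n" for n
  proof -
    have h0: "0 < h n" "real (Suc n) * h n = \<tau>" using \<tau> by (auto simp: h)
    have "2 * \<tau> / d < real (Suc n)" using N n by linarith
    \<comment> \<open>Each of the two coordinates is off by at most one step, hence the factor
      \<open>2\<close>.\<close>
    then have hd: "2 * h n < d" using d(1) by (simp add: h field_simps)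
    have "\<bar>(LINT s:{t n i<..t n (Suc i)}|lborel. k (s, s)) - h n * k (t n (Suc i), t n i)\<bar> \<le> h n * e"
      if i: "i < Suc n" for i
    proof -
      define u where "u = t n i"
      define v where "v = t n (Suc i)"
      define c where "c = k (v, u)"
      have "real (Suc i) * h n \<le> real (Suc n) * h n" using i h0 by (intro mult_right_mono) auto
      then have uv: "0 \<le> u" "u < v" "v \<le> \<tau>" "v - u = h n"
        using h0 by (auto simp: u_def v_def t algebra_simps)
      have int: "set_integrable lborel {u<..v} (\<lambda>s. k (s, s))"
        by (rule set_integrable_subset[OF borel_integrable_atLeastAtMost'[OF kd]]) (use uv in auto)
      note intc = set_integrable_const_interval(1)[of u v c]
      have "(LINT s:{u<..v}|lborel. k (s, s)) - h n * c = (LINT s:{u<..v}|lborel. k (s, s) - c)"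
        using int intc uv by (simp add: set_integral_diff set_integral_const)
      also have "\<bar>\<dots>\<bar> \<le> (\<integral>s. indicator {u<..v} s * e \<partial>lborel)"
        unfolding set_lebesgue_integral_def
      proof (rule integral_abs_bound_integral)
        show "integrable lborel (\<lambda>s. indicator {u<..v} s *\<^sub>R (k (s, s) - c))"
          using set_integral_diff(1)[OF int intc] unfolding set_integrable_def .
        show "integrable lborel (\<lambda>s. indicator {u<..v} s * e)"
          using set_integrable_const_interval(1)[of u v e] unfolding set_integrable_def real_scaleR_def .
        fix s
        have "\<bar>k (s, s) - c\<bar> \<le> e" if s: "s \<in> {u<..v}"
        proof -
          have "dist (s, s) (v, u) \<le> \<bar>s - v\<bar> + \<bar>s - u\<bar>"
            unfolding dist_Pair_Pair dist_real_def by (rule sqrt_sum_squares_le_sum) simp_all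
          also have "\<dots> < d" using s uv hd by auto
          finally have "dist (k (s, s)) (k (v, u)) < e" using s uv by (intro d(2)) auto
          then show ?thesis by (simp add: dist_real_def c_def)
        qed
        then show "\<bar>indicator {u<..v} s *\<^sub>R (k (s, s) - c)\<bar> \<le> indicator {u<..v} s * e"
          by (auto simp: indicator_def)
      qed
      also have "(\<integral>s. indicator {u<..v} s * e \<partial>lborel) = h n * e" using uv by simp
      finally show ?thesis by (simp add: u_def v_def c_def)
    qed
    then have "(\<Sum>i<Suc n. \<bar>(LINT s:{t n i<..t n (Suc i)}|lborel. k (s, s)) - h n * k (t n (Suc i), t n i)\<bar>)
        \<le> (\<Sum>i<Suc n. h n * e)" by (intro sum_mono) auto
    also have "\<dots> = \<tau> * e" using h0(2) by (simp del: of_nat_Suc flip: mult.assoc)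
    also have "\<dots> = r / 2" using \<tau> by (simp add: e_def)
    finally show ?thesis .
  qed
  show "\<exists>N. \<forall>n\<ge>N. norm ((\<Sum>i<Suc n. \<bar>(LINT s:{t n i<..t n (Suc i)}|lborel. k (s, s)) - h n * k (t n (Suc i), t n i)\<bar>) - 0) < r"
  proof (intro exI[of _ N] allI impI)
    fix n assume "N \<le> n"
    have "0 \<le> (\<Sum>i<Suc n. \<bar>(LINT s:{t n i<..t n (Suc i)}|lborel. k (s, s)) - h n * k (t n (Suc i), t n i)\<bar>)"
      by (intro sum_nonneg) simp
    with bound[OF \<open>N \<le> n\<close>] r
    show "norm ((\<Sum>i<Suc n. \<bar>(LINT s:{t n i<..t n (Suc i)}|lborel. k (s, s)) - h n * k (t n (Suc i), t n i)\<bar>) - 0) < r"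
      unfolding real_norm_def by linarith
  qed
qed

context brownian_space
begin

text \<open>Up to \<open>\<tau>\<close> the drift is bounded and continuous along paths. The
  telescoped inequality for the sampled process therefore passes to the limit: the sampled energies
  converge to the energy, and the sampling errors vanish.\<close>

lemma feedback_before_terminal:
  assumes f [measurable]: "f \<in> borel_measurable borel" and K: "\<And>x. \<bar>f x\<bar> \<le> K" and cont: "countable {x. \<not> isCont f x}"
    and X: "progressively_measurable F T X" and \<tau>: "0 < \<tau>" "\<tau> < T"
    and ae: "AE \<omega> in M. X 0 \<omega> = 0 \<and> continuous_on {0..\<tau>} (\<lambda>t. X t \<omega>) \<and>
      (\<forall>t\<in>{0..\<tau>}. X t \<omega> = (LINT s:{0..t}|lborel. drift f s (X s \<omega>)) + \<sigma> * B t \<omega>)"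
    and Jm: "(\<lambda>\<omega>. LINT s:{0..\<tau>}|lborel. (drift f s (X s \<omega>))\<^sup>2) \<in> borel_measurable M"
  shows "integrable M (\<lambda>\<omega>. LINT s:{0..\<tau>}|lborel. (drift f s (X s \<omega>))\<^sup>2) \<and>
    loglap (sd T) f 0 + (\<integral>\<omega>. (LINT s:{0..\<tau>}|lborel. (drift f s (X s \<omega>))\<^sup>2) \<partial>M) / (2 * \<sigma>\<^sup>2)
    \<le> (\<integral>\<omega>. loglap (sd (T - \<tau>)) f (X \<tau> \<omega>) \<partial>M)"
proof (rule lower_discrete[OF f K, of "T - \<tau>"])
  show "0 < T - \<tau>" using \<tau> by simp
  fix C P assume C: "0 \<le> C" and P0: "0 \<le> P" and P': "\<And>t x. t \<le> T - (T - \<tau>) \<Longrightarrow> \<bar>drift f t x\<bar> \<le> P"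
    and low: "\<And>t0 h n t Y A. \<lbrakk>0 \<le> t0; 0 < h; t0 + real n * h \<le> T - (T - \<tau>); \<And>i. t i = t0 + real i * h;
      \<And>i. i \<le> n \<Longrightarrow> Y i \<in> borel_measurable (F (t i)); \<And>i. i < n \<Longrightarrow> integrable M (A i);
      \<And>i. i < n \<Longrightarrow> AE \<omega> in M. Y (Suc i) \<omega> = Y i \<omega> + A i \<omega> + \<sigma> * (B (t (Suc i)) \<omega> - B (t i) \<omega>)\<rbrakk> \<Longrightarrow>
      (\<integral>\<omega>. loglap (sd (T - t0)) f (Y 0 \<omega>) \<partial>M)
        + (\<Sum>i<n. \<integral>\<omega>. h * (drift f (t (Suc i)) (Y i \<omega>))\<^sup>2 \<partial>M) / (2 * \<sigma>\<^sup>2)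
      \<le> (\<integral>\<omega>. loglap (sd (T - t n)) f (Y n \<omega>) \<partial>M)
        + real n * C * h\<^sup>2 + P * (\<Sum>i<n. \<integral>\<omega>. \<bar>A i \<omega> - h * drift f (t (Suc i)) (Y i \<omega>)\<bar> \<partial>M)"
  have P: "\<bar>drift f t x\<bar> \<le> P" if "t \<le> \<tau>" for t x using P' that by simp
  define h where "h n = \<tau> / real (Suc n)" for n
  define t where "t n i = real i * h n" for n i
  have h0: "0 < h n" "real (Suc n) * h n = \<tau>" for n using \<tau> by (auto simp: h_def)
  have t\<tau>: "t n (Suc n) = \<tau>" "t n 0 = 0" for n using h0(2)[of n] by (simp_all add: t_def)
  have tmono: "t n i \<le> t n j" if "i \<le> j" for n i j
    unfolding t_def using that h0(1)[of n] by (intro mult_right_mono) auto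
  have tle: "0 \<le> t n i" for n i using h0(1)[of n] by (simp add: t_def)
  have tle': "t n i \<le> \<tau>" if "i \<le> Suc n" for n i using tmono[OF that, of n] t\<tau> by simp
  have tS: "t n (Suc i) = t n i + h n" for n i by (simp add: t_def algebra_simps)
  have XF: "X (t n i) \<in> borel_measurable (F (t n i))" if "i \<le> Suc n" for n i
    using progressive_time[OF X tle, of n i] tle'[OF that] \<tau> by simp
  have XM: "X (t n i) \<in> borel_measurable M" if "i \<le> Suc n" for n i
    by (rule measurable_F_M[OF XF[OF that]])
  have BM: "B (t n i) \<in> borel_measurable M" if "i \<le> Suc n" for n i
    using tle[of n i] tle'[OF that] \<tau> by (intro measurable_B_M) auto
  define b where "b n i \<omega> = drift f (t n (Suc i)) (X (t n i) \<omega>)" for n i \<omega>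
  have bM: "b n i \<in> borel_measurable M" if "i < Suc n" for n i
    unfolding b_def using XM[of i n] that by (intro measurable_drift) auto
  have bP: "\<bar>b n i \<omega>\<bar> \<le> P" if "i < Suc n" for n i \<omega>
    unfolding b_def using tle'[of "Suc i" n] that by (intro P) auto
  \<comment> \<open>The displacement due to the drift, recovered by subtracting the noise; in this
    form its measurability does not rest on the integral equation, which holds only almost
    surely.\<close>
  define A where "A n i \<omega> = X (t n (Suc i)) \<omega> - X (t n i) \<omega> - \<sigma> * (B (t n (Suc i)) \<omega> - B (t n i) \<omega>)" for n i \<omega>
  have AM: "A n i \<in> borel_measurable M" if "i < Suc n" for n i
    unfolding A_def using XM[of i n] XM[of "Suc i" n] BM[of i n] BM[of "Suc i" n] that
    by (intro borel_measurable_diff borel_measurable_times borel_measurable_const) auto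
  define J where "J \<omega> = (LINT s:{0..\<tau>}|lborel. (drift f s (X s \<omega>))\<^sup>2)" for \<omega>
  define S where "S n \<omega> = (\<Sum>i<Suc n. h n * (b n i \<omega>)\<^sup>2)" for n \<omega>
  define E where "E n \<omega> = (\<Sum>i<Suc n. \<bar>A n i \<omega> - h n * b n i \<omega>\<bar>)" for n \<omega>
  \<comment> \<open>All pathwise limits on one almost sure event; the bound on \<open>A\<close>
    later supplies integrability and domination.\<close>
  have path: "AE \<omega> in M. (\<forall>n. \<forall>i<Suc n. \<bar>A n i \<omega>\<bar> \<le> P * h n) \<and> (\<lambda>n. S n \<omega>) \<longlonglongrightarrow> J \<omega> \<and> (\<lambda>n. E n \<omega>) \<longlonglongrightarrow> 0"
    using ae
  proof eventually_elim
    case (elim \<omega>)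
    define k where "k p = drift f (fst p) (X (snd p) \<omega>)" for p
    have kc: "continuous_on ({0..\<tau>} \<times> {0..\<tau>}) k"
      unfolding k_def drift_def
    proof (rule continuous_on_mult[OF continuous_on_const], rule continuous_on_score[OF f K cont])
      show "continuous_on ({0..\<tau>} \<times> {0..\<tau>}) (\<lambda>p. sd (T - fst p))" by (intro continuous_intros)
      show "continuous_on ({0..\<tau>} \<times> {0..\<tau>}) (\<lambda>p. X (snd p) \<omega>)"
        by (rule continuous_on_compose2[of "{0..\<tau>}" "\<lambda>t. X t \<omega>" _ snd]) (use elim in \<open>auto intro!: continuous_intros\<close>)
      show "sd (T - fst p) \<noteq> 0" if "p \<in> {0..\<tau>} \<times> {0..\<tau>}" for p
        using that \<tau> \<sigma>_pos by auto
    qed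
    have kd: "continuous_on {0..\<tau>} (\<lambda>s. k (s, s))"
      by (rule continuous_on_compose2[OF kc]) (auto intro!: continuous_intros)
    have ki: "set_integrable lborel {0..\<tau>} (\<lambda>s. k (s, s))" "set_integrable lborel {0..\<tau>} (\<lambda>s. (k (s, s))\<^sup>2)"
      by (intro borel_integrable_atLeastAtMost' kd continuous_on_power)+
    have kc2: "continuous_on ({0..\<tau>} \<times> {0..\<tau>}) (\<lambda>p. (k p)\<^sup>2)"
      by (intro continuous_on_power kc)
    have sub: "set_integrable lborel {0..t n (Suc i)} (\<lambda>s. k (s, s))"
      "set_integrable lborel {0..t n (Suc i)} (\<lambda>s. (k (s, s))\<^sup>2)" if "i < Suc n" for n i
      by (rule set_integrable_subset[OF ki(1)] set_integrable_subset[OF ki(2)];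
        use tle'[of "Suc i" n] that in auto)+
    have kX: "k (s, s) = drift f s (X s \<omega>)" for s by (simp add: k_def)
    have Xe: "X (t n i) \<omega> = (LINT s:{0..t n i}|lborel. k (s, s)) + \<sigma> * B (t n i) \<omega>" if "i \<le> Suc n" for n i
      unfolding kX using elim tle[of n i] tle'[OF that] by auto
    have Ae: "A n i \<omega> = (LINT s:{t n i<..t n (Suc i)}|lborel. k (s, s))" if "i < Suc n" for n i
      using Xe[of i n] Xe[of "Suc i" n] that set_integral_Icc_diff[OF tle tmono sub(1)[OF that], of i]
      by (simp add: A_def algebra_simps)
    have AP: "\<bar>A n i \<omega>\<bar> \<le> P * h n" if "i < Suc n" for n i
    proof -
      have "\<bar>A n i \<omega>\<bar> \<le> (\<integral>s. indicator {t n i<..t n (Suc i)} s * P \<partial>lborel)"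
        unfolding Ae[OF that] set_lebesgue_integral_def
      proof (rule integral_abs_bound_integral)
        have "set_integrable lborel {t n i<..t n (Suc i)} (\<lambda>s. k (s, s))"
          by (rule set_integrable_subset[OF ki(1)]) (use tle[of n i] tle'[of "Suc i" n] that in auto)
        then show "integrable lborel (\<lambda>s. indicator {t n i<..t n (Suc i)} s *\<^sub>R k (s, s))"
          unfolding set_integrable_def .
        show "integrable lborel (\<lambda>s. indicator {t n i<..t n (Suc i)} s * P)"
          using set_integrable_const_interval(1)[of "t n i" "t n (Suc i)" P] unfolding set_integrable_def real_scaleR_def .
        fix s
        show "\<bar>indicator {t n i<..t n (Suc i)} s *\<^sub>R k (s, s)\<bar> \<le> indicator {t n i<..t n (Suc i)} s * P"
          using P[of s "X s \<omega>"] tle'[of "Suc i" n] that unfolding kX by (cases "s \<in> {t n i<..t n (Suc i)}") auto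
      qed
      also have "\<dots> = P * h n" using tmono[of i "Suc i" n] h0(1)[of n] by (simp add: tS)
      finally show ?thesis .
    qed
    have kb: "k (t n (Suc i), t n i) = b n i \<omega>" for n i by (simp add: k_def b_def)
    have Elim: "(\<lambda>n. E n \<omega>) \<longlonglongrightarrow> 0"
      using riemann_diagonal[OF kc \<tau>(1) h_def t_def] Ae unfolding E_def kb by simp
    have Jsum: "J \<omega> = (\<Sum>i<Suc n. LINT s:{t n i<..t n (Suc i)}|lborel. (k (s, s))\<^sup>2)" for n
    proof -
      have "(LINT s:{0..t n m}|lborel. (k (s, s))\<^sup>2) = (\<Sum>i<m. LINT s:{t n i<..t n (Suc i)}|lborel. (k (s, s))\<^sup>2)"
        if "m \<le> Suc n" for m
        using that
      proof (induction m)
        case 0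
        then show ?case by (simp add: t\<tau> set_integral_singleton)
      next
        case (Suc m)
        then show ?case
          using set_integral_Icc_diff[OF tle tmono sub(2)[of m n], of m] by simp
      qed
      from this[of "Suc n"] show ?thesis by (simp only: t\<tau> J_def kX order_refl)
    qed
    have "(\<lambda>n. J \<omega> - S n \<omega>) \<longlonglongrightarrow> 0"
    proof (rule Lim_null_comparison)
      show "(\<lambda>n. \<Sum>i<Suc n. \<bar>(LINT s:{t n i<..t n (Suc i)}|lborel. (k (s, s))\<^sup>2) - h n * (k (t n (Suc i), t n i))\<^sup>2\<bar>) \<longlonglongrightarrow> 0"
        by (rule riemann_diagonal[OF kc2 \<tau>(1) h_def t_def])
      show "\<forall>\<^sub>F n in sequentially. norm (J \<omega> - S n \<omega>)
          \<le> (\<Sum>i<Suc n. \<bar>(LINT s:{t n i<..t n (Suc i)}|lborel. (k (s, s))\<^sup>2) - h n * (k (t n (Suc i), t n i))\<^sup>2\<bar>)"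
      proof (intro always_eventually allI)
        fix n
        show "norm (J \<omega> - S n \<omega>)
          \<le> (\<Sum>i<Suc n. \<bar>(LINT s:{t n i<..t n (Suc i)}|lborel. (k (s, s))\<^sup>2) - h n * (k (t n (Suc i), t n i))\<^sup>2\<bar>)"
          unfolding Jsum[of n] S_def kb sum_subtractf [symmetric] real_norm_def by (rule sum_abs)
      qed
    qed
    from tendsto_diff[OF tendsto_const[of "J \<omega>"] this] have "(\<lambda>n. S n \<omega>) \<longlonglongrightarrow> J \<omega>" by simp
    with AP Elim show ?case by blast
  qed
  have Aint: "integrable M (A n i)" if "i < Suc n" for n i
    by (rule integrable_const_bound[OF _ AM[OF that], of "P * h n"]) (use path that in \<open>auto elim!: eventually_mono\<close>)
  have bint: "integrable M (\<lambda>\<omega>. h n * b n i \<omega>)" "integrable M (\<lambda>\<omega>. h n * (b n i \<omega>)\<^sup>2)" if "i < Suc n" for n i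
  proof -
    have "\<bar>(b n i \<omega>)\<^sup>2\<bar> \<le> P\<^sup>2" for \<omega>
      using bP[OF that, of \<omega>] P0 by (simp add: abs_le_square_iff [symmetric])
    then show "integrable M (\<lambda>\<omega>. h n * (b n i \<omega>)\<^sup>2)"
      using bM[OF that] by (intro integrable_mult_right integrable_bounded[of _ "P\<^sup>2"] borel_measurable_power) auto
    show "integrable M (\<lambda>\<omega>. h n * b n i \<omega>)"
      using bM[OF that] bP[OF that] by (intro integrable_mult_right integrable_bounded[of _ P]) auto
  qed
  have ineq: "loglap (sd T) f 0 + (\<integral>\<omega>. S n \<omega> \<partial>M) / (2 * \<sigma>\<^sup>2)
      \<le> (\<integral>\<omega>. loglap (sd (T - \<tau>)) f (X \<tau> \<omega>) \<partial>M) + C * \<tau> * h n + P * (\<integral>\<omega>. E n \<omega> \<partial>M)" for n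
  proof -
    have e0: "(\<integral>\<omega>. loglap (sd (T - 0)) f (X (t n 0) \<omega>) \<partial>M)
        + (\<Sum>i<Suc n. \<integral>\<omega>. h n * (drift f (t n (Suc i)) (X (t n i) \<omega>))\<^sup>2 \<partial>M) / (2 * \<sigma>\<^sup>2)
      \<le> (\<integral>\<omega>. loglap (sd (T - t n (Suc n))) f (X (t n (Suc n)) \<omega>) \<partial>M)
        + real (Suc n) * C * (h n)\<^sup>2
        + P * (\<Sum>i<Suc n. \<integral>\<omega>. \<bar>A n i \<omega> - h n * drift f (t n (Suc i)) (X (t n i) \<omega>)\<bar> \<partial>M)"
    proof (rule low[of 0 "h n" "Suc n" "t n" "\<lambda>i. X (t n i)" "A n"])
      show "t n i = 0 + real i * h n" for i by (simp add: t_def)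
      show "0 + real (Suc n) * h n \<le> T - (T - \<tau>)" using h0(2)[of n] by simp
      show "AE \<omega> in M. X (t n (Suc i)) \<omega> = X (t n i) \<omega> + A n i \<omega> + \<sigma> * (B (t n (Suc i)) \<omega> - B (t n i) \<omega>)" for i
        by (simp add: A_def)
    qed (use h0 Aint XF in auto)
    have e1: "(\<integral>\<omega>. loglap (sd (T - 0)) f (X (t n 0) \<omega>) \<partial>M) = loglap (sd T) f 0"
    proof -
      have "(\<integral>\<omega>. loglap (sd T) f (X (t n 0) \<omega>) \<partial>M) = (\<integral>\<omega>. loglap (sd T) f 0 \<partial>M)"
        using ae XM[of 0 n] unfolding t\<tau> by (intro integral_cong_AE) (auto elim!: eventually_mono)
      then show ?thesis using prob_space by simp
    qed
    have e2: "(\<Sum>i<Suc n. \<integral>\<omega>. h n * (drift f (t n (Suc i)) (X (t n i) \<omega>))\<^sup>2 \<partial>M) = (\<integral>\<omega>. S n \<omega> \<partial>M)"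
      unfolding S_def b_def [symmetric] using bint by (intro Bochner_Integration.integral_sum[symmetric]) auto
    have e3: "(\<Sum>i<Suc n. \<integral>\<omega>. \<bar>A n i \<omega> - h n * drift f (t n (Suc i)) (X (t n i) \<omega>)\<bar> \<partial>M) = (\<integral>\<omega>. E n \<omega> \<partial>M)"
      unfolding E_def b_def [symmetric] using bint Aint by (intro Bochner_Integration.integral_sum[symmetric]) auto
    have e4: "real (Suc n) * C * (h n)\<^sup>2 = C * \<tau> * h n"
      unfolding h0(2)[of n, symmetric] by (simp add: power2_eq_square)
    show ?thesis using e0 unfolding e1 e2 e3 e4 unfolding t\<tau> .
  qed
  have JM: "J \<in> borel_measurable M" unfolding J_def by (rule Jm)
  have SP: "\<bar>S n \<omega>\<bar> \<le> \<tau> * P\<^sup>2" for n \<omega>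
  proof -
    have "\<bar>S n \<omega>\<bar> \<le> (\<Sum>i<Suc n. h n * P\<^sup>2)"
      unfolding S_def
    proof (rule order_trans[OF sum_abs], rule sum_mono)
      fix i assume "i \<in> {..<Suc n}"
      then have "(b n i \<omega>)\<^sup>2 \<le> P\<^sup>2" using bP[of i n \<omega>] P0 by (simp add: abs_le_square_iff [symmetric])
      then show "\<bar>h n * (b n i \<omega>)\<^sup>2\<bar> \<le> h n * P\<^sup>2" using h0(1)[of n] by simp
    qed
    also have "\<dots> = \<tau> * P\<^sup>2" using h0(2)[of n] by (simp del: of_nat_Suc flip: mult.assoc)
    finally show ?thesis .
  qed
  \<comment> \<open>The sampled energies are bounded by \<open>\<tau> * P\<^sup>2\<close>, and their
    limit inherits the bound.\<close>
  have Jint: "integrable M J"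
  proof (rule integrable_const_bound[OF _ JM])
    show "AE \<omega> in M. norm (J \<omega>) \<le> \<tau> * P\<^sup>2"
      using path
    proof eventually_elim
      case (elim \<omega>)
      then have "(\<lambda>n. norm (S n \<omega>)) \<longlonglongrightarrow> norm (J \<omega>)" by (intro tendsto_norm) blast
      then show ?case by (rule LIMSEQ_le_const2) (use SP in auto)
    qed
  qed
  have Slim: "(\<lambda>n. \<integral>\<omega>. S n \<omega> \<partial>M) \<longlonglongrightarrow> (\<integral>\<omega>. J \<omega> \<partial>M)"
  proof (rule integral_dominated_convergence[where w="\<lambda>_. \<tau> * P\<^sup>2", OF JM])
    show "S n \<in> borel_measurable M" for n
      unfolding S_def using bM by (intro borel_measurable_sum borel_measurable_times borel_measurable_power borel_measurable_const) auto
    show "AE \<omega> in M. (\<lambda>n. S n \<omega>) \<longlonglongrightarrow> J \<omega>" using path by (auto elim!: eventually_mono)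
    show "AE \<omega> in M. norm (S n \<omega>) \<le> \<tau> * P\<^sup>2" for n using SP by simp
  qed simp
  have Elim: "(\<lambda>n. \<integral>\<omega>. E n \<omega> \<partial>M) \<longlonglongrightarrow> (\<integral>\<omega>. 0 \<partial>M)"
  proof (rule integral_dominated_convergence[where w="\<lambda>_. \<tau> * (2 * P)"])
    show "E n \<in> borel_measurable M" for n
      unfolding E_def using bM AM by (intro borel_measurable_sum borel_measurable_abs borel_measurable_diff borel_measurable_times borel_measurable_const) auto
    show "AE \<omega> in M. (\<lambda>n. E n \<omega>) \<longlonglongrightarrow> 0" using path by (auto elim!: eventually_mono)
    show "AE \<omega> in M. norm (E n \<omega>) \<le> \<tau> * (2 * P)" for n
      using path
    proof eventually_elim
      case (elim \<omega>)
      have "\<bar>E n \<omega>\<bar> \<le> (\<Sum>i<Suc n. h n * (2 * P))"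
        unfolding E_def
      proof (rule order_trans[OF sum_abs], rule sum_mono)
        fix i assume i: "i \<in> {..<Suc n}"
        have "\<bar>h n * b n i \<omega>\<bar> \<le> h n * P"
          unfolding abs_mult using h0(1)[of n] bP[of i n \<omega>] i by (intro mult_mono) auto
        moreover have "\<bar>A n i \<omega>\<bar> \<le> P * h n" using elim i by auto
        ultimately show "\<bar>\<bar>A n i \<omega> - h n * b n i \<omega>\<bar>\<bar> \<le> h n * (2 * P)"
          by (simp add: mult.commute[of P])
      qed
      also have "\<dots> = \<tau> * (2 * P)" using h0(2)[of n] by (simp del: of_nat_Suc flip: mult.assoc)
      finally show "norm (E n \<omega>) \<le> \<tau> * (2 * P)" by simp
    qed
  qed auto
  have hlim: "h \<longlonglongrightarrow> 0"
    using LIMSEQ_Suc[OF lim_const_over_n[of \<tau>]] by (simp add: h_def[abs_def])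
  have "(\<lambda>n. (\<integral>\<omega>. loglap (sd (T - \<tau>)) f (X \<tau> \<omega>) \<partial>M) + C * \<tau> * h n + P * (\<integral>\<omega>. E n \<omega> \<partial>M))
      \<longlonglongrightarrow> (\<integral>\<omega>. loglap (sd (T - \<tau>)) f (X \<tau> \<omega>) \<partial>M) + C * \<tau> * 0 + P * (\<integral>\<omega>. 0 \<partial>M)"
    by (intro tendsto_intros hlim Elim)
  moreover have "(\<lambda>n. loglap (sd T) f 0 + (\<integral>\<omega>. S n \<omega> \<partial>M) / (2 * \<sigma>\<^sup>2))
      \<longlonglongrightarrow> loglap (sd T) f 0 + (\<integral>\<omega>. J \<omega> \<partial>M) / (2 * \<sigma>\<^sup>2)"
    using \<sigma>_pos by (intro tendsto_intros Slim) auto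
  ultimately have "loglap (sd T) f 0 + (\<integral>\<omega>. J \<omega> \<partial>M) / (2 * \<sigma>\<^sup>2)
      \<le> (\<integral>\<omega>. loglap (sd (T - \<tau>)) f (X \<tau> \<omega>) \<partial>M) + C * \<tau> * 0 + P * (\<integral>\<omega>. 0 \<partial>M)"
    using ineq by (intro LIMSEQ_le[of _ _ "\<lambda>n. (\<integral>\<omega>. loglap (sd (T - \<tau>)) f (X \<tau> \<omega>) \<partial>M) + C * \<tau> * h n + P * (\<integral>\<omega>. E n \<omega> \<partial>M)"]) auto
  then show ?thesis using Jint by (simp add: J_def[abs_def])
qed

section \<open>The feedback process up to the terminal time\<close>

context
  fixes f :: "real \<Rightarrow> real" and K :: real and X a :: "real \<Rightarrow> 'a \<Rightarrow> real"
  assumes f [measurable]: "f \<in> borel_measurable borel" and K: "\<And>x. \<bar>f x\<bar> \<le> K"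
    and cont: "countable {x. \<not> isCont f x}"
    and usc: "\<And>x e. 0 < e \<Longrightarrow> \<exists>d>0. \<forall>y. \<bar>y - x\<bar> < d \<longrightarrow> f y < f x + e"
    and X: "progressively_measurable F T X"
    and ae: "AE \<omega> in M. X 0 \<omega> = 0 \<and>
      (\<forall>t\<in>{0..<T}. set_integrable lborel {0..t} (\<lambda>s. drift f s (X s \<omega>)) \<and>
        X t \<omega> = (LINT s:{0..t}|lborel. drift f s (X s \<omega>)) + \<sigma> * B t \<omega>) \<and>
      ((\<lambda>t. X t \<omega>) \<longlongrightarrow> X T \<omega>) (at_left T)"
    and a: "\<And>s \<omega>. 0 \<le> s \<Longrightarrow> s < T \<Longrightarrow> a s \<omega> = drift f s (X s \<omega>)" and aT: "\<And>\<omega>. a T \<omega> = 0"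
begin

lemma feedback_progressive: "progressively_measurable F T a"
  unfolding progressively_measurable_def
proof (intro ballI)
  fix t assume t: "t \<in> {0..T}"
  let ?R = "restrict_space borel {0..t} \<Otimes>\<^sub>M F t"
  have [measurable]: "fst \<in> ?R \<rightarrow>\<^sub>M (borel :: real measure)"
    by (rule measurable_compose[OF measurable_fst]) (rule measurable_restrict_space1, simp)
  have [measurable]: "(\<lambda>(s, \<omega>). X s \<omega>) \<in> borel_measurable ?R"
    using X t by (simp add: progressively_measurable_def)
  have "(\<lambda>p. if fst p < T then drift f (fst p) ((\<lambda>(s, \<omega>). X s \<omega>) p) else 0) \<in> borel_measurable ?R"
    by measurable
  moreover have "(\<lambda>(s, \<omega>). a s \<omega>) p = (if fst p < T then drift f (fst p) ((\<lambda>(s, \<omega>). X s \<omega>) p) else 0)"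
    if "p \<in> space ?R" for p
  proof -
    obtain s \<omega> where p: "p = (s, \<omega>)" by (cases p)
    have "0 \<le> s" "s \<le> T" using that t by (auto simp: p space_pair_measure space_restrict_space)
    then show ?thesis using a[of s \<omega>] aT[of \<omega>] by (cases "s < T") (auto simp: p)
  qed
  ultimately show "(\<lambda>(s, \<omega>). a s \<omega>) \<in> borel_measurable ?R"
    by (subst measurable_cong) auto
qed

text \<open>Continuity before \<open>T\<close> is not assumed: the state is an indefinite integral
  plus a Brownian path. The exceptional null sets are collected here once.\<close>

lemma feedback_paths:
  "AE \<omega> in M. \<omega> \<in> space M \<and> X 0 \<omega> = 0 \<and> continuous_on {0..T} (\<lambda>t. B t \<omega>) \<and>
    (\<forall>\<tau>\<in>{0..<T}. continuous_on {0..\<tau>} (\<lambda>t. X t \<omega>) \<and>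
      (\<forall>t\<in>{0..\<tau>}. X t \<omega> = (LINT s:{0..t}|lborel. drift f s (X s \<omega>)) + \<sigma> * B t \<omega>)) \<and>
    ((\<lambda>t. X t \<omega>) \<longlongrightarrow> X T \<omega>) (at_left T)"
proof -
  have "AE \<omega> in M. continuous_on {0..T} (\<lambda>t. B t \<omega>)"
    using brownian by (simp add: brownian_motion_def)
  with ae AE_space show ?thesis
  proof eventually_elim
    case (elim \<omega>)
    have "continuous_on {0..\<tau>} (\<lambda>t. X t \<omega>)" if \<tau>: "\<tau> \<in> {0..<T}" for \<tau>
    proof -
      let ?d = "\<lambda>s. drift f s (X s \<omega>)"
      have si: "set_integrable lborel {0..t} ?d" if "t \<in> {0..\<tau>}" for t
        using elim that \<tau> by auto
      have "?d integrable_on {0..\<tau>}"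
        using set_borel_integral_eq_integral(1)[OF si] \<tau> by auto
      then have "continuous_on {0..\<tau>} (\<lambda>t. integral {0..t} ?d)"
        by (rule indefinite_integral_continuous_1)
      moreover have "continuous_on {0..\<tau>} (\<lambda>t. B t \<omega>)"
        by (rule continuous_on_subset[of "{0..T}"]) (use elim \<tau> in auto)
      ultimately have "continuous_on {0..\<tau>} (\<lambda>t. integral {0..t} ?d + \<sigma> * B t \<omega>)"
        by (intro continuous_intros)
      moreover have "X t \<omega> = integral {0..t} ?d + \<sigma> * B t \<omega>" if t: "t \<in> {0..\<tau>}" for t
      proof -
        have "t \<in> {0..<T}" using t \<tau> by auto
        then show ?thesis using elim set_borel_integral_eq_integral(2)[OF si[OF t]] by auto
      qed
      ultimately show ?thesis by (subst continuous_on_cong[OF refl]) auto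
    qed
    then show ?case using elim by auto
  qed
qed

lemma feedback_square:
  assumes \<tau>: "0 < \<tau>" "\<tau> < T"
  defines "J \<equiv> \<lambda>\<omega>. LINT s:{0..\<tau>}|lborel. (a s \<omega>)\<^sup>2"
  shows "(\<integral>\<^sup>+\<omega>. (\<integral>\<^sup>+s\<in>{0..\<tau>}. ennreal ((a s \<omega>)\<^sup>2) \<partial>lborel) \<partial>M) = ennreal (\<integral>\<omega>. J \<omega> \<partial>M)"
    and "0 \<le> (\<integral>\<omega>. J \<omega> \<partial>M)"
    and "loglap (sd T) f 0 + (\<integral>\<omega>. J \<omega> \<partial>M) / (2 * \<sigma>\<^sup>2) \<le> (\<integral>\<omega>. loglap (sd (T - \<tau>)) f (X \<tau> \<omega>) \<partial>M)"
proof -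
  have Jeq: "J = (\<lambda>\<omega>. LINT s:{0..\<tau>}|lborel. (drift f s (X s \<omega>))\<^sup>2)"
    unfolding J_def using a \<tau> by (intro ext set_lebesgue_integral_cong) auto
  have J0: "0 \<le> J \<omega>" for \<omega>
    unfolding J_def set_lebesgue_integral_def by (intro integral_nonneg_AE AE_I2) auto
  then show "0 \<le> (\<integral>\<omega>. J \<omega> \<partial>M)" by simp
  have JM: "J \<in> borel_measurable M"
    unfolding J_def using measurable_F_M[OF measurable_set_integral[OF progressive_square[OF feedback_progressive]]] \<tau> by auto
  have fin: "integrable M J \<and> loglap (sd T) f 0 + (\<integral>\<omega>. J \<omega> \<partial>M) / (2 * \<sigma>\<^sup>2) \<le> (\<integral>\<omega>. loglap (sd (T - \<tau>)) f (X \<tau> \<omega>) \<partial>M)"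
    unfolding Jeq
  proof (rule feedback_before_terminal[OF f K cont X \<tau>])
    show "AE \<omega> in M. X 0 \<omega> = 0 \<and> continuous_on {0..\<tau>} (\<lambda>t. X t \<omega>) \<and>
      (\<forall>t\<in>{0..\<tau>}. X t \<omega> = (LINT s:{0..t}|lborel. drift f s (X s \<omega>)) + \<sigma> * B t \<omega>)"
      using feedback_paths by eventually_elim (use \<tau> in auto)
    show "(\<lambda>\<omega>. LINT s:{0..\<tau>}|lborel. (drift f s (X s \<omega>))\<^sup>2) \<in> borel_measurable M"
      using JM unfolding Jeq .
  qed
  then show "loglap (sd T) f 0 + (\<integral>\<omega>. J \<omega> \<partial>M) / (2 * \<sigma>\<^sup>2) \<le> (\<integral>\<omega>. loglap (sd (T - \<tau>)) f (X \<tau> \<omega>) \<partial>M)" ..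
  have "AE \<omega> in M. (\<integral>\<^sup>+s\<in>{0..\<tau>}. ennreal ((a s \<omega>)\<^sup>2) \<partial>lborel) = ennreal (J \<omega>)"
    using feedback_paths
  proof eventually_elim
    case (elim \<omega>)
    have "continuous_on {0..\<tau>} (\<lambda>s. (drift f s (X s \<omega>))\<^sup>2)"
      unfolding drift_def
    proof (intro continuous_on_power continuous_on_mult[OF continuous_on_const], rule continuous_on_score[OF f K cont])
      show "continuous_on {0..\<tau>} (\<lambda>s. sd (T - s))" by (intro continuous_intros)
      show "continuous_on {0..\<tau>} (\<lambda>s. X s \<omega>)" using elim \<tau> by auto
      show "sd (T - s) \<noteq> 0" if "s \<in> {0..\<tau>}" for s using that \<tau> \<sigma>_pos by auto
    qed
    then have "set_integrable lborel {0..\<tau>} (\<lambda>s. (drift f s (X s \<omega>))\<^sup>2)"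
      by (rule borel_integrable_atLeastAtMost')
    then have "(\<integral>\<^sup>+s. ennreal (indicator {0..\<tau>} s *\<^sub>R (drift f s (X s \<omega>))\<^sup>2) \<partial>lborel) = ennreal (J \<omega>)"
      unfolding Jeq set_lebesgue_integral_def set_integrable_def by (intro nn_integral_eq_integral) auto
    moreover have "(\<integral>\<^sup>+s\<in>{0..\<tau>}. ennreal ((a s \<omega>)\<^sup>2) \<partial>lborel)
        = (\<integral>\<^sup>+s. ennreal (indicator {0..\<tau>} s *\<^sub>R (drift f s (X s \<omega>))\<^sup>2) \<partial>lborel)"
      using a \<tau> by (intro nn_integral_cong) (auto simp: indicator_def)
    ultimately show ?case by simp
  qed
  then have "(\<integral>\<^sup>+\<omega>. (\<integral>\<^sup>+s\<in>{0..\<tau>}. ennreal ((a s \<omega>)\<^sup>2) \<partial>lborel) \<partial>M) = (\<integral>\<^sup>+\<omega>. ennreal (J \<omega>) \<partial>M)"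
    by (rule nn_integral_cong_AE)
  also have "\<dots> = ennreal (\<integral>\<omega>. J \<omega> \<partial>M)" using fin J0 by (intro nn_integral_eq_integral) auto
  finally show "(\<integral>\<^sup>+\<omega>. (\<integral>\<^sup>+s\<in>{0..\<tau>}. ennreal ((a s \<omega>)\<^sup>2) \<partial>lborel) \<partial>M) = ennreal (\<integral>\<omega>. J \<omega> \<partial>M)" .
qed

text \<open>The double successor makes the sequence start at \<open>T / 2\<close>, so that all its
  members are positive.\<close>

definition approach :: "nat \<Rightarrow> real" where "approach k = T - T / real (Suc (Suc k))"

lemma approach: "0 < approach k" "approach k < T" "approach \<longlonglongrightarrow> T" "incseq approach"
proof -
  show "0 < approach k" "approach k < T" using T_pos by (auto simp: approach_def divide_less_eq)
  have "(\<lambda>k. T - T * inverse (real (Suc (Suc k)))) \<longlonglongrightarrow> T - T * 0"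
    by (intro tendsto_intros LIMSEQ_Suc[OF LIMSEQ_inverse_real_of_nat])
  then show "approach \<longlonglongrightarrow> T" by (simp add: approach_def[abs_def] divide_inverse)
  show "incseq approach"
    unfolding incseq_Suc_iff approach_def using T_pos by (intro allI diff_left_mono frac_le) auto
qed

lemma approach_at_left: "filterlim approach (at_left T) sequentially"
  unfolding filterlim_at using approach(2,3) by (auto intro!: always_eventually simp: less_imp_neq)

text \<open>Where \<open>f\<close> jumps, the smoothed values along the path need not converge to
  \<open>f (X T \<omega>)\<close>. They are first raised to those of a Lipschitz envelope, for which
  the limit at \<open>T\<close> exists by continuity, and then the envelopes decrease the bound to
  \<open>f\<close> by dominated convergence.\<close>

lemma feedback_cost_before:
  assumes \<tau>: "0 < \<tau>" "\<tau> < T"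
  shows "loglap (sd T) f 0 + (\<integral>\<omega>. (LINT s:{0..\<tau>}|lborel. (a s \<omega>)\<^sup>2) \<partial>M) / (2 * \<sigma>\<^sup>2) \<le> (\<integral>\<omega>. f (X T \<omega>) \<partial>M)"
proof -
  define EJ where "EJ v = (\<integral>\<omega>. (LINT s:{0..v}|lborel. (a s \<omega>)\<^sup>2) \<partial>M)" for v
  note fm = measurable_sup_conv[of f K, OF K] and Km = abs_sup_conv_le[of f K, OF K]
    and lim = sup_conv_tendsto[of f K, OF K usc] and cm = continuous_on_sup_conv[of f K, OF K]
  note fm [measurable]
  have XM: "X v \<in> borel_measurable M" if "0 \<le> v" "v \<le> T" for v
    by (rule measurable_F_M[OF progressive_time[OF X that]])
  have XT [measurable]: "X T \<in> borel_measurable M" using XM[of T] T_pos by simp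
  have XA [measurable]: "X (approach k) \<in> borel_measurable M" for k
    using XM[of "approach k"] approach(1,2)[of k] by simp
  \<comment> \<open>Energy grows with the horizon, so \<open>\<tau>\<close> can stay fixed while the
    time of evaluation runs to \<open>T\<close>.\<close>
  have mono: "EJ \<tau> \<le> EJ v" if v: "\<tau> \<le> v" "v < T" for v
  proof -
    have "ennreal (EJ \<tau>) \<le> ennreal (EJ v)"
      unfolding EJ_def using v \<tau>
      by (subst (1 2) feedback_square(1)[symmetric])
        (auto intro!: nn_integral_mono mult_left_mono simp: indicator_def)
    then show ?thesis using feedback_square(2)[of v] v \<tau> by (simp add: EJ_def)
  qed
  have m: "loglap (sd T) f 0 + EJ \<tau> / (2 * \<sigma>\<^sup>2) \<le> (\<integral>\<omega>. sup_conv f m (X T \<omega>) \<partial>M)" for m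
  proof (rule LIMSEQ_le_const)
    show "(\<lambda>k. \<integral>\<omega>. loglap (sd (T - approach k)) (sup_conv f m) (X (approach k) \<omega>) \<partial>M)
        \<longlonglongrightarrow> (\<integral>\<omega>. sup_conv f m (X T \<omega>) \<partial>M)"
    proof (rule integral_dominated_convergence[where w="\<lambda>_. K"])
      show "AE \<omega> in M. (\<lambda>k. loglap (sd (T - approach k)) (sup_conv f m) (X (approach k) \<omega>))
          \<longlonglongrightarrow> sup_conv f m (X T \<omega>)"
        using feedback_paths
      proof eventually_elim
        case (elim \<omega>)
        have "(\<lambda>k. X (approach k) \<omega>) \<longlonglongrightarrow> X T \<omega>"
          by (rule filterlim_compose[OF _ approach_at_left]) (use elim in simp)
        moreover have "(\<lambda>k. sd (T - approach k)) \<longlonglongrightarrow> sd (T - T)"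
          by (intro tendsto_intros approach)
        ultimately have "(\<lambda>k. loglap (sd (T - approach k)) (sup_conv f m) (X (approach k) \<omega>))
          \<longlonglongrightarrow> loglap (sd (T - T)) (sup_conv f m) (X T \<omega>)"
          by (rule tendsto_loglap[OF fm Km cm])
        then show ?case by simp
      qed
      show "AE \<omega> in M. norm (loglap (sd (T - approach k)) (sup_conv f m) (X (approach k) \<omega>)) \<le> K" for k
        unfolding real_norm_def by (intro AE_I2 abs_loglap_le[OF fm Km])
    qed measurable
    have "\<forall>\<^sub>F k in sequentially. \<tau> < approach k"
      using order_tendstoD(1)[OF approach(3)] \<tau> by blast
    then obtain N where N: "\<And>k. N \<le> k \<Longrightarrow> \<tau> < approach k" by (auto simp: eventually_sequentially)
    have "loglap (sd T) f 0 + EJ \<tau> / (2 * \<sigma>\<^sup>2)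
        \<le> (\<integral>\<omega>. loglap (sd (T - approach k)) (sup_conv f m) (X (approach k) \<omega>) \<partial>M)" if "N \<le> k" for k
    proof -
      have "EJ \<tau> / (2 * \<sigma>\<^sup>2) \<le> EJ (approach k) / (2 * \<sigma>\<^sup>2)"
        using mono[of "approach k"] N[OF that] approach(2)[of k] by (intro divide_right_mono) auto
      then have "loglap (sd T) f 0 + EJ \<tau> / (2 * \<sigma>\<^sup>2) \<le> loglap (sd T) f 0 + EJ (approach k) / (2 * \<sigma>\<^sup>2)"
        by simp
      also have "\<dots> \<le> (\<integral>\<omega>. loglap (sd (T - approach k)) f (X (approach k) \<omega>) \<partial>M)"
        unfolding EJ_def by (rule feedback_square(3)[OF approach(1,2)])
      also have "\<dots> \<le> (\<integral>\<omega>. loglap (sd (T - approach k)) (sup_conv f m) (X (approach k) \<omega>) \<partial>M)"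
      proof (rule integral_mono)
        show "integrable M (\<lambda>\<omega>. loglap (sd (T - approach k)) f (X (approach k) \<omega>))"
          by (rule integrable_bounded[OF _ abs_loglap_le[OF f K]]) measurable
        show "integrable M (\<lambda>\<omega>. loglap (sd (T - approach k)) (sup_conv f m) (X (approach k) \<omega>))"
          by (rule integrable_bounded[OF _ abs_loglap_le[OF fm Km]]) measurable
        show "loglap (sd (T - approach k)) f (X (approach k) \<omega>)
            \<le> loglap (sd (T - approach k)) (sup_conv f m) (X (approach k) \<omega>)" for \<omega>
          by (rule loglap_mono[OF f K fm Km sup_conv_ge_self[of f K, OF K]])
      qed
      finally show ?thesis .
    qed
    then show "\<exists>N. \<forall>k\<ge>N. loglap (sd T) f 0 + EJ \<tau> / (2 * \<sigma>\<^sup>2)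
        \<le> (\<integral>\<omega>. loglap (sd (T - approach k)) (sup_conv f m) (X (approach k) \<omega>) \<partial>M)" by blast
  qed
  have "(\<lambda>m. \<integral>\<omega>. sup_conv f m (X T \<omega>) \<partial>M) \<longlonglongrightarrow> (\<integral>\<omega>. f (X T \<omega>) \<partial>M)"
  proof (rule integral_dominated_convergence[where w="\<lambda>_. K"])
    show "AE \<omega> in M. (\<lambda>m. sup_conv f m (X T \<omega>)) \<longlonglongrightarrow> f (X T \<omega>)" by (intro AE_I2 lim)
    show "AE \<omega> in M. norm (sup_conv f m (X T \<omega>)) \<le> K" for m
      unfolding real_norm_def by (intro AE_I2 Km)
  qed measurable
  then show ?thesis unfolding EJ_def [symmetric] using m by (intro LIMSEQ_le_const) auto
qed

text \<open>The bounds before \<open>T\<close> do not depend on the horizon, so monotone convergence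
  gives both the finite total energy and the inequality at \<open>T\<close>.\<close>

lemma feedback_cost:
  "\<exists>Q\<ge>0. (\<integral>\<^sup>+\<omega>. (\<integral>\<^sup>+s\<in>{0..T}. ennreal ((a s \<omega>)\<^sup>2) \<partial>lborel) \<partial>M) = ennreal Q \<and>
    loglap (sd T) f 0 \<le> (\<integral>\<omega>. f (X T \<omega>) \<partial>M) - Q / (2 * \<sigma>\<^sup>2)"
proof -
  define N where "N = (\<integral>\<^sup>+\<omega>. (\<integral>\<^sup>+s\<in>{0..T}. ennreal ((a s \<omega>)\<^sup>2) \<partial>lborel) \<partial>M)"
  \<comment> \<open>\<open>feedback_cost_before\<close> solved for the energy.\<close>
  define D where "D = 2 * \<sigma>\<^sup>2 * ((\<integral>\<omega>. f (X T \<omega>) \<partial>M) - loglap (sd T) f 0)"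
  have \<sigma>2: "0 < 2 * \<sigma>\<^sup>2" using \<sigma>_pos by simp
  have DJ: "(\<integral>\<omega>. (LINT s:{0..approach k}|lborel. (a s \<omega>)\<^sup>2) \<partial>M) \<le> D" for k
    using feedback_cost_before[OF approach(1,2), of k] \<sigma>2 unfolding D_def by (simp add: field_simps)
  have D0: "0 \<le> D" using DJ[of 0] feedback_square(2)[OF approach(1,2), of 0] by linarith
  have inner: "(\<integral>\<^sup>+s\<in>{0..T}. ennreal ((a s \<omega>)\<^sup>2) \<partial>lborel) \<le> (SUP k. \<integral>\<^sup>+s\<in>{0..approach k}. ennreal ((a s \<omega>)\<^sup>2) \<partial>lborel)"
    if \<omega>: "\<omega> \<in> space M" for \<omega>
  proof -
    have "(\<integral>\<^sup>+s\<in>{0..T}. ennreal ((a s \<omega>)\<^sup>2) \<partial>lborel)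
        \<le> (\<integral>\<^sup>+s. (SUP k. ennreal ((a s \<omega>)\<^sup>2) * indicator {0..approach k} s) \<partial>lborel)"
    proof (rule nn_integral_mono)
      fix s
      show "ennreal ((a s \<omega>)\<^sup>2) * indicator {0..T} s \<le> (SUP k. ennreal ((a s \<omega>)\<^sup>2) * indicator {0..approach k} s)"
      proof (cases "0 \<le> s \<and> s < T")
        case True
        then have "\<forall>\<^sub>F k in sequentially. s < approach k"
          using order_tendstoD(1)[OF approach(3)] by blast
        then obtain k where "s < approach k" by (auto simp: eventually_sequentially)
        then have "ennreal ((a s \<omega>)\<^sup>2) * indicator {0..T} s = ennreal ((a s \<omega>)\<^sup>2) * indicator {0..approach k} s"
          using True by simp
        also have "\<dots> \<le> (SUP k. ennreal ((a s \<omega>)\<^sup>2) * indicator {0..approach k} s)" by (rule SUP_upper) simp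
        finally show ?thesis .
      next
        \<comment> \<open>The intervals \<open>{0..approach k}\<close> never contain
          \<open>T\<close>; the value \<open>0\<close> of the control at \<open>T\<close> settles
          that point.\<close>
        case False
        then show ?thesis using aT by (cases "s = T") (auto simp: indicator_def)
      qed
    qed
    also have "\<dots> = (SUP k. \<integral>\<^sup>+s\<in>{0..approach k}. ennreal ((a s \<omega>)\<^sup>2) \<partial>lborel)"
    proof (rule nn_integral_monotone_convergence_SUP)
      show "incseq (\<lambda>k s. ennreal ((a s \<omega>)\<^sup>2) * indicator {0..approach k} s)"
        using approach(4) by (intro incseq_SucI le_funI mult_left_mono) (auto simp: indicator_def incseq_Suc_iff intro: order_trans)
      fix k
      show "(\<lambda>s. ennreal ((a s \<omega>)\<^sup>2) * indicator {0..approach k} s) \<in> borel_measurable lborel"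
        using approach(2)[of k] by (intro measurable_square_section[OF feedback_progressive \<omega>]) auto
    qed
    finally show ?thesis .
  qed
  have "N \<le> (\<integral>\<^sup>+\<omega>. (SUP k. \<integral>\<^sup>+s\<in>{0..approach k}. ennreal ((a s \<omega>)\<^sup>2) \<partial>lborel) \<partial>M)"
    unfolding N_def by (intro nn_integral_mono inner)
  also have "\<dots> = (SUP k. \<integral>\<^sup>+\<omega>. (\<integral>\<^sup>+s\<in>{0..approach k}. ennreal ((a s \<omega>)\<^sup>2) \<partial>lborel) \<partial>M)"
  proof (rule nn_integral_monotone_convergence_SUP)
    show "incseq (\<lambda>k \<omega>. \<integral>\<^sup>+s\<in>{0..approach k}. ennreal ((a s \<omega>)\<^sup>2) \<partial>lborel)"
      using approach(4)
      by (intro incseq_SucI le_funI nn_integral_mono mult_left_mono) (auto simp: indicator_def incseq_Suc_iff intro: order_trans)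
    show "(\<lambda>\<omega>. \<integral>\<^sup>+s\<in>{0..approach k}. ennreal ((a s \<omega>)\<^sup>2) \<partial>lborel) \<in> borel_measurable M" for k
      using approach(2)[of k] by (intro measurable_set_nn_integral[OF feedback_progressive, of _ _ "\<lambda>x. x\<^sup>2"]) auto
  qed
  also have "\<dots> \<le> ennreal D"
    by (intro SUP_least) (simp add: feedback_square(1)[OF approach(1,2)] ennreal_leI DJ)
  finally have ND: "N \<le> ennreal D" .
  define Q where "Q = enn2real N"
  have "N = ennreal Q" unfolding Q_def using le_less_trans[OF ND ennreal_less_top] by (simp add: ennreal_enn2real)
  moreover have "0 \<le> Q" by (simp add: Q_def)
  moreover have "Q \<le> D" using ND \<open>N = ennreal Q\<close> D0 by simp
  then have "Q / (2 * \<sigma>\<^sup>2) \<le> (\<integral>\<omega>. f (X T \<omega>) \<partial>M) - loglap (sd T) f 0"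
    using \<sigma>2 unfolding D_def by (simp add: pos_divide_le_eq mult.commute)
  ultimately show ?thesis unfolding N_def by (intro exI[of _ Q]) auto
qed

lemma feedback_finite_AE:
  "AE \<omega> in M. \<omega> \<in> space M \<and> (\<integral>\<^sup>+s\<in>{0..T}. ennreal ((a s \<omega>)\<^sup>2) \<partial>lborel) < \<infinity>"
proof -
  obtain Q where "(\<integral>\<^sup>+\<omega>. (\<integral>\<^sup>+s\<in>{0..T}. ennreal ((a s \<omega>)\<^sup>2) \<partial>lborel) \<partial>M) = ennreal Q"
    using feedback_cost by blast
  then have "AE \<omega> in M. (\<integral>\<^sup>+s\<in>{0..T}. ennreal ((a s \<omega>)\<^sup>2) \<partial>lborel) \<noteq> \<infinity>"
    using measurable_set_nn_integral[OF feedback_progressive order_refl order_refl, of "\<lambda>x. x\<^sup>2"]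
    by (intro nn_integral_PInf_AE) auto
  then show ?thesis by (rule AE_mp) (auto simp: less_top)
qed

text \<open>Finite energy makes the integral continuous up to \<open>T\<close>, so the state
  equation passes to the limit; the left side of the limit is the controlled terminal state and the
  right side is \<open>X T\<close> by definition of the extension.\<close>

lemma feedback_terminal: "AE \<omega> in M. (LINT s:{0..T}|lborel. a s \<omega>) + \<sigma> * B T \<omega> = X T \<omega>"
  using feedback_finite_AE feedback_paths
proof eventually_elim
  case (elim \<omega>)
  have "(\<lambda>k. LINT s:{0..approach k}|lborel. a s \<omega>) \<longlonglongrightarrow> (LINT s:{0..T}|lborel. a s \<omega>)"
    by (rule progressive_integral_tendsto[OF feedback_progressive]) (use elim approach in \<open>auto simp: less_imp_le\<close>)
  moreover have "(\<lambda>k. B (approach k) \<omega>) \<longlonglongrightarrow> B T \<omega>"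
    by (rule continuous_on_tendsto_compose[of "{0..T}" "\<lambda>t. B t \<omega>", OF _ approach(3)])
      (use elim T_pos approach(1,2) in \<open>auto simp: less_imp_le\<close>)
  ultimately have "(\<lambda>k. (LINT s:{0..approach k}|lborel. a s \<omega>) + \<sigma> * B (approach k) \<omega>)
      \<longlonglongrightarrow> (LINT s:{0..T}|lborel. a s \<omega>) + \<sigma> * B T \<omega>"
    by (intro tendsto_intros)
  moreover have "(LINT s:{0..approach k}|lborel. a s \<omega>) + \<sigma> * B (approach k) \<omega> = X (approach k) \<omega>" for k
  proof -
    have "(LINT s:{0..approach k}|lborel. a s \<omega>) = (LINT s:{0..approach k}|lborel. drift f s (X s \<omega>))"
      using a approach(2)[of k] by (intro set_lebesgue_integral_cong) auto
    moreover have "approach k \<in> {0..<T}" using approach(1,2)[of k] by simp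
    ultimately show ?thesis using elim by auto
  qed
  moreover have "(\<lambda>k. X (approach k) \<omega>) \<longlonglongrightarrow> X T \<omega>"
    by (rule filterlim_compose[OF _ approach_at_left]) (use elim in simp)
  ultimately show ?case by (auto intro: LIMSEQ_unique)
qed

lemma feedback_admissible: "a \<in> admissible M F T"
proof -
  obtain Q where Q: "(\<integral>\<^sup>+\<omega>. (\<integral>\<^sup>+s\<in>{0..T}. ennreal ((a s \<omega>)\<^sup>2) \<partial>lborel) \<partial>M) = ennreal Q"
    using feedback_cost by blast
  have "(\<integral>\<^sup>+s\<in>{0..T}. ennreal \<bar>a s \<omega>\<bar> \<partial>lborel)
      \<le> ennreal T + (\<integral>\<^sup>+s\<in>{0..T}. ennreal ((a s \<omega>)\<^sup>2) \<partial>lborel)" if \<omega>: "\<omega> \<in> space M" for \<omega>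
  proof -
    have m: "(\<lambda>s. ennreal ((a s \<omega>)\<^sup>2) * indicator {0..T} s) \<in> borel_measurable lborel"
      by (rule measurable_square_section[OF feedback_progressive \<omega>]) simp_all
    have "\<bar>y\<bar> \<le> 1 + y\<^sup>2" for y :: real
      using zero_le_power2[of "\<bar>y\<bar> - 1"] zero_le_power2[of y] by (simp add: power2_diff)
    then have "ennreal \<bar>y\<bar> \<le> 1 + ennreal (y\<^sup>2)" for y
      by (simp add: ennreal_leI flip: ennreal_1 ennreal_plus)
    then have "(\<integral>\<^sup>+s\<in>{0..T}. ennreal \<bar>a s \<omega>\<bar> \<partial>lborel)
        \<le> (\<integral>\<^sup>+s. indicator {0..T} s + ennreal ((a s \<omega>)\<^sup>2) * indicator {0..T} s \<partial>lborel)"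
      by (intro nn_integral_mono) (auto simp: indicator_def)
    also have "\<dots> = ennreal T + (\<integral>\<^sup>+s\<in>{0..T}. ennreal ((a s \<omega>)\<^sup>2) \<partial>lborel)"
      using m T_pos by (subst nn_integral_add) auto
    finally show ?thesis .
  qed
  then have "(\<integral>\<^sup>+\<omega>. (\<integral>\<^sup>+s\<in>{0..T}. ennreal \<bar>a s \<omega>\<bar> \<partial>lborel) \<partial>M)
      \<le> (\<integral>\<^sup>+\<omega>. ennreal T + (\<integral>\<^sup>+s\<in>{0..T}. ennreal ((a s \<omega>)\<^sup>2) \<partial>lborel) \<partial>M)"
    by (intro nn_integral_mono)
  also have "\<dots> = ennreal T + ennreal Q"
    using measurable_set_nn_integral[OF feedback_progressive order_refl order_refl, of "\<lambda>x. x\<^sup>2"] emeasure_space_1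
    by (subst nn_integral_add) (auto simp: Q)
  also have "\<dots> < \<infinity>" by (simp add: less_top [symmetric])
  finally show ?thesis using feedback_progressive by (simp add: admissible_def)
qed

end

end

section \<open>The value function and the conditional law\<close>

context brownian_space
begin

lemma control_cost:
  assumes a: "progressively_measurable F T a" and t0: "0 \<le> t0" and c: "0 \<le> c"
  shows "(\<integral>\<^sup>+\<omega>. (\<integral>\<^sup>+s\<in>{t0..T}. ennreal (c * (a s \<omega>)\<^sup>2) \<partial>lborel) \<partial>M)
    = ennreal c * (\<integral>\<^sup>+\<omega>. (\<integral>\<^sup>+s\<in>{t0..T}. ennreal ((a s \<omega>)\<^sup>2) \<partial>lborel) \<partial>M)"
proof -
  have "(\<integral>\<^sup>+s\<in>{t0..T}. ennreal (c * (a s \<omega>)\<^sup>2) \<partial>lborel) = ennreal c * (\<integral>\<^sup>+s\<in>{t0..T}. ennreal ((a s \<omega>)\<^sup>2) \<partial>lborel)"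
    if "\<omega> \<in> space M" for \<omega>
    unfolding ennreal_mult[OF c zero_le_power2] mult.assoc
    by (rule nn_integral_cmult) (rule measurable_square_section[OF a that t0 order_refl])
  then have "(\<integral>\<^sup>+\<omega>. (\<integral>\<^sup>+s\<in>{t0..T}. ennreal (c * (a s \<omega>)\<^sup>2) \<partial>lborel) \<partial>M)
      = (\<integral>\<^sup>+\<omega>. ennreal c * (\<integral>\<^sup>+s\<in>{t0..T}. ennreal ((a s \<omega>)\<^sup>2) \<partial>lborel) \<partial>M)"
    by (rule nn_integral_cong)
  also have "\<dots> = ennreal c * (\<integral>\<^sup>+\<omega>. (\<integral>\<^sup>+s\<in>{t0..T}. ennreal ((a s \<omega>)\<^sup>2) \<partial>lborel) \<partial>M)"
    by (intro nn_integral_cmult measurable_set_nn_integral[OF a t0 order_refl, of "\<lambda>x. x\<^sup>2"]) simp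
  finally show ?thesis .
qed

text \<open>The factor \<open>2 * c * \<sigma>\<^sup>2\<close> links the units of the game to those
  of relative entropy.\<close>

lemma expected_payoff_scaled:
  assumes a: "progressively_measurable F T a" and t0: "0 \<le> t0" and c: "0 < c"
    and Q: "0 \<le> Q" "(\<integral>\<^sup>+\<omega>. (\<integral>\<^sup>+s\<in>{t0..T}. ennreal ((a s \<omega>)\<^sup>2) \<partial>lborel) \<partial>M) = ennreal Q"
  shows "expected_payoff M c T t0 (\<lambda>\<omega>. 2 * c * \<sigma>\<^sup>2 * Y \<omega>) a
    = ereal (2 * c * \<sigma>\<^sup>2 * ((\<integral>\<omega>. Y \<omega> \<partial>M) - Q / (2 * \<sigma>\<^sup>2)))"
proof -
  have "(\<integral>\<^sup>+\<omega>. (\<integral>\<^sup>+s\<in>{t0..T}. ennreal (c * (a s \<omega>)\<^sup>2) \<partial>lborel) \<partial>M) = ennreal (c * Q)"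
    using control_cost[OF a t0, of c] c Q by (simp add: ennreal_mult)
  then show ?thesis
    unfolding expected_payoff_def using c Q \<sigma>_pos by (simp add: enn2ereal_ennreal field_simps)
qed

lemma expected_payoff_le:
  assumes a: "progressively_measurable F T a" and t0: "0 \<le> t0" "t0 < T" and c: "0 < c"
    and f: "f \<in> borel_measurable borel" and K: "\<And>x. \<bar>f x\<bar> \<le> K"
    and usc: "\<And>x e. 0 < e \<Longrightarrow> \<exists>d>0. \<forall>y. \<bar>y - x\<bar> < d \<longrightarrow> f y < f x + e"
  shows "expected_payoff M c T t0
      (\<lambda>\<omega>. 2 * c * \<sigma>\<^sup>2 * f (x + (LINT s:{t0..T}|lborel. a s \<omega>) + \<sigma> * (B T \<omega> - B t0 \<omega>))) a
    \<le> ereal (2 * c * \<sigma>\<^sup>2 * loglap (sd (T - t0)) f x)"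
proof (cases "(\<integral>\<^sup>+\<omega>. (\<integral>\<^sup>+s\<in>{t0..T}. ennreal ((a s \<omega>)\<^sup>2) \<partial>lborel) \<partial>M)" rule: ennreal_cases)
  case (real Q)
  have "(\<integral>\<omega>. f (x + (LINT s:{t0..T}|lborel. a s \<omega>) + \<sigma> * (B T \<omega> - B t0 \<omega>)) \<partial>M) - Q / (2 * \<sigma>\<^sup>2)
      \<le> loglap (sd (T - t0)) f x"
    using upper_bound[OF a t0 real(2,1) f K usc, of x] by linarith
  then show ?thesis
    unfolding expected_payoff_scaled[OF a t0(1) c real] using c \<sigma>_pos by simp
next
  \<comment> \<open>A control of infinite energy is admissible but has payoff
    \<open>- \<infinity>\<close>, so it never competes.\<close>
  case top
  have "expected_payoff M c T t0 Y a = - \<infinity>" for Y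
    unfolding expected_payoff_def control_cost[OF a t0(1) less_imp_le[OF c]] top
    using c by (simp add: ennreal_mult_top)
  then show ?thesis by simp
qed

text \<open>The explicit formula for the supremum, valid for every filtration in which
  \<open>B\<close> is Brownian. It is needed at all points since the drift is a derivative of the
  supremum.\<close>

lemma value_eq:
  assumes t0: "0 \<le> t0" "t0 < T" and c: "0 < c"
    and f: "f \<in> borel_measurable borel" and K: "\<And>x. \<bar>f x\<bar> \<le> K"
    and cont: "countable {x. \<not> isCont f x}"
    and usc: "\<And>x e. 0 < e \<Longrightarrow> \<exists>d>0. \<forall>y. \<bar>y - x\<bar> < d \<longrightarrow> f y < f x + e"
  shows "(SUP a\<in>admissible M F T. expected_payoff M c T t0
      (\<lambda>\<omega>. 2 * c * \<sigma>\<^sup>2 * f (x + (LINT s:{t0..T}|lborel. a s \<omega>) + \<sigma> * (B T \<omega> - B t0 \<omega>))) a)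
    = ereal (2 * c * \<sigma>\<^sup>2 * loglap (sd (T - t0)) f x)" (is "(SUP a\<in>_. ?P a) = ereal (?k * ?v)")
proof (rule antisym)
  show "(SUP a\<in>admissible M F T. ?P a) \<le> ereal (?k * ?v)"
    by (rule SUP_least) (auto simp: admissible_def intro: expected_payoff_le[OF _ t0 c f K usc])
  have k: "0 < ?k" using c \<sigma>_pos by simp
  show "ereal (?k * ?v) \<le> (SUP a\<in>admissible M F T. ?P a)"
  proof (rule ereal_le_epsilon2)
    fix e :: real assume e: "0 < e"
    obtain a Q where a: "a \<in> admissible M F T" and Q: "0 \<le> Q"
      "(\<integral>\<^sup>+\<omega>. (\<integral>\<^sup>+s\<in>{t0..T}. ennreal ((a s \<omega>)\<^sup>2) \<partial>lborel) \<partial>M) = ennreal Q"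
      and low: "?v - e / ?k \<le> (\<integral>\<omega>. f (x + (LINT s:{t0..T}|lborel. a s \<omega>) + \<sigma> * (B T \<omega> - B t0 \<omega>)) \<partial>M) - Q / (2 * \<sigma>\<^sup>2)"
      using lower_bound[OF t0 K cont f divide_pos_pos[OF e k], of x] by blast
    have ap: "progressively_measurable F T a" using a by (simp add: admissible_def)
    have "?k * (?v - e / ?k) \<le> ?k * ((\<integral>\<omega>. f (x + (LINT s:{t0..T}|lborel. a s \<omega>) + \<sigma> * (B T \<omega> - B t0 \<omega>)) \<partial>M) - Q / (2 * \<sigma>\<^sup>2))"
      using low k by (intro mult_left_mono) auto
    moreover have "?k * (?v - e / ?k) = ?k * ?v - e"
      using c \<sigma>_pos by (simp add: right_diff_distrib)
    ultimately have "ereal (?k * ?v) \<le> ?P a + ereal e"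
      unfolding expected_payoff_scaled[OF ap t0(1) c Q] by simp
    also have "\<dots> \<le> (SUP a\<in>admissible M F T. ?P a) + ereal e"
      by (intro add_right_mono SUP_upper a)
    finally show "ereal (?k * ?v) \<le> (SUP a\<in>admissible M F T. ?P a) + ereal e" .
  qed
qed

end

text \<open>Monotonicity gives measurability and countably many jumps. Upper semicontinuity has two
  sides: to the right of \<open>x\<close> it is right-continuity of the distribution function, to
  the left it is monotonicity.\<close>

lemma (in real_distribution) rank_reward_scaled:
  fixes R :: "real \<Rightarrow> real"
  assumes R: "bounded (R ` {0..1})" "continuous_on {0..1} R" "mono_on {0..1} R" and k: "0 < k"
  defines "f \<equiv> \<lambda>x. rank_reward R M x / k"
  obtains K where "f \<in> borel_measurable borel" "\<And>x. \<bar>f x\<bar> \<le> K" "countable {x. \<not> isCont f x}"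
    "\<And>x e. 0 < e \<Longrightarrow> \<exists>d>0. \<forall>y. \<bar>y - x\<bar> < d \<longrightarrow> f y < f x + e"
proof -
  have F01: "cdf M x \<in> {0..1}" for x using cdf_nonneg[of x] cdf_bounded_prob[of x] by simp
  have mono: "mono f"
    unfolding f_def rank_reward_def
    using R(3) F01 cdf_nondecreasing k by (intro monoI divide_right_mono) (auto simp: mono_on_def)
  obtain b where b: "\<forall>u\<in>{0..1}. \<bar>R u\<bar> \<le> b"
    using R(1) unfolding bounded_iff by auto
  show thesis
  proof (rule that[of "b / k"])
    show "f \<in> borel_measurable borel" by (rule borel_measurable_mono[OF mono])
    show "countable {x. \<not> isCont f x}" by (rule mono_ctble_discont[OF mono])
    show "\<bar>f x\<bar> \<le> b / k" for x
      using bspec[OF b F01] k by (simp add: f_def rank_reward_def abs_divide divide_right_mono)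
    fix x e :: real assume e: "0 < e"
    have "(cdf M \<longlongrightarrow> cdf M x) (at_right x)"
      using cdf_is_right_cont[of x] by (simp add: continuous_within)
    then have "((\<lambda>y. R (cdf M y)) \<longlongrightarrow> R (cdf M x)) (at_right x)"
      by (rule continuous_on_tendsto_compose[OF R(2)]) (use F01 in auto)
    then have "(f \<longlongrightarrow> f x) (at_right x)"
      unfolding f_def rank_reward_def by (rule tendsto_divide[OF _ tendsto_const]) (use k in simp)
    then have "\<forall>\<^sub>F y in at_right x. f y < f x + e"
      by (rule order_tendstoD(2)) (use e in simp)
    then obtain z where z: "x < z" "\<And>y. x < y \<Longrightarrow> y < z \<Longrightarrow> f y < f x + e"
      by (auto simp: eventually_at_right_field)
    show "\<exists>d>0. \<forall>y. \<bar>y - x\<bar> < d \<longrightarrow> f y < f x + e"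
    proof (intro exI[of _ "z - x"] conjI allI impI)
      fix y assume y: "\<bar>y - x\<bar> < z - x"
      show "f y < f x + e"
      proof (cases "x < y")
        case True
        then show ?thesis using z(2)[of y] y by simp
      next
        case False
        then have "f y \<le> f x" using monoD[OF mono, of y x] by simp
        then show ?thesis using e by simp
      qed
    qed (use z in simp)
  qed
qed

text \<open>The cancellation: for \<open>q = - (\<sigma>0 * W T \<omega>)\<close> the argument on
  the right loses exactly the common noise contained in the terminal state.\<close>

lemma rank_reward_shift_measure:
  assumes "sets \<mu> = sets borel"
  shows "rank_reward R (shift_measure \<mu> q) x = rank_reward R \<mu> (x + q)"
proof -
  have "space \<mu> = UNIV" using sets_eq_imp_space_eq[OF assms] by simp
  moreover have "(\<lambda>x. x - q) \<in> borel_measurable \<mu>"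
    using assms by (simp cong: measurable_cong_sets)
  moreover have "(\<lambda>x. x - q) -` {..x} = {..x + q}" by auto
  ultimately show ?thesis
    by (simp add: rank_reward_def cdf_def shift_measure_def measure_distr)
qed

section \<open>Independence and the conditional law of the terminal state\<close>

context prob_space
begin

lemma subalgebra_history:
  assumes "\<And>s. s \<in> {0..t} \<Longrightarrow> V s \<in> borel_measurable M"
  shows "subalgebra M (history M V t)"
proof -
  have gen: "(\<Union>s\<in>{0..t}. preimages M (V s)) \<subseteq> sets M"
    unfolding preimages_def using assms by auto
  then have "sets (history M V t) = sigma_sets (space M) (\<Union>s\<in>{0..t}. preimages M (V s))"
    unfolding history_def using sets.space_closed by (intro sets_measure_of) blast
  then show ?thesis
    unfolding subalgebra_def using sets.sigma_sets_subset[OF gen] by (simp add: history_def space_measure_of_conv)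
qed

lemma measurable_history:
  assumes "s \<in> {0..t}"
  shows "V s \<in> borel_measurable (history M V t)"
proof (rule measurableI)
  fix A :: "real set" assume A: "A \<in> sets borel"
  have gen: "(\<Union>s\<in>{0..t}. preimages M (V s)) \<subseteq> Pow (space M)"
    unfolding preimages_def by auto
  have "V s -` A \<inter> space M \<in> (\<Union>s\<in>{0..t}. preimages M (V s))"
    using assms A unfolding preimages_def by blast
  then have "V s -` A \<inter> space M \<in> sets (history M V t)"
    unfolding history_def sets_measure_of[OF gen] by (rule sigma_sets.Basic)
  then show "V s -` A \<inter> space (history M V t) \<in> sets (history M V t)"
    by (simp add: history_def space_measure_of_conv)
qed simp

text \<open>Every event of the augmented history agrees with one of the history up to a null set.\<close>

lemma indep_augmented_history:
  assumes V: "subalgebra M (history M V t)" and ind: "indep_set (sets (history M V t)) (sets G)"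
    and X: "X \<in> borel_measurable (augmented_history M V t)" and XM: "X \<in> borel_measurable M"
  shows "indep_set (sets G) (preimages M X)"
proof -
  have gen: "sets (history M V t) \<union> null_sets M \<subseteq> Pow (space M)"
    using V sets.space_closed[of M] by (auto simp: subalgebra_def null_sets_def)
  have rep: "\<exists>S'\<in>sets (history M V t). AE \<omega> in M. \<omega> \<in> S \<longleftrightarrow> \<omega> \<in> S'"
    if "S \<in> sigma_sets (space M) (sets (history M V t) \<union> null_sets M)" for S
    using that
  proof (induction rule: sigma_sets.induct)
    case (Basic S)
    then show ?case
    proof
      assume "S \<in> null_sets M"
      then have "AE \<omega> in M. \<omega> \<notin> S" by (rule AE_not_in)
      then show ?thesis by (intro bexI[of _ "{}"]) auto
    qed auto
  next
    case Empty
    then show ?case by (intro bexI[of _ "{}"]) auto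
  next
    case (Compl S)
    then obtain S' where S': "S' \<in> sets (history M V t)" "AE \<omega> in M. \<omega> \<in> S \<longleftrightarrow> \<omega> \<in> S'" by auto
    have "space M - S' \<in> sets (history M V t)"
      using sets.compl_sets[OF S'(1)] V by (simp add: subalgebra_def)
    moreover have "AE \<omega> in M. \<omega> \<in> space M - S \<longleftrightarrow> \<omega> \<in> space M - S'"
      using S'(2) by eventually_elim auto
    ultimately show ?case by blast
  next
    case (Union S)
    then have "\<forall>i. \<exists>S'. S' \<in> sets (history M V t) \<and> (AE \<omega> in M. \<omega> \<in> S i \<longleftrightarrow> \<omega> \<in> S')" by blast
    then obtain S' where S': "\<And>i. S' i \<in> sets (history M V t)" "\<And>i. AE \<omega> in M. \<omega> \<in> S i \<longleftrightarrow> \<omega> \<in> S' i" by metis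
    have "AE \<omega> in M. \<forall>i. \<omega> \<in> S i \<longleftrightarrow> \<omega> \<in> S' i"
      using S'(2) by (simp add: AE_all_countable)
    then have "AE \<omega> in M. \<omega> \<in> (\<Union>i. S i) \<longleftrightarrow> \<omega> \<in> (\<Union>i. S' i)"
      by eventually_elim auto
    moreover have "(\<Union>i. S' i) \<in> sets (history M V t)" using S'(1) by auto
    ultimately show ?case by blast
  qed
  have GM: "sets G \<subseteq> events" and VM: "sets (history M V t) \<subseteq> events"
    using indep_setD_ev2[OF ind] indep_setD_ev1[OF ind] .
  show ?thesis
  proof (rule indep_setI[OF GM])
    show "preimages M X \<subseteq> events" unfolding preimages_def using XM by auto
    fix H S assume H: "H \<in> sets G" and S: "S \<in> preimages M X"
    have sp: "space (augmented_history M V t) = space M"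
      by (simp add: augmented_history_def space_measure_of_conv)
    obtain A where A: "A \<in> sets borel" "S = X -` A \<inter> space M"
      using S unfolding preimages_def by blast
    have SM: "S \<in> events" unfolding A(2) by (rule measurable_sets[OF XM A(1)])
    have "S \<in> sets (augmented_history M V t)"
      using measurable_sets[OF X A(1)] unfolding A(2) sp .
    then have "S \<in> sigma_sets (space M) (sets (history M V t) \<union> null_sets M)"
      unfolding augmented_history_def sets_measure_of[OF gen] .
    from rep[OF this] obtain S' where S': "S' \<in> sets (history M V t)" "AE \<omega> in M. \<omega> \<in> S \<longleftrightarrow> \<omega> \<in> S'" by blast
    have ev: "S' \<in> events" "H \<in> events" using S'(1) H VM GM by auto
    have "prob (H \<inter> S) = prob (H \<inter> S')"
      using S'(2) ev SM by (intro finite_measure_eq_AE) (auto elim!: eventually_mono)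
    also have "H \<inter> S' = S' \<inter> H" by blast
    also have "prob (S' \<inter> H) = prob S' * prob H" by (rule indep_setD[OF ind S'(1) H])
    also have "prob S' = prob S"
      using S'(2) ev SM by (intro finite_measure_eq_AE) (auto elim!: eventually_mono)
    finally show "prob (H \<inter> S) = prob H * prob S" by (simp add: mult.commute)
  qed
qed

text \<open>Given \<open>G\<close>, the variable \<open>V\<close> is frozen and \<open>X\<close>
  keeps its law, so the conditional law is a translate of that law; the minus sign turns the left
  shift into a move to the right by \<open>V\<close>. The decomposition of \<open>Z\<close> is asked
  only almost surely, as the terminal equation provides it.\<close>

lemma conditional_law_shift:
  assumes G: "subalgebra M G" and ind: "indep_set (sets G) (preimages M X)"
    and X: "X \<in> borel_measurable M" and V: "V \<in> borel_measurable G"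
    and Z: "Z \<in> borel_measurable M" "AE \<omega> in M. Z \<omega> = X \<omega> + V \<omega>"
  shows "conditional_law M G Z (\<lambda>\<omega>. shift_measure (distr M borel X) (- V \<omega>))"
  unfolding conditional_law_def
proof (intro conjI ballI)
  interpret finite_measure_subalgebra M G by unfold_locales (rule G)
  note X [measurable] and V [measurable] and Z(1) [measurable]
  have VM [measurable]: "V \<in> borel_measurable M" by (rule measurable_from_subalg[OF G V])
  let ?\<kappa> = "\<lambda>\<omega>. shift_measure (distr M borel X) (- V \<omega>)"
  show \<kappa>: "?\<kappa> \<in> G \<rightarrow>\<^sub>M prob_algebra borel"
  proof (rule measurable_prob_algebraI)
    show "prob_space (?\<kappa> \<omega>)" for \<omega>
      unfolding shift_measure_def by (intro prob_space.prob_space_distr prob_space_distr) auto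
    have "distr M borel X \<in> space (subprob_algebra borel)"
      by (auto simp: space_subprob_algebra intro!: prob_space_imp_subprob_space prob_space_distr)
    then have "(\<lambda>\<omega>. distr M borel X) \<in> G \<rightarrow>\<^sub>M subprob_algebra borel" by (rule measurable_const)
    then show "?\<kappa> \<in> G \<rightarrow>\<^sub>M subprob_algebra borel"
      unfolding shift_measure_def by (rule measurable_distr2[rotated]) measurable
  qed
  fix A :: "real set" assume A [measurable]: "A \<in> sets borel"
  have \<kappa>A: "(\<lambda>\<omega>. measure (?\<kappa> \<omega>) A) \<in> borel_measurable G"
    by (rule measurable_compose[OF \<kappa> measurable_measure_prob_algebra[OF A]])
  have m: "measure (?\<kappa> \<omega>) A = (\<integral>\<omega>'. indicator A (X \<omega>' + V \<omega>) \<partial>M)" for \<omega>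
  proof -
    have "(\<integral>\<omega>'. indicator A (X \<omega>' + V \<omega>) \<partial>M) = (\<integral>x. (indicator A x :: real) \<partial>distr M borel (\<lambda>\<omega>'. X \<omega>' + V \<omega>))"
      by (rule integral_distr[where g="\<lambda>\<omega>'. X \<omega>' + V \<omega>" and f="indicator A", symmetric]) measurable
    also have "\<dots> = measure (distr M borel (\<lambda>\<omega>'. X \<omega>' + V \<omega>)) A" by simp
    also have "distr M borel (\<lambda>\<omega>'. X \<omega>' + V \<omega>) = ?\<kappa> \<omega>"
      unfolding shift_measure_def by (subst distr_distr) (auto simp: comp_def)
    finally show ?thesis by simp
  qed
  have "AE \<omega> in M. real_cond_exp M G (indicator (Z -` A \<inter> space M)) \<omega> = measure (?\<kappa> \<omega>) A"
  proof (rule real_cond_exp_charact)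
    show "integrable M (indicator (Z -` A \<inter> space M) :: 'a \<Rightarrow> real)"
      by (intro integrable_real_indicator) (auto simp: less_top [symmetric])
    show "(\<lambda>\<omega>. measure (?\<kappa> \<omega>) A) \<in> borel_measurable G" by (rule \<kappa>A)
    have prob\<kappa>: "prob_space (?\<kappa> \<omega>)" for \<omega>
      unfolding shift_measure_def by (intro prob_space.prob_space_distr prob_space_distr) auto
    show "integrable M (\<lambda>\<omega>. measure (?\<kappa> \<omega>) A)"
      by (rule integrable_const_bound[of _ 1])
        (use measurable_from_subalg[OF G \<kappa>A] prob_space.prob_le_1[OF prob\<kappa>] in auto)
    fix H assume H: "H \<in> sets G"
    have HM [measurable]: "H \<in> sets M" using H G by (auto simp: subalgebra_def)
    \<comment> \<open>The truth value of \<open>\<omega> \<in> H\<close> is carried as a second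
      frozen variable, so the integral over \<open>H\<close> is a single use of
      \<open>integral_independent\<close>.\<close>
    define \<phi> :: "bool \<times> real \<Rightarrow> real \<Rightarrow> real" where
      "\<phi> y x = (if fst y then indicator A (x + snd y) else 0)" for y x
    have "(\<integral>\<omega>\<in>H. indicator (Z -` A \<inter> space M) \<omega> \<partial>M) = (\<integral>\<omega>. \<phi> (\<omega> \<in> H, V \<omega>) (X \<omega>) \<partial>M)"
      unfolding set_lebesgue_integral_def
    proof (rule integral_cong_AE)
      show "AE \<omega> in M. indicator H \<omega> *\<^sub>R indicator (Z -` A \<inter> space M) \<omega> = \<phi> (\<omega> \<in> H, V \<omega>) (X \<omega>)"
        using Z(2) AE_space by eventually_elim (auto simp: \<phi>_def indicator_def)
      show "(\<lambda>\<omega>. \<phi> (\<omega> \<in> H, V \<omega>) (X \<omega>)) \<in> borel_measurable M"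
        unfolding \<phi>_def fst_conv snd_conv by measurable
    qed measurable
    also have "\<dots> = (\<integral>\<omega>. (\<integral>\<omega>'. \<phi> (\<omega> \<in> H, V \<omega>) (X \<omega>') \<partial>M) \<partial>M)"
    proof (rule integral_independent[OF G ind X])
      have "(\<lambda>\<omega>. \<omega> \<in> H) \<in> G \<rightarrow>\<^sub>M count_space UNIV"
        using H by simp
      then show "(\<lambda>\<omega>. (\<omega> \<in> H, V \<omega>)) \<in> G \<rightarrow>\<^sub>M count_space UNIV \<Otimes>\<^sub>M borel"
        by (rule measurable_Pair) (rule V)
      show "(\<lambda>(y, x). \<phi> y x) \<in> borel_measurable ((count_space UNIV \<Otimes>\<^sub>M borel) \<Otimes>\<^sub>M borel)"
        unfolding \<phi>_def by measurable
      show "\<bar>\<phi> y x\<bar> \<le> 1" for y x by (simp add: \<phi>_def indicator_def)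
    qed
    also have "\<dots> = (\<integral>\<omega>\<in>H. measure (?\<kappa> \<omega>) A \<partial>M)"
      unfolding set_lebesgue_integral_def m
      by (intro Bochner_Integration.integral_cong) (auto simp: \<phi>_def indicator_def)
    finally show "(\<integral>\<omega>\<in>H. indicator (Z -` A \<inter> space M) \<omega> \<partial>M) = (\<integral>\<omega>\<in>H. measure (?\<kappa> \<omega>) A \<partial>M)" .
  qed
  then show "AE \<omega> in M. measure (?\<kappa> \<omega>) A = real_cond_exp M G (indicator (Z -` A \<inter> space M)) \<omega>"
    by eventually_elim simp
qed

end

theorem proposition4p1:
  fixes M :: "'a measure" and F :: "real \<Rightarrow> 'a measure"
    and B W :: "real \<Rightarrow> 'a \<Rightarrow> real"
    and T c \<sigma> \<sigma>0 :: real and R :: "real \<Rightarrow> real" and \<mu>bar :: "real measure"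
  assumes "T > 0" and "c > 0" and "\<sigma> > 0" and "\<sigma>0 > 0"
    and "prob_space M"
    and "filtration (space M) F" and "\<And>t. subalgebra M (F t)"
    and "brownian_motion M F T B" and "brownian_motion M F T W"
    and "prob_space.indep_set M (sets (history M B T)) (sets (history M W T))"
    and "bounded (R ` {0..1})" and "continuous_on {0..1} R" and "mono_on {0..1} R"
    and "mfg0_equilibrium M F B T c \<sigma> R \<mu>bar"
  defines "\<mu> \<equiv> \<lambda>\<omega>. shift_measure \<mu>bar (- (\<sigma>0 * W T \<omega>))"
  shows "mfg_cn_equilibrium M F B W T c \<sigma> \<sigma>0 R \<mu> \<and>
    (\<forall>X. mfg0_optimal_state M F B T c \<sigma> R \<mu>bar X \<longrightarrow>
       mfg_cn_optimal_control M F B W T c \<sigma> \<sigma>0 R \<mu> (mfg0_optimal_control M F B T c \<sigma> R \<mu>bar X))"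
proof -
  interpret brownian_space M F T B \<sigma>
    by (intro brownian_space.intro brownian_space_axioms.intro assms)
  interpret WB: brownian_space M F T W \<sigma>
    by (intro brownian_space.intro brownian_space_axioms.intro assms)
  have eqm: "sets \<mu>bar = sets borel" "prob_space \<mu>bar"
    using assms(14) by (auto simp: mfg0_equilibrium_def)
  interpret \<mu>: real_distribution \<mu>bar
    by (intro real_distribution.intro real_distribution_axioms.intro eqm)
  define k where "k = 2 * c * \<sigma>\<^sup>2"
  have k: "0 < k" using assms(2,3) by (simp add: k_def)
  define f where "f x = rank_reward R \<mu>bar x / k" for x
  obtain K where f [measurable]: "f \<in> borel_measurable borel" and K: "\<And>x. \<bar>f x\<bar> \<le> K"
    and cont: "countable {x. \<not> isCont f x}"
    and usc: "\<And>x e. 0 < e \<Longrightarrow> \<exists>d>0. \<forall>y. \<bar>y - x\<bar> < d \<longrightarrow> f y < f x + e"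
    using \<mu>.rank_reward_scaled[OF assms(11-13) k] unfolding f_def[abs_def] by blast
  have rf: "rank_reward R \<mu>bar x = 2 * c * \<sigma>\<^sup>2 * f x" for x
    using assms(2,3) by (simp add: f_def k_def)
  have val: "mfg0_value M F B T c \<sigma> R \<mu>bar t x = k * loglap (sd (T - t)) f x" if "0 \<le> t" "t < T" for t x
  proof -
    have "(SUP a\<in>admissible M F T. expected_payoff M c T t
          (\<lambda>\<omega>. rank_reward R \<mu>bar (mfg0_terminal_state B T \<sigma> t x a \<omega>)) a)
        = ereal (2 * c * \<sigma>\<^sup>2 * loglap (sd (T - t)) f x)"
      unfolding mfg0_terminal_state_def rf by (rule value_eq[OF that assms(2) f K cont usc])
    then show ?thesis by (simp add: mfg0_value_def k_def)
  qed
  \<comment> \<open>Only now is the derivative of the supremum known: \<open>val\<close> holds for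
    all \<open>x\<close> at the given time, so it may be differentiated.\<close>
  have drift: "mfg0_drift M F B T c \<sigma> R \<mu>bar t x = drift f t x" if "0 \<le> t" "t < T" for t x
  proof -
    have "0 < sd (T - t)" using that assms(3) by simp
    from DERIV_cmult[OF has_real_derivative_loglap[OF f K this], of k x]
    have "deriv (\<lambda>x. k * loglap (sd (T - t)) f x) x = k * score (sd (T - t)) f x"
      by (rule DERIV_imp_deriv)
    then show ?thesis
      unfolding mfg0_drift_def val[OF that, abs_def] using assms(2) by (simp add: k_def drift_def)
  qed
  \<comment> \<open>The general estimates use increments from the starting time, and
    \<open>B 0\<close> vanishes only almost surely.\<close>
  have B0: "AE \<omega> in M. B 0 \<omega> = 0" using assms(8) by (simp add: brownian_motion_def)
  have BM [measurable]: "B T \<in> borel_measurable M" "B 0 \<in> borel_measurable M"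
    using assms(1) by (auto intro: measurable_B_M)
  \<comment> \<open>The common noise disappears pathwise, hence for every control, including those
    that depend on \<open>W\<close>.\<close>
  have payoff: "mfg_cn_payoff M B W T c \<sigma> \<sigma>0 R \<mu> b
      = expected_payoff M c T 0 (\<lambda>\<omega>. 2 * c * \<sigma>\<^sup>2 * f ((LINT s:{0..T}|lborel. b s \<omega>) + \<sigma> * B T \<omega>)) b" for b
    unfolding mfg_cn_payoff_def \<mu>_def rank_reward_shift_measure[OF eqm(1)] mfg_cn_terminal_state_def
    by (simp add: rf)
  have upper: "mfg_cn_payoff M B W T c \<sigma> \<sigma>0 R \<mu> b \<le> ereal (2 * c * \<sigma>\<^sup>2 * loglap (sd T) f 0)"
    if "b \<in> admissible M F T" for b
  proof -
    have b: "progressively_measurable F T b" using that by (simp add: admissible_def)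
    have [measurable]: "(\<lambda>\<omega>. LINT s:{0..T}|lborel. b s \<omega>) \<in> borel_measurable M"
      using measurable_F_M[OF measurable_set_integral[OF b]] assms(1) by simp
    have "(\<integral>\<omega>. 2 * c * \<sigma>\<^sup>2 * f ((LINT s:{0..T}|lborel. b s \<omega>) + \<sigma> * B T \<omega>) \<partial>M)
        = (\<integral>\<omega>. 2 * c * \<sigma>\<^sup>2 * f (0 + (LINT s:{0..T}|lborel. b s \<omega>) + \<sigma> * (B T \<omega> - B 0 \<omega>)) \<partial>M)"
    proof (rule integral_cong_AE)
      show "AE \<omega> in M. 2 * c * \<sigma>\<^sup>2 * f ((LINT s:{0..T}|lborel. b s \<omega>) + \<sigma> * B T \<omega>)
          = 2 * c * \<sigma>\<^sup>2 * f (0 + (LINT s:{0..T}|lborel. b s \<omega>) + \<sigma> * (B T \<omega> - B 0 \<omega>))"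
        using B0 by eventually_elim simp
    qed measurable
    then have "mfg_cn_payoff M B W T c \<sigma> \<sigma>0 R \<mu> b = expected_payoff M c T 0
        (\<lambda>\<omega>. 2 * c * \<sigma>\<^sup>2 * f (0 + (LINT s:{0..T}|lborel. b s \<omega>) + \<sigma> * (B T \<omega> - B 0 \<omega>))) b"
      unfolding payoff expected_payoff_def by (simp only:)
    also have "\<dots> \<le> ereal (2 * c * \<sigma>\<^sup>2 * loglap (sd (T - 0)) f 0)"
      by (rule expected_payoff_le[OF b order_refl assms(1,2) f K usc])
    finally show ?thesis by simp
  qed
  have optimal: "mfg_cn_optimal_control M F B W T c \<sigma> \<sigma>0 R \<mu> (mfg0_optimal_control M F B T c \<sigma> R \<mu>bar X)"
    and terminal: "AE \<omega> in M. (LINT s:{0..T}|lborel. mfg0_optimal_control M F B T c \<sigma> R \<mu>bar X s \<omega>) + \<sigma> * B T \<omega> = X T \<omega>"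
    if X: "mfg0_optimal_state M F B T c \<sigma> R \<mu>bar X" for X
  proof -
    define a where "a = mfg0_optimal_control M F B T c \<sigma> R \<mu>bar X"
    have Xp: "progressively_measurable F T X" using X by (simp add: mfg0_optimal_state_def)
    have a: "a s \<omega> = drift f s (X s \<omega>)" if "0 \<le> s" "s < T" for s \<omega>
      using that by (simp add: a_def mfg0_optimal_control_def drift)
    have aT: "a T \<omega> = 0" for \<omega> by (simp add: a_def mfg0_optimal_control_def)
    have "AE \<omega> in M. X 0 \<omega> = 0 \<and>
        (\<forall>t\<in>{0..<T}.
           set_integrable lborel {0..t} (\<lambda>s. mfg0_drift M F B T c \<sigma> R \<mu>bar s (X s \<omega>)) \<and>
           X t \<omega> = (LINT s:{0..t}|lborel. mfg0_drift M F B T c \<sigma> R \<mu>bar s (X s \<omega>)) + \<sigma> * B t \<omega>) \<and>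
        ((\<lambda>t. X t \<omega>) \<longlongrightarrow> X T \<omega>) (at_left T)"
      using X by (simp add: mfg0_optimal_state_def)
    then have ae: "AE \<omega> in M. X 0 \<omega> = 0 \<and>
      (\<forall>t\<in>{0..<T}. set_integrable lborel {0..t} (\<lambda>s. drift f s (X s \<omega>)) \<and>
        X t \<omega> = (LINT s:{0..t}|lborel. drift f s (X s \<omega>)) + \<sigma> * B t \<omega>) \<and>
      ((\<lambda>t. X t \<omega>) \<longlongrightarrow> X T \<omega>) (at_left T)"
    proof eventually_elim
      case (elim \<omega>)
      have "set_integrable lborel {0..t} (\<lambda>s. mfg0_drift M F B T c \<sigma> R \<mu>bar s (X s \<omega>))
          = set_integrable lborel {0..t} (\<lambda>s. drift f s (X s \<omega>))"
        "(LINT s:{0..t}|lborel. mfg0_drift M F B T c \<sigma> R \<mu>bar s (X s \<omega>)) = (LINT s:{0..t}|lborel. drift f s (X s \<omega>))"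
        if "t \<in> {0..<T}" for t
      proof -
        have d: "mfg0_drift M F B T c \<sigma> R \<mu>bar s (X s \<omega>) = drift f s (X s \<omega>)" if "s \<in> {0..t}" for s
          using that \<open>t \<in> {0..<T}\<close> by (intro drift) auto
        show "set_integrable lborel {0..t} (\<lambda>s. mfg0_drift M F B T c \<sigma> R \<mu>bar s (X s \<omega>))
            = set_integrable lborel {0..t} (\<lambda>s. drift f s (X s \<omega>))"
          by (rule set_integrable_cong[OF refl refl d])
        show "(LINT s:{0..t}|lborel. mfg0_drift M F B T c \<sigma> R \<mu>bar s (X s \<omega>)) = (LINT s:{0..t}|lborel. drift f s (X s \<omega>))"
          by (rule set_lebesgue_integral_cong) (use d in auto)
      qed
      with elim show ?case by simp
    qed
    note ctx = f K cont usc Xp ae a aT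
    have adm: "a \<in> admissible M F T" by (rule feedback_admissible[OF ctx])
    have state_T: "AE \<omega> in M. (LINT s:{0..T}|lborel. a s \<omega>) + \<sigma> * B T \<omega> = X T \<omega>"
      by (rule feedback_terminal[OF ctx])
    then show "AE \<omega> in M. (LINT s:{0..T}|lborel. mfg0_optimal_control M F B T c \<sigma> R \<mu>bar X s \<omega>) + \<sigma> * B T \<omega> = X T \<omega>"
      unfolding a_def .
    obtain Q where Q: "0 \<le> Q" "(\<integral>\<^sup>+\<omega>. (\<integral>\<^sup>+s\<in>{0..T}. ennreal ((a s \<omega>)\<^sup>2) \<partial>lborel) \<partial>M) = ennreal Q"
      and le: "loglap (sd T) f 0 \<le> (\<integral>\<omega>. f (X T \<omega>) \<partial>M) - Q / (2 * \<sigma>\<^sup>2)"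
      using feedback_cost[OF ctx] by blast
    have ap: "progressively_measurable F T a" using adm by (simp add: admissible_def)
    have [measurable]: "(\<lambda>\<omega>. LINT s:{0..T}|lborel. a s \<omega>) \<in> borel_measurable M"
      using measurable_F_M[OF measurable_set_integral[OF ap]] assms(1) by simp
    have [measurable]: "X T \<in> borel_measurable M"
      using measurable_F_M[OF progressive_time[OF Xp]] assms(1) by simp
    have "(\<integral>\<omega>. f ((LINT s:{0..T}|lborel. a s \<omega>) + \<sigma> * B T \<omega>) \<partial>M) = (\<integral>\<omega>. f (X T \<omega>) \<partial>M)"
    proof (rule integral_cong_AE)
      show "AE \<omega> in M. f ((LINT s:{0..T}|lborel. a s \<omega>) + \<sigma> * B T \<omega>) = f (X T \<omega>)"
        using state_T by eventually_elim simp
    qed measurable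
    then have "mfg_cn_payoff M B W T c \<sigma> \<sigma>0 R \<mu> a = ereal (2 * c * \<sigma>\<^sup>2 * ((\<integral>\<omega>. f (X T \<omega>) \<partial>M) - Q / (2 * \<sigma>\<^sup>2)))"
      unfolding payoff expected_payoff_scaled[OF ap order_refl assms(2) Q] by simp
    then have lower: "ereal (2 * c * \<sigma>\<^sup>2 * loglap (sd T) f 0) \<le> mfg_cn_payoff M B W T c \<sigma> \<sigma>0 R \<mu> a"
      using le assms(2) by (simp add: mult_left_mono)
    have "mfg_cn_payoff M B W T c \<sigma> \<sigma>0 R \<mu> a = (SUP b\<in>admissible M F T. mfg_cn_payoff M B W T c \<sigma> \<sigma>0 R \<mu> b)"
    proof (rule antisym)
      show "mfg_cn_payoff M B W T c \<sigma> \<sigma>0 R \<mu> a \<le> (SUP b\<in>admissible M F T. mfg_cn_payoff M B W T c \<sigma> \<sigma>0 R \<mu> b)"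
        by (rule SUP_upper[OF adm])
      have "(SUP b\<in>admissible M F T. mfg_cn_payoff M B W T c \<sigma> \<sigma>0 R \<mu> b) \<le> ereal (2 * c * \<sigma>\<^sup>2 * loglap (sd T) f 0)"
        by (rule SUP_least) (rule upper)
      then show "(SUP b\<in>admissible M F T. mfg_cn_payoff M B W T c \<sigma> \<sigma>0 R \<mu> b) \<le> mfg_cn_payoff M B W T c \<sigma> \<sigma>0 R \<mu> a"
        using lower by (rule order_trans)
    qed
    with adm show "mfg_cn_optimal_control M F B W T c \<sigma> \<sigma>0 R \<mu> (mfg0_optimal_control M F B T c \<sigma> R \<mu>bar X)"
      unfolding mfg_cn_optimal_control_def a_def by blast
  qed
  obtain X where X: "mfg0_optimal_state M F B T c \<sigma> R \<mu>bar X" "\<mu>bar = distr M borel (X T)"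
    using assms(14) by (auto simp: mfg0_equilibrium_def)
  define a where "a = mfg0_optimal_control M F B T c \<sigma> R \<mu>bar X"
  have BW: "subalgebra M (history M B T)" "subalgebra M (history M W T)"
    by (auto intro!: subalgebra_history measurable_B_M WB.measurable_B_M)
  have Xp: "progressively_measurable F T X" and Xaug: "X T \<in> borel_measurable (augmented_history M B T)"
    using X(1) assms(1) by (auto simp: mfg0_optimal_state_def)
  have XT: "X T \<in> borel_measurable M"
    using measurable_F_M[OF progressive_time[OF Xp]] assms(1) by simp
  have ap: "progressively_measurable F T a"
    using optimal[OF X(1)] by (simp add: mfg_cn_optimal_control_def admissible_def a_def)
  have [measurable]: "(\<lambda>\<omega>. LINT s:{0..T}|lborel. a s \<omega>) \<in> borel_measurable M"
    using measurable_F_M[OF measurable_set_integral[OF ap]] assms(1) by simp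
  have WT [measurable]: "W T \<in> borel_measurable (history M W T)"
    using assms(1) by (intro measurable_history) simp
  have [measurable]: "W T \<in> borel_measurable M" by (rule measurable_from_subalg[OF BW(2) WT])
  have law: "conditional_law M (history M W T) (mfg_cn_terminal_state B W T \<sigma> \<sigma>0 a) \<mu>"
    unfolding \<mu>_def X(2)
  proof (rule conditional_law_shift[OF BW(2) _ XT])
    \<comment> \<open>The feedback state is strong, that is, known from \<open>B\<close> up to null
      sets; this is what decouples it from \<open>W\<close>.\<close>
    show "indep_set (sets (history M W T)) (preimages M (X T))"
      by (rule indep_augmented_history[OF BW(1) assms(10) Xaug XT])
    show "(\<lambda>\<omega>. \<sigma>0 * W T \<omega>) \<in> borel_measurable (history M W T)" by measurable
    show "mfg_cn_terminal_state B W T \<sigma> \<sigma>0 a \<in> borel_measurable M"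
      unfolding mfg_cn_terminal_state_def[abs_def] by measurable
    show "AE \<omega> in M. mfg_cn_terminal_state B W T \<sigma> \<sigma>0 a \<omega> = X T \<omega> + \<sigma>0 * W T \<omega>"
      using terminal[OF X(1)] by eventually_elim (simp add: mfg_cn_terminal_state_def a_def)
  qed
  have "mfg_cn_equilibrium M F B W T c \<sigma> \<sigma>0 R \<mu>"
    unfolding mfg_cn_equilibrium_def
  proof (intro conjI exI[of _ a])
    show "\<mu> \<in> history M W T \<rightarrow>\<^sub>M prob_algebra borel" using law by (simp add: conditional_law_def)
    show "mfg_cn_optimal_control M F B W T c \<sigma> \<sigma>0 R \<mu> a" unfolding a_def by (rule optimal[OF X(1)])
  qed (rule law)
  with optimal show ?thesis by blast
qed

end
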